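(* Let $\mathbb{G}$ be a Carnot group of step $2$ given by $$\mathbb{G} = V \oplus \frac{\bigwedge^2 V}{W}$$ for some linear subspace $W \le \bigwedge^2 V$. Let $W^{\perp_2}$ be the orthogonal complement of $W$ in $\bigwedge^2 V$ with respect to an adequate scalar product, and let $$\tilde{k} := \min \{ \mathrm{rank}(\omega) \mid \omega \in W^{\perp_2} \setminus \{0\}\}.$$ Then the abnormal set $\mathrm{Abn}_{\mathbb{G}}$ is contained in an algebraic variety of codimension $2\tilde{k}+1$ in $\mathbb{G}$. In particular, the abnormal set $\mathrm{Abn}_{\mathbb{G}}$ has codimension at least $3$.
   Context: A Carnot group $\mathbb{G}$ of rank $r$ and step $s$ is a connected, simply connected, nilpotent Lie group whose Lie algebra $\mathfrak{g}$ (identified with the tangent space at the identity $e$) admits a stratification $\mathfrak{g}=\mathfrak{g}_1\oplus\dots\oplus\mathfrak{g}_s$ with $\mathfrak{g}_{i+1}=[\mathfrak{g},\mathfrak{g}_i]$ for $1\le i\le s-1$, $[\mathfrak{g},\mathfrak{g}_s]=\{0\}$ and $\dim\mathfrak{g}_1=r$. The exponential map is a diffeomorphism and is used to identify $\mathbb{G}$ with $\mathfrak{g}$ (so that $\mathbb{G}$ is regarded as a vector space when speaking of algebraic varieties in $\mathbb{G}$). Endpoint map and abnormal set. For $u\in L^1([0,1],\mathfrak{g}_1)$ let $\gamma_u:[0,1]\to\mathbb{G}$ be the absolutely continuous curve with $\gamma_u(0)=e$ and $\gamma_u'(t)=(dL_{\gamma_u(t)})_e u(t)$ for a.e. $t$,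 where $L_g$ is left translation by $g$. The endpoint map is $F:L^1([0,1],\mathfrak{g}_1)\to\mathbb{G}$, $F(u)=\gamma_u(1)$. A control $u$ is singular if the differential $d_uF$ is not surjective. The abnormal set is the set of critical values of $F$, $\mathrm{Abn}_{\mathbb{G}}=\{\gamma_u(1)\mid u \text{ is a singular control}\}$. Step 2 groups as quotients. Let $r\ge 2$. The free Lie algebra of step $2$ and rank $r$ is $\mathfrak{f}_r=V\oplus\bigwedge^2V$ with $\dim V=r$ (first layer $V$, second layer $\bigwedge^2V$, bracket $[v,w]=v\wedge w$ for $v,w\in V$, all other brackets zero). Every step 2 Carnot group of rank $r$ has Lie algebra $\mathfrak{g}=\mathfrak{g}_1\oplus\mathfrak{g}_2$ that is a quotient of $\mathfrak{f}_r$ by a linear subspace $W\le\bigwedge^2V$, so $\mathfrak{g}_1=V$, $\mathfrak{g}_2=\bigwedge^2V/W$; this is the meaning of $\mathbb{G}=V\oplus \bigwedge^2V/W$. Adequate scalar product. Given a scalar product on $V$, there is a unique extension to a scalar product on $\mathfrak{f}_r=V\oplus\bigwedge^2V$ such that for every orthonormal basis $\{e_1,\dots,e_r\}$ of $V$ the basis $\{e_1,\dots,e_r\}\cup\{e_i\wedge e_j\mid i<j\}$ is orthonormal. Any such scalar product on $\mathfrak{f}_r$ is called adequate. For $B\le\bigwedge^2V$, $B^{\perp_2}:=B^\perp\cap\bigwedge^2V$. Rank. For $\omega\in\bigwedge^2V$, $\mathrm{rank}(\omega)$ is the smallest integer $k$ such that $\omega=v_1\wedge v_2+\dots+v_{2k-1}\wedge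 v_{2k}$ for some $v_1,\dots,v_{2k}\in V$. *)

theory Defs
  imports "HOL-Analysis.Analysis"
begin

section \<open>The space of controls\<close>

text \<open>The normed space $L^1([0,1],V)$ of Lebesgue integrable functions modulo almost everywhere
  equality. \<open>rep_control u\<close> is some representative of the class \<open>u\<close>.\<close>

definition ae_equal :: "(real \<Rightarrow> 'a::{banach, second_countable_topology}) \<Rightarrow> (real \<Rightarrow> 'a) \<Rightarrow> bool" where
  "ae_equal f g \<longleftrightarrow> integrable (lebesgue_on {0..1}) f \<and> integrable (lebesgue_on {0..1}) g \<and>
     (AE t in lebesgue_on {0..1}. f t = g t)"

quotient_type (overloaded) 'a control = "real \<Rightarrow> 'a::{banach, second_countable_topology}"
  / partial: "ae_equal"
  morphisms rep_control abs_control
proof (rule part_equivpI)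
  show "\<exists>f :: real \<Rightarrow> 'a. ae_equal f f"
    by (rule exI[of _ "\<lambda>_. 0"]) (simp add: ae_equal_def)
  show "symp (ae_equal :: (real \<Rightarrow> 'a) \<Rightarrow> _)"
    by (auto intro!: sympI simp: ae_equal_def elim: eventually_mono)
  show "transp (ae_equal :: (real \<Rightarrow> 'a) \<Rightarrow> _)"
    by (rule transpI) (auto simp: ae_equal_def elim: eventually_elim2)
qed

instantiation control :: ("{banach, second_countable_topology}") real_normed_vector
begin

lift_definition zero_control :: "'a control" is "\<lambda>_. 0"
  by (simp add: ae_equal_def)

lift_definition plus_control :: "'a control \<Rightarrow> 'a control \<Rightarrow> 'a control" is "\<lambda>f g t. f t + g t"
  by (auto simp: ae_equal_def elim: eventually_elim2)

lift_definition minus_control :: "'a control \<Rightarrow> 'a control \<Rightarrow> 'a control" is "\<lambda>f g t. f t - g t"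
  by (auto simp: ae_equal_def elim: eventually_elim2)

lift_definition uminus_control :: "'a control \<Rightarrow> 'a control" is "\<lambda>f t. - f t"
  by (auto simp: ae_equal_def elim: eventually_mono)

lift_definition scaleR_control :: "real \<Rightarrow> 'a control \<Rightarrow> 'a control" is "\<lambda>c f t. c *\<^sub>R f t"
  by (auto simp: ae_equal_def elim: eventually_mono)

lift_definition norm_control :: "'a control \<Rightarrow> real" is
  "\<lambda>f. integral\<^sup>L (lebesgue_on {0..1}) (\<lambda>t. norm (f t))"
proof -
  fix f g :: "real \<Rightarrow> 'a"
  assume fg: "ae_equal f g"
  show "integral\<^sup>L (lebesgue_on {0..1}) (\<lambda>t. norm (f t)) = integral\<^sup>L (lebesgue_on {0..1}) (\<lambda>t. norm (g t))"
  proof (rule integral_cong_AE)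
    show "AE t in lebesgue_on {0..1}. norm (f t) = norm (g t)"
      using fg by (auto simp: ae_equal_def elim: eventually_mono)
  qed (use fg in \<open>auto simp: ae_equal_def\<close>)
qed

definition dist_control :: "'a control \<Rightarrow> 'a control \<Rightarrow> real" where
  "dist_control u v = norm (u - v)"

definition sgn_control :: "'a control \<Rightarrow> 'a control" where
  "sgn_control u = inverse (norm u) *\<^sub>R u"

definition uniformity_control :: "('a control \<times> 'a control) filter" where
  "uniformity_control = (INF e\<in>{0<..}. principal {(u, v). dist u v < e})"

definition open_control :: "'a control set \<Rightarrow> bool" where
  "open_control U \<longleftrightarrow> (\<forall>u\<in>U. eventually (\<lambda>(u', v). u' = u \<longrightarrow> v \<in> U) uniformity)"

instance
proof
  fix u v w :: "'a control" and a b :: real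
  show "u + v + w = u + (v + w)"
    by transfer (simp add: ae_equal_def add.assoc)
  show "u + v = v + u"
    by transfer (simp add: ae_equal_def add.commute)
  show "0 + u = u"
    by transfer (simp add: ae_equal_def)
  show "- u + u = 0"
    by transfer (simp add: ae_equal_def)
  show "u - v = u + - v"
    by transfer (simp add: ae_equal_def)
  show "a *\<^sub>R (u + v) = a *\<^sub>R u + a *\<^sub>R v"
    by transfer (simp add: ae_equal_def scaleR_add_right)
  show "(a + b) *\<^sub>R u = a *\<^sub>R u + b *\<^sub>R u"
    by transfer (simp add: ae_equal_def scaleR_add_left)
  show "a *\<^sub>R b *\<^sub>R u = (a * b) *\<^sub>R u"
    by transfer (simp add: ae_equal_def)
  show "1 *\<^sub>R u = u"
    by transfer (simp add: ae_equal_def)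
  show "dist u v = norm (u - v)"
    by (simp add: dist_control_def)
  show "sgn u = inverse (norm u) *\<^sub>R u"
    by (simp add: sgn_control_def)
  show "uniformity = (INF e\<in>{0<..}. principal {(u, v :: 'a control). dist u v < e})"
    by (simp add: uniformity_control_def)
  show "open U \<longleftrightarrow> (\<forall>u\<in>U. \<forall>\<^sub>F (u', v) in uniformity. u' = u \<longrightarrow> v \<in> U)" for U :: "'a control set"
    by (simp add: open_control_def)
  show "norm u = 0 \<longleftrightarrow> u = 0"
    by transfer (auto simp: ae_equal_def integral_nonneg_eq_0_iff_AE)
  show "norm (u + v) \<le> norm u + norm v"
    by transfer (auto simp: ae_equal_def norm_triangle_ineq
        simp flip: Bochner_Integration.integral_add intro!: integral_mono)
  show "norm (a *\<^sub>R u) = \<bar>a\<bar> * norm u"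
    by transfer simp
qed

end


section \<open>Exterior square and adequate scalar product\<close>

definition orthonormal_basis_on :: "'i set \<Rightarrow> ('i \<Rightarrow> 'a::euclidean_space) \<Rightarrow> bool" where
  "orthonormal_basis_on I f \<longleftrightarrow>
     (\<forall>i\<in>I. \<forall>j\<in>I. f i \<bullet> f j = (if i = j then 1 else 0)) \<and> span (f ` I) = UNIV"

text \<open>\<open>exterior_square wedge\<close> says that the type \<open>'x\<close> together with the map \<open>wedge\<close> is the exterior
  square $\bigwedge^2V$ of the vector space \<open>V = 'v\<close>, by its universal property. Since all spaces
  are finite-dimensional it suffices to test against real-valued alternating bilinear maps.\<close>

definition exterior_square :: "('v::euclidean_space \<Rightarrow> 'v \<Rightarrow> 'x::euclidean_space) \<Rightarrow> bool" where
  "exterior_square wedge \<longleftrightarrow> bilinear wedge \<and> (\<forall>v. wedge v v = 0) \<and>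
     (\<forall>\<beta> :: 'v \<Rightarrow> 'v \<Rightarrow> real. bilinear \<beta> \<and> (\<forall>v. \<beta> v v = 0) \<longrightarrow>
        (\<exists>!f. linear f \<and> (\<forall>v w. \<beta> v w = f (wedge v w))))"

text \<open>The free Lie algebra $V\oplus\bigwedge^2V$ is the type \<open>'v \<times> 'x\<close>. The scalar products on \<open>V\<close>
  and on $V\oplus\bigwedge^2V$ are those carried by the types; \<open>adequate wedge\<close> says that the latter
  is the adequate extension of the former.\<close>

definition adequate :: "('v::euclidean_space \<Rightarrow> 'v \<Rightarrow> 'x::euclidean_space) \<Rightarrow> bool" where
  "adequate wedge \<longleftrightarrow>
     (\<forall>e :: nat \<Rightarrow> 'v. orthonormal_basis_on {..<DIM('v)} e \<longrightarrow>
        orthonormal_basis_on ({..<DIM('v)} <+> {(i, j). i < j \<and> j < DIM('v)})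
          (case_sum (\<lambda>i. (e i, 0 :: 'x)) (\<lambda>(i, j). (0 :: 'v, wedge (e i) (e j)))))"

text \<open>For example, the cross product makes \<open>real^3\<close> the exterior square of \<open>real^3\<close>, with its
  adequate scalar product.\<close>

context
  includes cross3_syntax
begin

lemma exterior_square_cross3: "exterior_square cross3"
proof -
  have "\<exists>!f. linear f \<and> (\<forall>v w. \<beta> v w = f (v \<times> w))"
    if \<beta>: "bilinear \<beta>" "\<And>v. \<beta> v v = 0" for \<beta> :: "real^3 \<Rightarrow> real^3 \<Rightarrow> real"
  proof (rule ex1I[where a = "\<lambda>z. z $ 1 * \<beta> (axis 2 1) (axis 3 1)
      + z $ 2 * \<beta> (axis 3 1) (axis 1 1) + z $ 3 * \<beta> (axis 1 1) (axis 2 1)"], intro conjI allI)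
    note bl = bilinear_ladd[OF \<beta>(1)] bilinear_radd[OF \<beta>(1)] bilinear_lmul[OF \<beta>(1)] bilinear_rmul[OF \<beta>(1)]
    have ax: "v = v $ 1 *\<^sub>R axis 1 1 + v $ 2 *\<^sub>R axis 2 1 + v $ 3 *\<^sub>R axis 3 1" for v :: "real^3"
      by (simp add: vec_eq_iff forall_3 axis_def)
    have sk: "\<beta> v w = - \<beta> w v" for v w
      using \<beta>(2)[of "v + w"] \<beta>(2)[of v] \<beta>(2)[of w] unfolding bl by linarith
    show "\<beta> v w = (v \<times> w) $ 1 * \<beta> (axis 2 1) (axis 3 1) + (v \<times> w) $ 2 * \<beta> (axis 3 1) (axis 1 1)
        + (v \<times> w) $ 3 * \<beta> (axis 1 1) (axis 2 1)" for v w
      apply (subst ax[of v], subst ax[of w])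
      apply (simp add: bl \<beta>(2) cross3_def algebra_simps)
      using sk[of "axis 2 1" "axis 1 1"] sk[of "axis 3 1" "axis 2 1"] sk[of "axis 1 1" "axis 3 1"]
      by (simp add: algebra_simps)
    show "linear (\<lambda>z::real^3. z $ 1 * \<beta> (axis 2 1) (axis 3 1)
      + z $ 2 * \<beta> (axis 3 1) (axis 1 1) + z $ 3 * \<beta> (axis 1 1) (axis 2 1))"
      by (rule linearI) (simp_all add: algebra_simps)
    fix f :: "real^3 \<Rightarrow> real" assume f: "linear f \<and> (\<forall>v w. \<beta> v w = f (v \<times> w))"
    have *: "axis 2 1 \<times> axis 3 1 = (axis 1 1 :: real^3)" "axis 3 1 \<times> axis 1 1 = (axis 2 1 :: real^3)"
      "axis 1 1 \<times> axis 2 1 = (axis 3 1 :: real^3)"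
      by (simp_all add: cross3_def vec_eq_iff forall_3 axis_def)
    show "f = (\<lambda>z. z $ 1 * \<beta> (axis 2 1) (axis 3 1)
      + z $ 2 * \<beta> (axis 3 1) (axis 1 1) + z $ 3 * \<beta> (axis 1 1) (axis 2 1))"
    proof
      fix z :: "real^3"
      have "f z = f (z $ 1 *\<^sub>R axis 1 1 + z $ 2 *\<^sub>R axis 2 1 + z $ 3 *\<^sub>R axis 3 1)"
        using ax[of z] by simp
      also have "\<dots> = z $ 1 * f (axis 1 1) + z $ 2 * f (axis 2 1) + z $ 3 * f (axis 3 1)"
        using f by (simp add: linear_add linear_scale)
      finally show "f z = z $ 1 * \<beta> (axis 2 1) (axis 3 1)
        + z $ 2 * \<beta> (axis 3 1) (axis 1 1) + z $ 3 * \<beta> (axis 1 1) (axis 2 1)"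
        using f by (simp add: *)
    qed
  qed
  moreover have "bilinear cross3"
    using bilinear_cross by (simp add: bilinear_def) 
  ultimately show ?thesis
    by (auto simp: exterior_square_def)
qed

lemma adequate_cross3: "adequate cross3"
proof -
  have "orthonormal_basis_on ({..<3} <+> {(i, j). i < j \<and> j < 3})
    (case_sum (\<lambda>i. (e i, 0 :: real^3)) (\<lambda>(i, j). (0 :: real^3, e i \<times> e j)))" (is "orthonormal_basis_on ?I ?f")
    if e: "orthonormal_basis_on {..<3} e" for e :: "nat \<Rightarrow> real^3"
  proof -
    have I: "?I = {Inl 0, Inl 1, Inl 2, Inr (0,1), Inr (0,2), Inr (1,2)}"
      by (auto simp: image_iff numeral_eq_Suc less_Suc_eq)
    have on: "e 0 \<bullet> e 0 = 1" "e 1 \<bullet> e 1 = 1" "e 2 \<bullet> e 2 = 1" "e 0 \<bullet> e 1 = 0" "e 0 \<bullet> e 2 = 0" "e 1 \<bullet> e 2 = 0"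
      using e by (auto simp: orthonormal_basis_on_def)
    have 1: "\<forall>i\<in>?I. \<forall>j\<in>?I. ?f i \<bullet> ?f j = (if i = j then 1 else 0)"
      unfolding I using on by (simp add: dot_cross inner_commute)
    have inj: "inj_on ?f ?I"
    proof (rule inj_onI)
      fix i j assume ij: "i \<in> ?I" "j \<in> ?I" "?f i = ?f j"
      then have "?f i \<bullet> ?f j = 1" using bspec[OF bspec[OF 1 ij(1)] ij(1)] by simp
      then show "i = j" using bspec[OF bspec[OF 1 ij(1)] ij(2)] by (simp split: if_splits)
    qed
    have "pairwise orthogonal (?f ` ?I)"
      unfolding pairwise_image unfolding pairwise_def orthogonal_def
    proof (intro ballI impI)
      fix i j assume ij: "i \<in> ?I" "j \<in> ?I" "i \<noteq> j" "?f i \<noteq> ?f j"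
      show "?f i \<bullet> ?f j = 0" using bspec[OF bspec[OF 1 ij(1)] ij(2)] ij(3) by simp
    qed
    moreover have "0 \<notin> ?f ` ?I"
    proof
      assume "0 \<in> ?f ` ?I"
      then obtain i where i: "i \<in> ?I" "?f i = 0" by (elim imageE) (rule that, assumption, rule sym)
      show False using bspec[OF bspec[OF 1 i(1)] i(1)] unfolding i(2) by simp
    qed
    ultimately have ind: "independent (?f ` ?I)"
      by (rule pairwise_orthogonal_independent)
    have "card (?f ` ?I) = 6"
      unfolding card_image[OF inj] unfolding I by simp
    then have "span (?f ` ?I) = UNIV"
      using card_ge_dim_independent[OF subset_UNIV ind] by (simp only: dim_UNIV DIM_prod DIM_cart) auto
    with 1 show ?thesis by (simp add: orthonormal_basis_on_def)
  qed
  then show ?thesis by (simp add: adequate_def)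
qed

end

definition bivector_rank :: "('v \<Rightarrow> 'v \<Rightarrow> 'x::euclidean_space) \<Rightarrow> 'x \<Rightarrow> nat" where
  "bivector_rank wedge \<omega> = (LEAST k. \<exists>v w. \<omega> = (\<Sum>i<k. wedge (v i) (w i)))"


section \<open>The step two group\<close>

text \<open>\<open>quotient_map_by W \<pi>\<close> says that the type \<open>'q\<close> together with the projection \<open>\<pi>\<close> is the
  quotient of \<open>'x\<close> by the subspace \<open>W\<close>. A type of class \<open>euclidean_space\<close> has positive dimension,
  so \<open>W\<close> is automatically a proper subspace and the step is exactly two.\<close>

definition quotient_map_by :: "'x::euclidean_space set \<Rightarrow> ('x \<Rightarrow> 'q::euclidean_space) \<Rightarrow> bool" where
  "quotient_map_by W \<pi> \<longleftrightarrow> linear \<pi> \<and> surj \<pi> \<and> {\<omega>. \<pi> \<omega> = 0} = W"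

text \<open>Lie bracket of $V\oplus\bigwedge^2V/W$, carried by the type \<open>'v \<times> 'q\<close>.\<close>

definition lie_bracket :: "('v \<Rightarrow> 'v \<Rightarrow> 'x) \<Rightarrow> ('x \<Rightarrow> 'q) \<Rightarrow>
    'v::euclidean_space \<times> 'q::euclidean_space \<Rightarrow> 'v \<times> 'q \<Rightarrow> 'v \<times> 'q" where
  "lie_bracket wedge \<pi> p q = (0, \<pi> (wedge (fst p) (fst q)))"

text \<open>The group is identified with its Lie algebra by the exponential map, hence the product is given
  by the Baker-Campbell-Hausdorff formula, in step two. The identity element is \<open>0\<close>.\<close>

definition group_mult :: "('v \<Rightarrow> 'v \<Rightarrow> 'x) \<Rightarrow> ('x \<Rightarrow> 'q) \<Rightarrow>
    'v::euclidean_space \<times> 'q::euclidean_space \<Rightarrow> 'v \<times> 'q \<Rightarrow> 'v \<times> 'q" where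
  "group_mult wedge \<pi> p q = p + q + (1 / 2) *\<^sub>R lie_bracket wedge \<pi> p q"


section \<open>Endpoint map and abnormal set\<close>

definition absolutely_continuous_on :: "real set \<Rightarrow> (real \<Rightarrow> 'a::metric_space) \<Rightarrow> bool" where
  "absolutely_continuous_on S f \<longleftrightarrow>
     (\<forall>\<epsilon>>0. \<exists>\<delta>>0. \<forall>(n::nat) a b.
        (\<forall>i<n. a i \<le> b i \<and> {a i..b i} \<subseteq> S) \<and>
        (\<forall>i<n. \<forall>j<n. i \<noteq> j \<longrightarrow> {a i<..<b i} \<inter> {a j<..<b j} = {}) \<and>
        (\<Sum>i<n. b i - a i) < \<delta> \<longrightarrow>
        (\<Sum>i<n. dist (f (a i)) (f (b i))) < \<epsilon>)"

text \<open>\<open>control_curve wedge \<pi> u \<gamma>\<close>: on $[0,1]$ the function \<open>\<gamma>\<close> is the curve $\gamma_u$. Left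
  translation by \<open>g\<close> is \<open>group_mult wedge \<pi> g\<close>, and \<open>V\<close> sits in the Lie algebra as $V\times\{0\}$.\<close>

definition control_curve :: "('v \<Rightarrow> 'v \<Rightarrow> 'x) \<Rightarrow> ('x \<Rightarrow> 'q) \<Rightarrow>
    'v::euclidean_space control \<Rightarrow> (real \<Rightarrow> 'v \<times> 'q::euclidean_space) \<Rightarrow> bool" where
  "control_curve wedge \<pi> u \<gamma> \<longleftrightarrow> absolutely_continuous_on {0..1} \<gamma> \<and> \<gamma> 0 = 0 \<and>
     (AE t in lebesgue_on {0..1}.
        (\<gamma> has_vector_derivative
           frechet_derivative (group_mult wedge \<pi> (\<gamma> t)) (at 0) (rep_control u t, 0))
        (at t within {0..1}))"

definition endpoint_map :: "('v \<Rightarrow> 'v \<Rightarrow> 'x) \<Rightarrow> ('x \<Rightarrow> 'q) \<Rightarrow>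
    'v::euclidean_space control \<Rightarrow> 'v \<times> 'q::euclidean_space" where
  "endpoint_map wedge \<pi> u = (THE p. \<exists>\<gamma>. control_curve wedge \<pi> u \<gamma> \<and> \<gamma> 1 = p)"

definition singular_control :: "('v \<Rightarrow> 'v \<Rightarrow> 'x) \<Rightarrow> ('x \<Rightarrow> 'q::euclidean_space) \<Rightarrow>
    'v::euclidean_space control \<Rightarrow> bool" where
  "singular_control wedge \<pi> u \<longleftrightarrow>
     (\<exists>D. (endpoint_map wedge \<pi> has_derivative D) (at u) \<and> \<not> surj D)"

definition abnormal_set :: "('v \<Rightarrow> 'v \<Rightarrow> 'x) \<Rightarrow> ('x \<Rightarrow> 'q) \<Rightarrow>
    ('v::euclidean_space \<times> 'q::euclidean_space) set" where
  "abnormal_set wedge \<pi> = {endpoint_map wedge \<pi> u | u. singular_control wedge \<pi> u}"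


section \<open>Real algebraic varieties\<close>

definition algebraic_variety :: "'a::euclidean_space set \<Rightarrow> bool" where
  "algebraic_variety Z \<longleftrightarrow>
     (\<exists>P. (\<forall>p\<in>P. real_polynomial_function p) \<and> Z = {x. \<forall>p\<in>P. p x = 0})"

definition irreducible_variety :: "'a::euclidean_space set \<Rightarrow> bool" where
  "irreducible_variety Z \<longleftrightarrow> algebraic_variety Z \<and> Z \<noteq> {} \<and>
     (\<forall>A B. algebraic_variety A \<and> algebraic_variety B \<and> Z = A \<union> B \<longrightarrow> Z = A \<or> Z = B)"

text \<open>Krull dimension: the supremum of the lengths of strictly increasing chains of irreducible
  varieties contained in \<open>Z\<close>. The dimension of the empty set is \<open>-\<infinity>\<close>.\<close>

definition variety_dim :: "'a::euclidean_space set \<Rightarrow> ereal" where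
  "variety_dim Z = Sup {ereal (real n) | n. \<exists>C :: nat \<Rightarrow> 'a set.
     (\<forall>i\<le>n. irreducible_variety (C i) \<and> C i \<subseteq> Z) \<and> (\<forall>i<n. C i \<subset> C (Suc i))}"

definition zariski_closure :: "'a::euclidean_space set \<Rightarrow> 'a set" where
  "zariski_closure A = \<Inter> {Z. algebraic_variety Z \<and> A \<subseteq> Z}"

text \<open>As usual in real algebraic geometry, the dimension of an arbitrary set is the dimension of its
  Zariski closure; the closure of a variety is the variety itself.\<close>

definition codim :: "'a::euclidean_space set \<Rightarrow> ereal" where
  "codim A = ereal (real DIM('a)) - variety_dim (zariski_closure A)"

end

theory Submission
  imports Defs
begin

text \<open>
Write \<open>h a b = \<pi> (wedge a b)\<close> for the bracket $V\times V\to\mathfrak g_2$, and for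
\<open>\<mu>\<close> in $\mathfrak g_2$ let $U_\mu$ be the kernel of the alternating form $\mu\cdot h$.

The abnormal set is swept out by these kernels. With $x(t)=\int_0^tu$ the endpoint of \<open>u\<close> is
$(x(1),\frac12\int_0^1h(x,u))$, and integration by parts turns the differential of the endpoint map
into $v\mapsto(\int v,\ \frac12h(\int v,x(1))+\int h(x,v))$. A covector $(l,\mu)$ that annihilates its
image is integration of \<open>v\<close> against a continuous function, which therefore vanishes. Its value at
$t=0$ shows that \<open>l\<close> is determined by \<open>\<mu>\<close>, so $\mu\neq0$, and its value at \<open>t\<close> then
shows $x(t)\in U_\mu$. The control takes its values in $U_\mu$ too, so the endpoint lies in
$U_\mu\times\mathrm{span}\,h(U_\mu,U_\mu)$ (\<open>abnormal_point_kernel\<close>). The curves are only absolutely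
continuous, which makes the Lebesgue differentiation theorem and the fundamental theorem of calculus
for absolutely continuous functions necessary.

Counting dimensions gives the codimension. Let \<open>r\<close> and \<open>q\<close> be the dimensions of \<open>V\<close> and
$\mathfrak g_2$. The symplectic normal form yields $\dim U_\mu\leq r-2k$
(\<open>dim_kernel_bivector_rank\<close>). If \<open>\<mu>\<close> moves in a direction \<open>\<theta>\<close> while its kernel
moves along, then $\theta\cdot h$ vanishes on $U_\mu\times U_\mu$, that is, \<open>\<theta>\<close> is orthogonal
to $\mathrm{span}\,h(U_\mu,U_\mu)$. So the directions available to \<open>\<mu>\<close> and the span have dimensions
adding up to at most \<open>q\<close>, and as the direction of \<open>\<mu>\<close> itself moves no point, the union of all
the sets $U_\mu\times\mathrm{span}\,h(U_\mu,U_\mu)$ has dimension at most $(r-2k)+q-1$, which is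
codimension $2k+1$ (\<open>dim_tangent_triples\<close>, \<open>alg_dependent_kernel_pairs\<close>).

This count is made rigorous at generic points rather than at smooth points. A chain of \<open>n + 1\<close>
irreducible varieties produces \<open>n\<close> polynomials that are algebraically independent on the largest
one (\<open>irreducible_chain_independent\<close>), so it suffices to show that too many polynomials are
algebraically dependent on a set \<open>S\<close>. If \<open>n\<close> polynomials are independent on \<open>S\<close>, a family
of points of \<open>S\<close> defines a point with coordinates in an ultrapower of the reals at which they
satisfy no polynomial relation. Derivations extend along arbitrary field extensions of characteristic
zero, hence the ultrapower has derivations dual to the \<open>n\<close> polynomials
(\<open>alg_independent_derivation\<close>). Every family of real numbers, however chosen, is an element of the
ultrapower; in particular \<open>\<mu>\<close> and a projection onto $U_\mu$ can be chosen arbitrarily at each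
point and still be differentiated, even though the dimension of $U_\mu$ may vary from point to point.
Evaluating finitely many differentiated identities at one common index gives \<open>n\<close> real tangent
vectors dual to the \<open>n\<close> polynomials, and linear algebra bounds their number.

Finally a linear subspace of dimension $(r-2k)+q-1$ is adjoined, so that the Zariski closure of the
union has exactly this dimension.
\<close>

section \<open>Lebesgue differentiation\<close>

text \<open>The Lebesgue differentiation theorem for gauge integrals. Where the difference quotient stays
  \<open>e\<close> away from \<open>f x\<close> on arbitrarily short intervals, such intervals form a Vitali cover; by
  Henstock's lemma disjoint ones among them have small total length, and enlarging them five times
  covers the exceptional set.\<close>

lemma integral_has_vector_derivative_negligible:
  fixes f :: "real \<Rightarrow> 'n::euclidean_space"
  assumes f: "f integrable_on {a..b}"
  shows "negligible {x\<in>{a..b}. \<not> ((\<lambda>y. integral {a..y} f) has_vector_derivative f x) (at x within {a..b})}"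
proof -
  define F where "F = (\<lambda>y. integral {a..y} f)"
  define J where "J = (\<lambda>x y::real. {min x y..max x y})"
  define Bad where "Bad e = {x\<in>{a..b}. \<forall>d>0. \<exists>y\<in>{a..b}. \<bar>y - x\<bar> < d \<and>
      norm (F y - F x - (y - x) *\<^sub>R f x) > e * \<bar>y - x\<bar>}" for e
  have F_J: "norm (measure lborel (J x y) *\<^sub>R f x - integral (J x y) f) = norm (F y - F x - (y - x) *\<^sub>R f x)"
    if "x \<in> {a..b}" "y \<in> {a..b}" for x y
  proof (cases "x \<le> y")
    case True
    then have "F x + integral {x..y} f = F y"
      unfolding F_def using that
      by (intro Henstock_Kurzweil_Integration.integral_combine integrable_subinterval_real[OF f]) auto
    then have "integral {x..y} f = F y - F x" by (simp add: algebra_simps)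
    with True show ?thesis by (simp add: J_def min_def max_def norm_minus_commute)
  next
    case False
    then have "F y + integral {y..x} f = F x"
      unfolding F_def using that
      by (intro Henstock_Kurzweil_Integration.integral_combine integrable_subinterval_real[OF f]) auto
    then have "integral {y..x} f = F x - F y" by (simp add: algebra_simps)
    with False have "measure lborel (J x y) *\<^sub>R f x - integral (J x y) f = F y - F x - (y - x) *\<^sub>R f x"
      by (simp add: J_def min_def max_def algebra_simps)
    then show ?thesis by simp
  qed
  have neg: "negligible (Bad e)" if e: "e > 0" for e
  proof (rule negligible_outer_le[THEN iffD2], intro allI impI)
    fix \<epsilon> :: real assume \<epsilon>: "\<epsilon> > 0"
    \<comment> \<open>the factor 5 is the enlargement of the intervals in the Vitali covering lemma\<close>
    define \<eta> where "\<eta> = \<epsilon> * e / 5"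
    have \<eta>: "\<eta> > 0" using \<epsilon> e by (simp add: \<eta>_def)
    obtain \<gamma> where \<gamma>: "gauge \<gamma>"
      and hen: "\<And>p. \<lbrakk>p tagged_partial_division_of (cbox a b); \<gamma> fine p\<rbrakk> \<Longrightarrow>
             sum (\<lambda>(x,k). norm(measure lborel k *\<^sub>R f x - integral k f)) p < \<eta>"
      using Henstock_lemma[of f a b \<eta>] f \<eta> by auto
    have "\<exists>y\<in>{a..b}. J x y \<subseteq> \<gamma> x \<and> norm (F y - F x - (y - x) *\<^sub>R f x) > e * \<bar>y - x\<bar> \<and> y \<noteq> x \<and> \<bar>y - x\<bar> \<le> 1"
      if x: "x \<in> Bad e" for x
    proof -
      have "x \<in> \<gamma> x" "open (\<gamma> x)" using \<gamma> by (auto simp: gauge_def)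
      then obtain d where d: "d > 0" "ball x d \<subseteq> \<gamma> x" by (meson openE)
      with x obtain y where y: "y \<in> {a..b}" "\<bar>y - x\<bar> < min d 1" "norm (F y - F x - (y - x) *\<^sub>R f x) > e * \<bar>y - x\<bar>"
        unfolding Bad_def by (auto simp: Ball_def dest!: spec[of _ "min d 1"])
      have "J x y \<subseteq> ball x d" using y(2) by (auto simp: J_def dist_real_def)
      with y d show ?thesis by (intro bexI[of _ y]) auto
    qed
    then obtain Y where Y: "\<And>x. x \<in> Bad e \<Longrightarrow> Y x \<in> {a..b} \<and> J x (Y x) \<subseteq> \<gamma> x \<and>
        norm (F (Y x) - F x - (Y x - x) *\<^sub>R f x) > e * \<bar>Y x - x\<bar> \<and> Y x \<noteq> x \<and> \<bar>Y x - x\<bar> \<le> 1"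
      by metis
    define c r where "c x = (x + Y x) / 2" and "r x = \<bar>Y x - x\<bar> / 2" for x
    have J_cball: "J x (Y x) = cball (c x) (r x)" for x
      by (auto simp: J_def c_def r_def cball_eq_atLeastAtMost min_def max_def field_simps abs_if)
    have "Bad e \<subseteq> (\<Union>x\<in>Bad e. cball (c x) (r x))"
      by (auto simp flip: J_cball simp: J_def)
    then obtain C where C: "countable C" "C \<subseteq> Bad e"
      "pairwise (\<lambda>i j. disjnt (cball (c i) (r i)) (cball (c j) (r j))) C"
      "Bad e \<subseteq> (\<Union>i\<in>C. cball (c i) (5 * r i))"
      by (rule Vitali_covering_lemma_cballs[where B = 1]) (use Y in \<open>force simp: r_def\<close>)
    have r: "r x > 0" if "x \<in> C" for x using Y C that by (force simp: r_def)
    have inj: "inj_on (\<lambda>x. (x, J x (Y x))) I" for I by (auto simp: inj_on_def)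
    have fin: "(\<Sum>x\<in>I. measure lebesgue (cball (c x) (5 * r x))) \<le> \<epsilon>" if I: "finite I" "I \<subseteq> C" for I
    proof -
      let ?p = "(\<lambda>x. (x, J x (Y x))) ` I"
      have "?p tagged_partial_division_of cbox a b"
        unfolding tagged_partial_division_of_def
      proof (intro conjI allI impI, goal_cases)
        case 1 show ?case using I by simp
      next
        case (2 x K)
        then show ?case by (auto simp: J_def)
      next
        case (3 x K)
        then have "x \<in> Bad e" "K = J x (Y x)" using I C by auto
        with Y[of x] show ?case by (auto simp: J_def Bad_def)
      next
        case (4 x K) then show ?case unfolding J_def by (metis (no_types, lifting) cbox_interval imageE prod.inject)
      next
        case (5 x K x' K')
        then have "x \<in> C" "x' \<in> C" "x \<noteq> x'" "K = cball (c x) (r x)" "K' = cball (c x') (r x')"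
          using I by (auto simp: J_cball)
        with C(3) have "K \<inter> K' = {}" by (auto simp: pairwise_def disjnt_def)
        then show ?case using interior_subset by blast
      qed
      moreover have "\<gamma> fine ?p" unfolding fine_def using Y I C by blast
      ultimately have "sum (\<lambda>(x,k). norm(measure lborel k *\<^sub>R f x - integral k f)) ?p < \<eta>" by (rule hen)
      also have "sum (\<lambda>(x,k). norm(measure lborel k *\<^sub>R f x - integral k f)) ?p
          = (\<Sum>x\<in>I. norm (F (Y x) - F x - (Y x - x) *\<^sub>R f x))"
        unfolding sum.reindex[OF inj] o_def split_def fst_conv snd_conv
      proof (rule sum.cong[OF refl])
        fix x assume "x \<in> I"
        then have "x \<in> Bad e" using I C by auto
        then show "norm (measure lborel (J x (Y x)) *\<^sub>R f x - integral (J x (Y x)) f) = norm (F (Y x) - F x - (Y x - x) *\<^sub>R f x)"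
          by (intro F_J) (use Y in \<open>auto simp: Bad_def\<close>)
      qed
      finally have "(\<Sum>x\<in>I. e * \<bar>Y x - x\<bar>) < \<eta>"
        by (rule le_less_trans[rotated]) (intro sum_mono less_imp_le, use Y I C in blast)
      then have "e * (\<Sum>x\<in>I. \<bar>Y x - x\<bar>) < \<eta>" by (simp add: sum_distrib_left)
      moreover have "(\<Sum>x\<in>I. measure lebesgue (cball (c x) (5 * r x))) = 5 * (\<Sum>x\<in>I. \<bar>Y x - x\<bar>)"
        unfolding sum_distrib_left
        by (intro sum.cong refl) (simp add: cball_eq_atLeastAtMost r_def)
      ultimately show ?thesis using e by (simp add: \<eta>_def field_simps)
    qed
    show "\<exists>T. Bad e \<subseteq> T \<and> T \<in> lmeasurable \<and> measure lebesgue T \<le> \<epsilon>"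
    proof (intro exI conjI)
      show "Bad e \<subseteq> (\<Union>i\<in>C. cball (c i) (5 * r i))" by fact
      have *: "measure lebesgue (\<Union> D) \<le> \<epsilon>" if D: "D \<subseteq> (\<lambda>i. cball (c i) (5 * r i)) ` C" "finite D" for D
      proof -
        obtain I where I: "I \<subseteq> C" "finite I" "D = (\<lambda>i. cball (c i) (5 * r i)) ` I"
          using finite_subset_image[OF D(2,1)] by blast
        have "measure lebesgue (\<Union>i\<in>I. cball (c i) (5 * r i)) \<le> (\<Sum>x\<in>I. measure lebesgue (cball (c x) (5 * r x)))"
          by (rule measure_UNION_le) (auto simp: I)
        with fin[OF I(2,1)] I show ?thesis by simp
      qed
      have c: "countable ((\<lambda>i. cball (c i) (5 * r i)) ` C)" using C by auto
      show "(\<Union>i\<in>C. cball (c i) (5 * r i)) \<in> lmeasurable"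
        using c by (rule fmeasurable_Union_bound) (use * in auto)
      show "measure lebesgue (\<Union>i\<in>C. cball (c i) (5 * r i)) \<le> \<epsilon>"
        using c by (rule measure_Union_bound) (use * in auto)
    qed
  qed
  have "{x\<in>{a..b}. \<not> (F has_vector_derivative f x) (at x within {a..b})} \<subseteq> (\<Union>n. Bad (1 / real (Suc n)))"
  proof (rule subsetI, rule ccontr)
    fix x assume x: "x \<in> {x\<in>{a..b}. \<not> (F has_vector_derivative f x) (at x within {a..b})}"
      and nb: "x \<notin> (\<Union>n. Bad (1 / real (Suc n)))"
    have "(F has_vector_derivative f x) (at x within {a..b})"
      unfolding has_vector_derivative_def has_derivative_within_alt
    proof (intro conjI allI impI)
      show "bounded_linear (\<lambda>h. h *\<^sub>R f x)" by (rule bounded_linear_scaleR_left)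
      fix e :: real assume "e > 0"
      then obtain n where n: "1 / real (Suc n) < e" using nat_approx_posE by blast
      from nb x obtain d where d: "d > 0" "\<And>y. y \<in> {a..b} \<Longrightarrow> \<bar>y - x\<bar> < d \<Longrightarrow>
           norm (F y - F x - (y - x) *\<^sub>R f x) \<le> 1 / real (Suc n) * \<bar>y - x\<bar>"
        unfolding Bad_def by (auto simp: not_less) (metis atLeastAtMost_iff not_less)
      show "\<exists>d>0. \<forall>y\<in>{a..b}. norm (y - x) < d \<longrightarrow> norm (F y - F x - (y - x) *\<^sub>R f x) \<le> e * norm (y - x)"
      proof (intro exI[of _ d] conjI ballI impI)
        fix y assume "y \<in> {a..b}" "norm (y - x) < d"
        then have "norm (F y - F x - (y - x) *\<^sub>R f x) \<le> 1 / real (Suc n) * norm (y - x)" using d by auto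
        also have "\<dots> \<le> e * norm (y - x)" by (rule mult_right_mono[OF less_imp_le[OF n]]) simp
        finally show "norm (F y - F x - (y - x) *\<^sub>R f x) \<le> e * norm (y - x)" .
      qed fact
    qed
    with x show False by auto
  qed
  moreover have "negligible (\<Union>n. Bad (1 / real (Suc n)))"
    by (rule negligible_Union_nat) (auto intro: neg)
  ultimately show ?thesis unfolding F_def by (rule negligible_subset[rotated])
qed

section \<open>Absolutely continuous functions\<close>

definition small_intervals :: "real set \<Rightarrow> real \<Rightarrow> nat \<Rightarrow> (nat \<Rightarrow> real) \<Rightarrow> (nat \<Rightarrow> real) \<Rightarrow> bool" where
  "small_intervals S \<delta> n a b \<longleftrightarrow> (\<forall>i<n. a i \<le> b i \<and> {a i..b i} \<subseteq> S) \<and>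
     (\<forall>i<n. \<forall>j<n. i \<noteq> j \<longrightarrow> {a i<..<b i} \<inter> {a j<..<b j} = {}) \<and> (\<Sum>i<n. b i - a i) < \<delta>"

lemma absolutely_continuous_on_iff:
  "absolutely_continuous_on S f \<longleftrightarrow> (\<forall>\<epsilon>>0. \<exists>\<delta>>0. \<forall>n a b. small_intervals S \<delta> n a b \<longrightarrow>
     (\<Sum>i<n. dist (f (a i)) (f (b i))) < \<epsilon>)"
  by (simp add: absolutely_continuous_on_def small_intervals_def)

text \<open>A common source for the closure properties of absolute continuity: increments that are
  controlled by the increments of absolutely continuous functions.\<close>

lemma absolutely_continuous_on_dominated:
  fixes f :: "real \<Rightarrow> 'a::metric_space"
  assumes AC: "absolutely_continuous_on S g" "absolutely_continuous_on S h"
    and K: "\<And>s t. s \<in> S \<Longrightarrow> t \<in> S \<Longrightarrow> dist (f s) (f t) \<le> K * (dist (g s) (g t) + dist (h s) (h t))"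
  shows "absolutely_continuous_on S f"
  unfolding absolutely_continuous_on_iff
proof (intro allI impI)
  fix \<epsilon> :: real assume "\<epsilon> > 0"
  define K' where "K' = max K 1"
  define \<epsilon>' where "\<epsilon>' = \<epsilon> / (2 * K')"
  have K': "K' > 0" "K' \<ge> K" by (auto simp: K'_def)
  have \<epsilon>': "\<epsilon>' > 0" using \<open>\<epsilon> > 0\<close> K' by (simp add: \<epsilon>'_def)
  obtain d1 where d1: "d1 > 0" "\<And>n a b. small_intervals S d1 n a b \<Longrightarrow> (\<Sum>i<n. dist (g (a i)) (g (b i))) < \<epsilon>'"
    using AC(1)[unfolded absolutely_continuous_on_iff, rule_format, OF \<epsilon>'] by blast
  obtain d2 where d2: "d2 > 0" "\<And>n a b. small_intervals S d2 n a b \<Longrightarrow> (\<Sum>i<n. dist (h (a i)) (h (b i))) < \<epsilon>'"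
    using AC(2)[unfolded absolutely_continuous_on_iff, rule_format, OF \<epsilon>'] by blast
  show "\<exists>\<delta>>0. \<forall>n a b. small_intervals S \<delta> n a b \<longrightarrow> (\<Sum>i<n. dist (f (a i)) (f (b i))) < \<epsilon>"
  proof (intro exI[of _ "min d1 d2"] conjI allI impI)
    fix n :: nat and a b :: "nat \<Rightarrow> real"
    assume "small_intervals S (min d1 d2) n a b"
    then have *: "\<forall>i<n. a i \<le> b i \<and> {a i..b i} \<subseteq> S" "small_intervals S d1 n a b" "small_intervals S d2 n a b"
      by (simp_all add: small_intervals_def)
    have "(\<Sum>i<n. dist (f (a i)) (f (b i))) \<le> (\<Sum>i<n. K' * (dist (g (a i)) (g (b i)) + dist (h (a i)) (h (b i))))"
    proof (rule sum_mono)
      fix i assume "i \<in> {..<n}"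
      then have "{a i..b i} \<subseteq> S" "a i \<le> b i" using *(1) by auto
      then have "a i \<in> S" "b i \<in> S" by auto
      then have "dist (f (a i)) (f (b i)) \<le> K * (dist (g (a i)) (g (b i)) + dist (h (a i)) (h (b i)))" by (rule K)
      also have "\<dots> \<le> K' * (dist (g (a i)) (g (b i)) + dist (h (a i)) (h (b i)))"
        using K' by (intro mult_right_mono) auto
      finally show "dist (f (a i)) (f (b i)) \<le> \<dots>" .
    qed
    also have "\<dots> = K' * ((\<Sum>i<n. dist (g (a i)) (g (b i))) + (\<Sum>i<n. dist (h (a i)) (h (b i))))"
      by (simp add: sum.distrib flip: sum_distrib_left)
    also have "\<dots> < K' * (\<epsilon>' + \<epsilon>')"
      using K' by (intro mult_strict_left_mono add_strict_mono d1(2) d2(2) *)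
    also have "\<dots> = \<epsilon>" using K' by (simp add: \<epsilon>'_def field_simps)
    finally show "(\<Sum>i<n. dist (f (a i)) (f (b i))) < \<epsilon>" .
  qed (use d1 d2 in auto)
qed

lemma absolutely_continuous_on_bounded_linear:
  assumes "bounded_linear h" "absolutely_continuous_on S f"
  shows "absolutely_continuous_on S (\<lambda>t. h (f t))"
proof -
  obtain K where K: "\<And>x. norm (h x) \<le> norm x * K" using bounded_linear.bounded[OF assms(1)] by blast
  show ?thesis
  proof (rule absolutely_continuous_on_dominated[OF assms(2,2), of _ "K/2"])
    fix s t
    show "dist (h (f s)) (h (f t)) \<le> K/2 * (dist (f s) (f t) + dist (f s) (f t))"
      using K[of "f s - f t"] bounded_linear.linear[OF assms(1)]
      by (simp add: dist_norm linear_diff mult.commute)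
  qed
qed

lemma absolutely_continuous_on_diff:
  fixes f g :: "real \<Rightarrow> 'a::real_normed_vector"
  assumes "absolutely_continuous_on S f" "absolutely_continuous_on S g"
  shows "absolutely_continuous_on S (\<lambda>t. f t - g t)"
proof (rule absolutely_continuous_on_dominated[OF assms, of _ 1])
  fix s t
  have "f s - g s - (f t - g t) = (f s - f t) - (g s - g t)" by simp
  then show "dist (f s - g s) (f t - g t) \<le> 1 * (dist (f s) (f t) + dist (g s) (g t))"
    by (simp only: dist_norm norm_triangle_ineq4 mult_1)
qed

lemma absolutely_continuous_on_bilinear:
  fixes f :: "real \<Rightarrow> 'a::real_normed_vector" and g :: "real \<Rightarrow> 'b::real_normed_vector"
  assumes h: "bounded_bilinear h" and "absolutely_continuous_on S f" "absolutely_continuous_on S g"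
    and f: "bounded (f ` S)" and g: "bounded (g ` S)"
  shows "absolutely_continuous_on S (\<lambda>t. h (f t) (g t))"
proof -
  interpret bounded_bilinear h by fact
  obtain K where K: "K > 0" "\<And>a b. norm (h a b) \<le> norm a * norm b * K" using pos_bounded by blast
  obtain A B where A: "A > 0" "\<And>t. t \<in> S \<Longrightarrow> norm (f t) \<le> A" and B: "B > 0" "\<And>t. t \<in> S \<Longrightarrow> norm (g t) \<le> B"
    using f g unfolding bounded_pos by auto
  show ?thesis
  proof (rule absolutely_continuous_on_dominated[OF assms(2,3), of _ "K * (A + B)"])
    fix s t assume st: "s \<in> S" "t \<in> S"
    have "h (f s) (g s) - h (f t) (g t) = h (f s - f t) (g s) + h (f t) (g s - g t)"
      by (simp add: diff_left diff_right)
    then have "dist (h (f s) (g s)) (h (f t) (g t)) \<le> norm (h (f s - f t) (g s)) + norm (h (f t) (g s - g t))"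
      by (simp add: dist_norm norm_triangle_ineq)
    also have "\<dots> \<le> dist (f s) (f t) * B * K + A * dist (g s) (g t) * K"
      using st A B K unfolding dist_norm
      by (intro add_mono order_trans[OF K(2)] mult_right_mono mult_mono) auto
    also have "\<dots> \<le> K * (A + B) * (dist (f s) (f t) + dist (g s) (g t))"
      using A B K by (simp add: algebra_simps)
    finally show "dist (h (f s) (g s)) (h (f t) (g t)) \<le> \<dots>" .
  qed
qed

lemma absolutely_continuous_on_imp_continuous_on:
  assumes "absolutely_continuous_on {a..b} f"
  shows "continuous_on {a..b} f"
  unfolding continuous_on_iff
proof (intro ballI allI impI)
  fix x e assume x: "x \<in> {a..b}" and "e > (0::real)"
  then obtain \<delta> where \<delta>: "\<delta> > 0"
      "\<And>n u v. small_intervals {a..b} \<delta> n u v \<Longrightarrow> (\<Sum>i<n. dist (f (u i)) (f (v i))) < e"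
    using assms unfolding absolutely_continuous_on_iff by meson
  show "\<exists>d>0. \<forall>x'\<in>{a..b}. dist x' x < d \<longrightarrow> dist (f x') (f x) < e"
  proof (intro exI[of _ \<delta>] conjI ballI impI)
    fix y assume y: "y \<in> {a..b}" "dist y x < \<delta>"
    show "dist (f y) (f x) < e"
    proof (cases "x \<le> y")
      case True
      then show ?thesis using \<delta>(2)[of 1 "\<lambda>_. x" "\<lambda>_. y"] x y by (auto simp: small_intervals_def dist_real_def dist_commute)
    next
      case False
      then show ?thesis using \<delta>(2)[of 1 "\<lambda>_. y" "\<lambda>_. x"] x y by (auto simp: small_intervals_def dist_real_def dist_commute)
    qed
  qed fact
qed

text \<open>The integrand is split into a bounded part, whose contribution is controlled by the total
  length of the intervals, and the excess of its norm over a large constant, whose integral over the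
  whole interval is small by dominated convergence.\<close>

lemma absolutely_continuous_on_integral:
  fixes f :: "real \<Rightarrow> 'n::euclidean_space"
  assumes f: "f absolutely_integrable_on {a..b}"
  shows "absolutely_continuous_on {a..b} (\<lambda>t. integral {a..t} f)"
  unfolding absolutely_continuous_on_iff
proof (intro allI impI)
  fix \<epsilon> :: real assume \<epsilon>: "\<epsilon> > 0"
  define g where "g = (\<lambda>(n::nat) t. max (norm (f t) - real n) 0)"
  have fn: "(\<lambda>t. norm (f t)) absolutely_integrable_on {a..b}" by (rule absolutely_integrable_norm[OF f, unfolded o_def])
  have gi: "g n integrable_on {a..b}" for n
  proof -
    have "(\<lambda>t. max (norm (f t) - real n) 0) absolutely_integrable_on {a..b}"
      by (intro absolutely_integrable_max_1 set_integral_diff(1) fn) auto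
    then show ?thesis by (simp add: absolutely_integrable_on_def g_def)
  qed
  have "(\<lambda>n. integral {a..b} (g n)) \<longlonglongrightarrow> integral {a..b} (\<lambda>_. 0::real)"
  proof (rule dominated_convergence(2)[where h = "\<lambda>t. norm (f t)"])
    show "(\<lambda>t. norm (f t)) integrable_on {a..b}" using fn by (simp add: absolutely_integrable_on_def)
    fix t assume "t \<in> {a..b}"
    have "\<forall>\<^sub>F n in sequentially. g n t = 0"
      using eventually_ge_at_top[of "nat \<lceil>norm (f t)\<rceil>"]
      by eventually_elim (auto simp: g_def)
    then show "(\<lambda>n. g n t) \<longlonglongrightarrow> 0" by (rule tendsto_eventually)
  qed (use gi in \<open>auto simp: g_def\<close>)
  then have "\<forall>\<^sub>F n in sequentially. integral {a..b} (g n) < \<epsilon> / 2"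
    using \<epsilon> by (intro order_tendstoD) auto
  then obtain n where n: "integral {a..b} (g n) < \<epsilon> / 2" by (auto simp: eventually_sequentially)
  \<comment> \<open>on intervals of total length \<open>\<delta>\<close> the part of the norm bounded by \<open>n\<close> contributes at most \<open>\<epsilon> / 2\<close>\<close>
  define \<delta> where "\<delta> = \<epsilon> / (2 * (real n + 1))"
  have \<delta>: "\<delta> > 0" using \<epsilon> by (simp add: \<delta>_def)
  show "\<exists>\<delta>>0. \<forall>m u v. small_intervals {a..b} \<delta> m u v \<longrightarrow> (\<Sum>i<m. dist (integral {a..u i} f) (integral {a..v i} f)) < \<epsilon>"
  proof (intro exI[of _ \<delta>] conjI allI impI \<delta>)
    fix m :: nat and u v :: "nat \<Rightarrow> real"
    assume "small_intervals {a..b} \<delta> m u v"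
    note * = this[unfolded small_intervals_def]
    have fi: "f integrable_on {a..b}" using f by (simp add: absolutely_integrable_on_def)
    have step: "dist (integral {a..u i} f) (integral {a..v i} f)
        \<le> integral {a..b} (\<lambda>t. indicator {u i<..<v i} t * g n t) + real n * (v i - u i)" if "i < m" for i
    proof -
      have i: "u i \<le> v i" "{u i..v i} \<subseteq> {a..b}" "u i \<in> {a..b}" "v i \<in> {a..b}" using * that by force+
      have "integral {a..u i} f + integral {u i..v i} f = integral {a..v i} f"
        using i by (intro Henstock_Kurzweil_Integration.integral_combine integrable_subinterval_real[OF fi]) auto
      then have "dist (integral {a..u i} f) (integral {a..v i} f) = norm (integral {u i..v i} f)"
        by (metis add_diff_cancel_left' dist_norm norm_minus_commute)
      also have "\<dots> \<le> integral {u i..v i} (\<lambda>t. norm (f t))"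
        using absolutely_integrable_on_subinterval[OF f i(2)]
        by (intro Henstock_Kurzweil_Integration.integral_norm_bound_integral) (auto simp: absolutely_integrable_on_def)
      also have "\<dots> \<le> integral {u i..v i} (\<lambda>t. g n t + real n)"
        by (intro integral_le integrable_add integrable_const_ivl integrable_subinterval_real[OF gi i(2)]
            integrable_subinterval_real[OF fn[THEN set_lebesgue_integral_eq_integral(1)] i(2)]) (auto simp: g_def)
      also have "\<dots> = integral {u i..v i} (g n) + real n * (v i - u i)"
        using i by (subst Henstock_Kurzweil_Integration.integral_add) (auto intro: integrable_subinterval_real[OF gi i(2)])
      also have "integral {u i..v i} (g n) = integral {u i<..<v i} (g n)"
        by (simp add: integral_open_interval_real)
      also have "\<dots> = integral {a..b} (\<lambda>t. indicator {u i<..<v i} t * g n t)"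
        using i by (subst (1 2) integral_restrict_UNIV[symmetric]) (auto intro!: integral_cong simp: indicator_def)
      finally show ?thesis .
    qed
    have ii: "(\<lambda>t. indicator {u i<..<v i} t * g n t) integrable_on {a..b}" if "i < m" for i
    proof -
      have i: "u i \<le> v i" "{u i..v i} \<subseteq> {a..b}" using * that by force+
      have "g n integrable_on {u i<..<v i}"
        by (subst integrable_on_open_interval_real) (rule integrable_subinterval_real[OF gi i(2)])
      then have "(\<lambda>t. if t \<in> {u i<..<v i} then g n t else 0) integrable_on {a..b}"
        using i by (subst integrable_restrict_Int) (auto simp: Int_absorb2 subset_iff)
      then show ?thesis by (rule integrable_eq) (auto simp: indicator_def)
    qed
    have "(\<Sum>i<m. dist (integral {a..u i} f) (integral {a..v i} f))
        \<le> (\<Sum>i<m. integral {a..b} (\<lambda>t. indicator {u i<..<v i} t * g n t) + real n * (v i - u i))"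
      by (intro sum_mono step) auto
    also have "\<dots> = integral {a..b} (\<lambda>t. \<Sum>i<m. indicator {u i<..<v i} t * g n t) + real n * (\<Sum>i<m. v i - u i)"
      by (subst Henstock_Kurzweil_Integration.integral_sum) (auto simp: sum.distrib sum_distrib_left ii)
    also have "integral {a..b} (\<lambda>t. \<Sum>i<m. indicator {u i<..<v i} t * g n t) \<le> integral {a..b} (g n)"
    proof (intro integral_le integrable_sum ii gi)
      fix t assume "t \<in> {a..b}"
      have "(\<Sum>i<m. indicator {u i<..<v i} t :: real) = indicator (\<Union>i<m. {u i<..<v i}) t"
        using * by (intro indicator_UN_disjoint[symmetric]) (auto simp: disjoint_family_on_def)
      also have "\<dots> \<le> 1" by (simp add: indicator_def)
      finally have "(\<Sum>i<m. indicator {u i<..<v i} t) * g n t \<le> 1 * g n t"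
        by (rule mult_right_mono) (simp add: g_def)
      then show "(\<Sum>i<m. indicator {u i<..<v i} t * g n t) \<le> g n t" by (simp add: sum_distrib_right)
    qed auto
    also have "real n * (\<Sum>i<m. v i - u i) \<le> real n * \<delta>" using * by (intro mult_left_mono) auto
    also have "\<dots> \<le> \<epsilon> / 2" using \<epsilon> by (simp add: \<delta>_def field_simps)
    finally show "(\<Sum>i<m. dist (integral {a..u i} f) (integral {a..v i} f)) < \<epsilon>" using n by simp
  qed
qed

lemma additive_dist_bound:
  fixes f :: "real \<Rightarrow> 'a::real_normed_vector"
  assumes "a \<le> b" "p tagged_division_of {a..b}"
  shows "dist (f a) (f b) \<le> (\<Sum>(x,K)\<in>p. dist (f (Inf K)) (f (Sup K)))"
proof -
  have "dist (f a) (f b) = norm (\<Sum>(x,K)\<in>p. f (Sup K) - f (Inf K))"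
    by (subst additive_tagged_division_1[OF assms]) (simp add: dist_norm norm_minus_commute)
  also have "\<dots> \<le> (\<Sum>(x,K)\<in>p. dist (f (Inf K)) (f (Sup K)))"
    unfolding split_def by (rule order_trans[OF norm_sum]) (simp add: dist_norm norm_minus_commute)
  finally show ?thesis .
qed

text \<open>Take a tagged division of $[a,t]$ that is so fine that around tags outside \<open>N\<close> the
  derivative bounds the increments, and that around tags in \<open>N\<close> the intervals stay inside an open
  set of small measure. Absolute continuity controls the increments over the latter intervals.\<close>

lemma absolutely_continuous_on_constant:
  fixes f :: "real \<Rightarrow> 'a::real_normed_vector"
  assumes AC: "absolutely_continuous_on {a..b} f" and N: "negligible N"
    and der: "\<And>x. x \<in> {a..b} - N \<Longrightarrow> (f has_vector_derivative 0) (at x within {a..b})"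
    and t: "t \<in> {a..b}"
  shows "f t = f a"
proof -
  have main: "dist (f a) (f t) \<le> \<epsilon> * (t - a) + \<epsilon>" if \<epsilon>: "\<epsilon> > 0" for \<epsilon>
  proof -
    obtain \<delta> where \<delta>: "\<delta> > 0" and ac: "\<And>n u v. small_intervals {a..b} \<delta> n u v \<Longrightarrow> (\<Sum>i<n. dist (f (u i)) (f (v i))) < \<epsilon>"
      using AC \<epsilon> unfolding absolutely_continuous_on_iff by meson
    obtain U where U: "open U" "N \<subseteq> U" "U \<in> lmeasurable" "measure lebesgue U < \<delta>"
    proof -
      have N': "N \<in> null_sets lebesgue" using N by (simp add: negligible_iff_null_sets)
      obtain U where U: "open U" "N \<subseteq> U" "U - N \<in> lmeasurable" "emeasure lebesgue (U - N) < ennreal \<delta>"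
        using sets_lebesgue_outer_open[of N \<delta>] N' \<delta> by auto
      have "emeasure lebesgue U = emeasure lebesgue (U - N)"
        using U(1) N' by (intro emeasure_Diff_null_set[symmetric]) auto
      with U have U': "emeasure lebesgue U < ennreal \<delta>" by simp
      with U(1) have lm: "U \<in> lmeasurable"
        by (intro fmeasurableI) (auto simp: less_top[symmetric] dest: order.strict_trans)
      have "measure lebesgue U < \<delta>"
        using U' \<delta> lm by (simp add: emeasure_eq_measure2 ennreal_less_iff)
      with U lm show thesis by (intro that[of U]) auto
    qed
    have "\<exists>d>0. \<forall>y\<in>{a..b}. \<bar>y - x\<bar> < d \<longrightarrow> norm (f y - f x) \<le> \<epsilon> * \<bar>y - x\<bar>" if "x \<in> {a..b} - N" for x
      using der[OF that] \<epsilon> unfolding has_vector_derivative_def has_derivative_within_alt by auto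
    then obtain d where d: "\<And>x. x \<in> {a..b} - N \<Longrightarrow> d x > 0"
      "\<And>x y. x \<in> {a..b} - N \<Longrightarrow> y \<in> {a..b} \<Longrightarrow> \<bar>y - x\<bar> < d x \<Longrightarrow> norm (f y - f x) \<le> \<epsilon> * \<bar>y - x\<bar>"
      by metis
    define \<gamma> where "\<gamma> x = (if x \<in> N then U else if x \<in> {a..b} then ball x (d x) else ball x 1)" for x
    have "gauge \<gamma>" using U d by (auto simp: gauge_def \<gamma>_def)
    then obtain p where p: "p tagged_division_of {a..t}" "\<gamma> fine p"
      using fine_division_exists_real by blast
    note pD = tagged_division_ofD[OF p(1)]
    have K: "\<exists>u v. K = {u..v} \<and> u \<le> v \<and> Inf K = u \<and> Sup K = v \<and> x \<in> K \<and> {u..v} \<subseteq> {a..t} \<and> {u..v} \<subseteq> \<gamma> x"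
      if xK: "(x,K) \<in> p" for x K
    proof -
      obtain u v where uv: "K = cbox u v" using pD(4)[OF xK] by blast
      with pD(2)[OF xK] have "u \<le> v" by auto
      with uv pD(2,3)[OF xK] p(2) xK show ?thesis by (intro exI[of _ u] exI[of _ v]) (auto simp: fine_def)
    qed
    define p1 where "p1 = {xk\<in>p. fst xk \<in> N}"
    define p2 where "p2 = {xk\<in>p. fst xk \<notin> N}"
    have fin: "finite p" "finite p1" "finite p2" using pD(1) by (auto simp: p1_def p2_def)
    have "(\<Sum>(x,K)\<in>p2. dist (f (Inf K)) (f (Sup K))) \<le> (\<Sum>(x,K)\<in>p2. \<epsilon> * measure lborel K)"
    proof (rule sum_mono, clarify)
      fix x K assume "(x,K) \<in> p2"
      then have xK: "(x,K) \<in> p" "x \<notin> N" by (auto simp: p2_def)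
      from K[OF xK(1)] obtain u v where uv: "K = {u..v}" "u \<le> v" "Inf K = u" "Sup K = v" "x \<in> {u..v}"
        "{u..v} \<subseteq> {a..t}" "{u..v} \<subseteq> \<gamma> x" by blast
      then have "x \<in> {a..t}" by blast
      then have x: "x \<in> {a..b} - N" using t xK by auto
      have "u \<in> \<gamma> x" "v \<in> \<gamma> x" "u \<in> {a..t}" "v \<in> {a..t}" using uv by auto
      then have "norm (f u - f x) \<le> \<epsilon> * \<bar>u - x\<bar>" "norm (f v - f x) \<le> \<epsilon> * \<bar>v - x\<bar>"
        using t x by (intro d(2); auto simp: \<gamma>_def dist_real_def)+
      then have "dist (f u) (f v) \<le> \<epsilon> * \<bar>u - x\<bar> + \<epsilon> * \<bar>v - x\<bar>"
        using dist_triangle2[of "f u" "f v" "f x"] by (simp add: dist_norm)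
      also have "\<dots> = \<epsilon> * (v - u)" using uv by (simp add: algebra_simps)
      finally show "dist (f (Inf K)) (f (Sup K)) \<le> \<epsilon> * measure lborel K" using uv by simp
    qed
    also have "\<dots> \<le> (\<Sum>(x,K)\<in>p. \<epsilon> * measure lborel K)"
      using fin \<epsilon> by (intro sum_mono2) (auto simp: p2_def)
    also have "\<dots> = \<epsilon> * (\<Sum>(x,K)\<in>p. measure lborel K)" by (simp add: sum_distrib_left split_def)
    also have "(\<Sum>(x,K)\<in>p. measure lborel K) = t - a"
      using additive_content_tagged_division[of p a t] p(1) t by simp
    finally have 2: "(\<Sum>(x,K)\<in>p2. dist (f (Inf K)) (f (Sup K))) \<le> \<epsilon> * (t - a)" .
    obtain g n where g: "bij_betw g {..<n::nat} p1"
      using ex_bij_betw_nat_finite[OF fin(2)] by (auto simp: atLeast0LessThan)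
    have gK: "\<exists>x. (x, snd (g i)) \<in> p \<and> x \<in> N \<and> g i = (x, snd (g i))" if "i < n" for i
    proof -
      have "g i \<in> p1" using g that by (auto simp: bij_betw_def)
      then show ?thesis by (intro exI[of _ "fst (g i)"]) (auto simp: p1_def)
    qed
    define u where "u i = Inf (snd (g i))" for i
    define v where "v i = Sup (snd (g i))" for i
    have uv: "snd (g i) = {u i..v i}" "u i \<le> v i" "{u i..v i} \<subseteq> {a..b}" "{u i..v i} \<subseteq> U" if i: "i < n" for i
    proof -
      obtain x where x: "(x, snd (g i)) \<in> p" "x \<in> N" using gK[OF i] by blast
      from K[OF x(1)] x(2) t
      show "snd (g i) = {u i..v i}" "u i \<le> v i" "{u i..v i} \<subseteq> {a..b}" "{u i..v i} \<subseteq> U"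
        by (fastforce simp: u_def v_def \<gamma>_def)+
    qed
    have disj: "{u i<..<v i} \<inter> {u j<..<v j} = {}" if ij: "i < n" "j < n" "i \<noteq> j" for i j
    proof -
      obtain x where x: "(x, snd (g i)) \<in> p" "g i = (x, snd (g i))" using gK[OF ij(1)] by blast
      obtain y where y: "(y, snd (g j)) \<in> p" "g j = (y, snd (g j))" using gK[OF ij(2)] by blast
      have "g i \<noteq> g j" using g ij by (auto simp: bij_betw_def inj_on_def)
      then have "(x, snd (g i)) \<noteq> (y, snd (g j))" using x y by simp
      from pD(5)[OF x(1) y(1) this] show ?thesis by (simp add: uv ij interior_atLeastAtMost_real)
    qed
    have "(\<Sum>i<n. v i - u i) = (\<Sum>i<n. measure lebesgue {u i<..<v i})"
      by (intro sum.cong refl) (simp add: uv)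
    also have "\<dots> = measure lebesgue (\<Union>i<n. {u i<..<v i})"
      using disj lmeasurable_box[of "u _" "v _"]
      by (intro measure_UNION'[symmetric]) (auto simp: pairwise_def disjnt_def)
    also have "\<dots> \<le> measure lebesgue U"
    proof (rule measure_mono_fmeasurable)
      show "(\<Union>i<n. {u i<..<v i}) \<subseteq> U"
      proof
        fix s assume "s \<in> (\<Union>i<n. {u i<..<v i})"
        then obtain i where "i < n" "s \<in> {u i..v i}" by force
        with uv(4) show "s \<in> U" by blast
      qed
    qed (auto intro: U)
    also have "\<dots> < \<delta>" by fact
    finally have "(\<Sum>i<n. dist (f (u i)) (f (v i))) < \<epsilon>"
      using uv(2,3) disj by (intro ac) (auto simp: small_intervals_def)
    also have "(\<Sum>i<n. dist (f (u i)) (f (v i))) = (\<Sum>xK\<in>p1. dist (f (Inf (snd xK))) (f (Sup (snd xK))))"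
      unfolding u_def v_def by (rule sum.reindex_bij_betw[OF g])
    finally have 1: "(\<Sum>(x,K)\<in>p1. dist (f (Inf K)) (f (Sup K))) \<le> \<epsilon>" by (simp add: split_def)
    have "p = p1 \<union> p2" "p1 \<inter> p2 = {}" by (auto simp: p1_def p2_def)
    then have "(\<Sum>(x,K)\<in>p. dist (f (Inf K)) (f (Sup K)))
       = (\<Sum>(x,K)\<in>p1. dist (f (Inf K)) (f (Sup K))) + (\<Sum>(x,K)\<in>p2. dist (f (Inf K)) (f (Sup K)))"
      using fin by (simp add: sum.union_disjoint)
    with 1 2 additive_dist_bound[OF _ p(1), of f] t show ?thesis by simp
  qed
  have "dist (f a) (f t) \<le> 0"
  proof (rule field_le_epsilon)
    fix e :: real assume e: "e > 0"
    have "dist (f a) (f t) \<le> e / (t - a + 1) * (t - a) + e / (t - a + 1)" using e t by (intro main) simp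
    also have "\<dots> = e / (t - a + 1) * (t - a + 1)" by (simp only: distrib_left mult_1_right)
    also have "\<dots> = e" using t by simp
    finally show "dist (f a) (f t) \<le> 0 + e" by simp
  qed
  then show ?thesis by simp
qed

text \<open>The fundamental theorem of calculus: the difference of both sides is absolutely continuous
  with derivative zero almost everywhere.\<close>

lemma absolutely_continuous_on_eq_integral:
  fixes f g :: "real \<Rightarrow> 'n::euclidean_space"
  assumes AC: "absolutely_continuous_on {a..b} f" and g: "g absolutely_integrable_on {a..b}" and N: "negligible N"
    and der: "\<And>x. x \<in> {a..b} - N \<Longrightarrow> (f has_vector_derivative g x) (at x within {a..b})"
    and t: "t \<in> {a..b}"
  shows "f t = f a + integral {a..t} g"
proof -
  define B where "B = {x\<in>{a..b}. \<not> ((\<lambda>y. integral {a..y} g) has_vector_derivative g x) (at x within {a..b})}"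
  have B: "negligible B" unfolding B_def
    by (rule integral_has_vector_derivative_negligible) (use g in \<open>simp add: absolutely_integrable_on_def\<close>)
  have "f t - integral {a..t} g = f a - integral {a..a} g"
  proof (rule absolutely_continuous_on_constant[OF _ negligible_Un[OF N B] _ t])
    show "absolutely_continuous_on {a..b} (\<lambda>t. f t - integral {a..t} g)"
      by (intro absolutely_continuous_on_diff AC absolutely_continuous_on_integral g)
    fix x assume x: "x \<in> {a..b} - (N \<union> B)"
    then have "((\<lambda>t. f t - integral {a..t} g) has_vector_derivative g x - g x) (at x within {a..b})"
      by (intro has_vector_derivative_diff der) (auto simp: B_def)
    then show "((\<lambda>t. f t - integral {a..t} g) has_vector_derivative 0) (at x within {a..b})" by simp
  qed
  then show ?thesis by (simp add: algebra_simps)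
qed

section \<open>The endpoint map\<close>

lemma AE_lebesgue_on_iff:
  "(AE t in lebesgue_on {a..b::real}. P t) \<longleftrightarrow> (\<exists>N. negligible N \<and> (\<forall>t\<in>{a..b} - N. P t))"
proof
  assume "AE t in lebesgue_on {a..b}. P t"
  then have "AE t in lebesgue. t \<in> {a..b} \<longrightarrow> P t"
    by (simp add: AE_restrict_space_iff)
  then obtain N where "N \<in> null_sets lebesgue" "{t. \<not> (t \<in> {a..b} \<longrightarrow> P t)} \<subseteq> N"
    by (auto simp: eventually_ae_filter)
  then show "\<exists>N. negligible N \<and> (\<forall>t\<in>{a..b} - N. P t)"
    by (intro exI[of _ N]) (auto simp: negligible_iff_null_sets)
next
  assume "\<exists>N. negligible N \<and> (\<forall>t\<in>{a..b} - N. P t)"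
  then obtain N where N: "negligible N" "\<forall>t\<in>{a..b} - N. P t" by blast
  then have "AE t in lebesgue. t \<in> {a..b} \<longrightarrow> P t"
    unfolding eventually_ae_filter by (intro bexI[of _ N]) (auto simp: negligible_iff_null_sets)
  then show "AE t in lebesgue_on {a..b}. P t" by (simp add: AE_restrict_space_iff)
qed

lemma integrable_lebesgue_on_iff:
  fixes f :: "real \<Rightarrow> 'a::euclidean_space"
  shows "integrable (lebesgue_on {a..b}) f \<longleftrightarrow> f absolutely_integrable_on {a..b}"
  by (simp add: integrable_restrict_space set_integrable_def)

lemma rep_control_integrable:
  fixes u :: "'v::euclidean_space control"
  shows "rep_control u absolutely_integrable_on {0..1}"
proof -
  have "ae_equal (rep_control u) (rep_control u)"
    using Quotient3_rep_reflp[OF Quotient3_control] .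
  then show ?thesis by (simp add: ae_equal_def integrable_lebesgue_on_iff)
qed

lemma ae_equal_refl: "f absolutely_integrable_on {0..1} \<Longrightarrow> ae_equal f (f :: real \<Rightarrow> 'a::euclidean_space)"
  by (simp add: ae_equal_def integrable_lebesgue_on_iff)

lemma ae_equal_rep_abs:
  fixes f :: "real \<Rightarrow> 'a::euclidean_space"
  assumes "f absolutely_integrable_on {0..1}"
  shows "ae_equal (rep_control (abs_control f)) f"
  by (rule rep_abs_rsp_left[OF Quotient3_control]) (rule ae_equal_refl[OF assms])

text \<open>Perturbations of a control are computed on representatives.\<close>

lemma control_add_scale:
  fixes u :: "'v::euclidean_space control"
  assumes g: "g absolutely_integrable_on {0..1}"
  shows "u + s *\<^sub>R abs_control g = abs_control (\<lambda>t. rep_control u t + s *\<^sub>R g t)"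
proof -
  have u: "abs_control (rep_control u) = u" by (rule Quotient3_abs_rep[OF Quotient3_control])
  have sg: "(\<lambda>t. s *\<^sub>R g t) absolutely_integrable_on {0..1}"
    using g by (rule absolutely_integrable_scaleR_left)
  have "u + s *\<^sub>R abs_control g = abs_control (rep_control u) + abs_control (\<lambda>t. s *\<^sub>R g t)"
    by (simp only: u scaleR_control.abs_eq[OF ae_equal_refl[OF g]])
  also have "\<dots> = abs_control (\<lambda>t. rep_control u t + s *\<^sub>R g t)"
    by (rule plus_control.abs_eq) (intro ae_equal_refl rep_control_integrable sg)+
  finally show ?thesis .
qed

lemma ae_equal_negligible:
  "ae_equal f g \<Longrightarrow> \<exists>N. negligible N \<and> (\<forall>t\<in>{0..1} - N. f t = g t)"
  by (simp add: ae_equal_def AE_lebesgue_on_iff)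

definition primitive :: "(real \<Rightarrow> 'a::euclidean_space) \<Rightarrow> real \<Rightarrow> 'a" where
  "primitive f t = integral {0..t} f"

lemma primitive_cong:
  assumes "negligible N" "\<And>t. t \<in> {0..1} - N \<Longrightarrow> f t = g t" "t \<le> 1"
  shows "primitive f t = primitive g t"
  unfolding primitive_def using assms by (intro integral_spike[of N]) auto

lemma primitive_add_scale:
  assumes "f absolutely_integrable_on {0..1}" "g absolutely_integrable_on {0..1}" "t \<in> {0..1}"
  shows "primitive (\<lambda>t. f t + s *\<^sub>R g t) t = primitive f t + s *\<^sub>R primitive g t"
proof -
  have "f integrable_on {0..t}" "g integrable_on {0..t}"
    using assms by (auto intro!: integrable_subinterval_real[of _ 0 1] simp: absolutely_integrable_on_def)
  then show ?thesis unfolding primitive_def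
    by (subst Henstock_Kurzweil_Integration.integral_add) (auto intro: integrable_cmul)
qed

lemma primitive_AC:
  "f absolutely_integrable_on {0..1} \<Longrightarrow> absolutely_continuous_on {0..1} (primitive f)"
  unfolding primitive_def by (rule absolutely_continuous_on_integral)

lemma primitive_continuous:
  "f absolutely_integrable_on {0..1} \<Longrightarrow> continuous_on {0..1} (primitive f)"
  by (intro absolutely_continuous_on_imp_continuous_on primitive_AC)

lemma primitive_0 [simp]: "primitive f 0 = 0"
  by (simp add: primitive_def)

lemma primitive_derivative:
  assumes "f absolutely_integrable_on {0..1}"
  shows "\<exists>N. negligible N \<and> (\<forall>t\<in>{0..1} - N. (primitive f has_vector_derivative f t) (at t within {0..1}))"
proof (intro exI conjI ballI)
  show "negligible {t\<in>{0..1}. \<not> (primitive f has_vector_derivative f t) (at t within {0..1})}"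
    unfolding primitive_def[abs_def]
    by (rule integral_has_vector_derivative_negligible) (rule set_lebesgue_integral_eq_integral(1)[OF assms])
qed blast

lemma bilinear_absolutely_integrable:
  fixes h :: "'a::euclidean_space \<Rightarrow> 'b::euclidean_space \<Rightarrow> 'c::euclidean_space"
  assumes h: "bilinear h" and X: "continuous_on {a..b} X" and f: "f absolutely_integrable_on {a..b::real}"
  shows "(\<lambda>t. h (X t) (f t)) absolutely_integrable_on {a..b}"
proof (rule absolutely_integrable_bounded_measurable_product[OF h _ _ _ f])
  show "X \<in> borel_measurable (lebesgue_on {a..b})"
    by (rule continuous_imp_measurable_on_sets_lebesgue[OF X]) auto
  show "bounded (X ` {a..b})" using compact_continuous_image[OF X] compact_imp_bounded by auto
qed auto

text \<open>The product is absolutely continuous, so the fundamental theorem of calculus applies to the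
  product rule, which holds almost everywhere.\<close>

lemma integral_by_parts_primitive:
  fixes h :: "'a::euclidean_space \<Rightarrow> 'b::euclidean_space \<Rightarrow> 'c::euclidean_space"
  assumes h: "bilinear h" and f: "f absolutely_integrable_on {0..1}" and g: "g absolutely_integrable_on {0..1}"
  shows "h (primitive f 1) (primitive g 1)
    = integral {0..1} (\<lambda>t. h (f t) (primitive g t)) + integral {0..1} (\<lambda>t. h (primitive f t) (g t))"
proof -
  let ?X = "primitive f" and ?Y = "primitive g"
  have hb: "bounded_bilinear h" using h by (simp add: bilinear_conv_bounded_bilinear)
  have bdd: "bounded (?X ` {0..1})" "bounded (?Y ` {0..1})"
    using f g by (auto intro!: compact_imp_bounded compact_continuous_image primitive_continuous)
  have AC: "absolutely_continuous_on {0..1} (\<lambda>t. h (?X t) (?Y t))"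
    by (rule absolutely_continuous_on_bilinear[OF hb primitive_AC[OF f] primitive_AC[OF g] bdd])
  obtain N where N: "negligible N" "\<And>t. t \<in> {0..1} - N \<Longrightarrow> (?X has_vector_derivative f t) (at t within {0..1})"
    using primitive_derivative[OF f] by blast
  obtain M where M: "negligible M" "\<And>t. t \<in> {0..1} - M \<Longrightarrow> (?Y has_vector_derivative g t) (at t within {0..1})"
    using primitive_derivative[OF g] by blast
  have i1: "(\<lambda>t. h (?X t) (g t)) absolutely_integrable_on {0..1}"
    by (rule bilinear_absolutely_integrable[OF h primitive_continuous[OF f] g])
  have h': "bilinear (\<lambda>x y. h y x)" using h by (simp add: bilinear_def)
  have i2: "(\<lambda>t. h (f t) (?Y t)) absolutely_integrable_on {0..1}"
    by (rule bilinear_absolutely_integrable[OF h' primitive_continuous[OF g] f])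
  have "h (?X 1) (?Y 1) = h (?X 0) (?Y 0) + integral {0..1} (\<lambda>t. h (?X t) (g t) + h (f t) (?Y t))"
  proof (rule absolutely_continuous_on_eq_integral[OF AC _ negligible_Un[OF N(1) M(1)]])
    show "(\<lambda>t. h (?X t) (g t) + h (f t) (?Y t)) absolutely_integrable_on {0..1}"
      using i1 i2 by (rule set_integral_add(1))
    fix t assume "t \<in> {0..1} - (N \<union> M)"
    then show "((\<lambda>t. h (?X t) (?Y t)) has_vector_derivative h (?X t) (g t) + h (f t) (?Y t)) (at t within {0..1})"
      by (intro bounded_bilinear.has_vector_derivative[OF hb] N M) auto
  qed simp
  then show ?thesis
    using i1 i2 bilinear_lzero[OF h] by (simp add: absolutely_integrable_on_def Henstock_Kurzweil_Integration.integral_add)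
qed

lemma frechet_derivative_group_mult:
  fixes wedge :: "'v::euclidean_space \<Rightarrow> 'v \<Rightarrow> 'x::euclidean_space" and \<pi> :: "'x \<Rightarrow> 'q::euclidean_space"
  assumes h: "bilinear (\<lambda>a b. \<pi> (wedge a b))"
  shows "frechet_derivative (group_mult wedge \<pi> p) (at 0) (a, 0) = (a, (1/2) *\<^sub>R \<pi> (wedge (fst p) a))"
proof -
  define L where "L q = q + (1/2) *\<^sub>R (0::'v, \<pi> (wedge (fst p) (fst q)))" for q :: "'v \<times> 'q"
  have "linear L" unfolding L_def
    by (rule linearI) (simp_all add: prod_eq_iff bilinear_radd[OF h] bilinear_rmul[OF h] algebra_simps)
  then have "(L has_derivative L) (at 0)" by (simp add: linear_imp_has_derivative)
  then have "((\<lambda>q. p + L q) has_derivative L) (at 0)" using has_derivative_add[OF has_derivative_const] by fastforce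
  moreover have "(\<lambda>q. p + L q) = group_mult wedge \<pi> p"
    by (auto simp: L_def group_mult_def lie_bracket_def)
  ultimately have "(group_mult wedge \<pi> p has_derivative L) (at 0)" by simp
  then have "frechet_derivative (group_mult wedge \<pi> p) (at 0) = L" using frechet_derivative_at by metis
  then show ?thesis by (simp add: L_def)
qed

text \<open>The horizontal component of a control curve has derivative \<open>u\<close> almost everywhere, so it is
  the primitive of \<open>u\<close>. This fixes the derivative of the vertical component, and with it the whole
  curve. Existence is Lebesgue differentiation, uniqueness the fundamental theorem of calculus.\<close>

lemma endpoint_map_eq:
  fixes wedge :: "'v::euclidean_space \<Rightarrow> 'v \<Rightarrow> 'x::euclidean_space" and \<pi> :: "'x \<Rightarrow> 'q::euclidean_space"
  assumes h: "bilinear (\<lambda>a b. \<pi> (wedge a b))"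
  shows "endpoint_map wedge \<pi> u = (primitive (rep_control u) 1,
     (1/2) *\<^sub>R integral {0..1} (\<lambda>t. \<pi> (wedge (primitive (rep_control u) t) (rep_control u t))))"
proof -
  define f where "f = rep_control u"
  define X where "X = primitive f"
  define g where "g t = (f t, (1/2) *\<^sub>R \<pi> (wedge (X t) (f t)))" for t
  have f: "f absolutely_integrable_on {0..1}" unfolding f_def by (rule rep_control_integrable)
  have z: "(\<lambda>t. (1/2) *\<^sub>R \<pi> (wedge (X t) (f t))) absolutely_integrable_on {0..1}"
    unfolding X_def by (rule absolutely_integrable_scaleR_left[OF bilinear_absolutely_integrable[OF h primitive_continuous[OF f] f]])
  have g: "g absolutely_integrable_on {0..1}"
  proof -
    have "(\<lambda>t. (f t, 0::'q)) absolutely_integrable_on {0..1}"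
      using absolutely_integrable_linear[OF f, of "\<lambda>a. (a, 0::'q)"] by (simp add: o_def bounded_linear_Pair bounded_linear_ident bounded_linear_zero)
    moreover have "(\<lambda>t. (0::'v, (1/2) *\<^sub>R \<pi> (wedge (X t) (f t)))) absolutely_integrable_on {0..1}"
      using absolutely_integrable_linear[OF z, of "\<lambda>a. (0::'v, a)"] by (simp add: o_def bounded_linear_Pair bounded_linear_ident bounded_linear_zero)
    ultimately have "(\<lambda>t. (f t, 0::'q) + (0::'v, (1/2) *\<^sub>R \<pi> (wedge (X t) (f t)))) absolutely_integrable_on {0..1}"
      by (rule set_integral_add(1))
    then show ?thesis by (simp add: g_def[abs_def])
  qed
  have fst_g: "fst (primitive g t) = X t" and snd_g: "snd (primitive g t) = integral {0..t} (\<lambda>t. (1/2) *\<^sub>R \<pi> (wedge (X t) (f t)))"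
    if "t \<in> {0..1}" for t
  proof -
    have "g integrable_on {0..t}" using g that by (auto intro!: integrable_subinterval_real[of _ 0 1] simp: absolutely_integrable_on_def)
    from integral_linear[OF this bounded_linear_fst] integral_linear[OF this bounded_linear_snd]
    show "fst (primitive g t) = X t" "snd (primitive g t) = integral {0..t} (\<lambda>t. (1/2) *\<^sub>R \<pi> (wedge (X t) (f t)))"
      by (simp_all add: primitive_def X_def g_def o_def)
  qed
  have cc: "control_curve wedge \<pi> u \<gamma> \<longleftrightarrow> absolutely_continuous_on {0..1} \<gamma> \<and> \<gamma> 0 = 0 \<and>
     (\<exists>N. negligible N \<and> (\<forall>t\<in>{0..1} - N. (\<gamma> has_vector_derivative (f t, (1/2) *\<^sub>R \<pi> (wedge (fst (\<gamma> t)) (f t)))) (at t within {0..1})))" for \<gamma>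
    unfolding control_curve_def AE_lebesgue_on_iff frechet_derivative_group_mult[where wedge = wedge and \<pi> = \<pi>, OF h] f_def ..
  have "endpoint_map wedge \<pi> u = primitive g 1"
    unfolding endpoint_map_def
  proof (rule the_equality)
    obtain N where N: "negligible N" "\<And>t. t \<in> {0..1} - N \<Longrightarrow> (primitive g has_vector_derivative g t) (at t within {0..1})"
      using primitive_derivative[OF g] by blast
    have "control_curve wedge \<pi> u (primitive g)"
      unfolding cc using N primitive_AC[OF g] by (intro conjI exI[of _ N]) (auto simp: fst_g g_def)
    then show "\<exists>\<gamma>. control_curve wedge \<pi> u \<gamma> \<and> \<gamma> 1 = primitive g 1" by blast
    fix p assume "\<exists>\<gamma>. control_curve wedge \<pi> u \<gamma> \<and> \<gamma> 1 = p"
    then obtain \<gamma> M where \<gamma>: "absolutely_continuous_on {0..1} \<gamma>" "\<gamma> 0 = 0" "\<gamma> 1 = p" and M: "negligible M"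
      and der: "\<And>t. t\<in>{0..1} - M \<Longrightarrow> (\<gamma> has_vector_derivative (f t, (1/2) *\<^sub>R \<pi> (wedge (fst (\<gamma> t)) (f t)))) (at t within {0..1})"
      unfolding cc by blast
    have fst_\<gamma>: "fst (\<gamma> t) = X t" if "t \<in> {0..1}" for t
    proof -
      have "fst (\<gamma> t) = fst (\<gamma> 0) + integral {0..t} f"
      proof (rule absolutely_continuous_on_eq_integral[OF _ f M _ that])
        show "absolutely_continuous_on {0..1} (\<lambda>t. fst (\<gamma> t))"
          by (intro absolutely_continuous_on_bounded_linear[OF bounded_linear_fst] \<gamma>)
        fix t assume "t \<in> {0..1} - M"
        from bounded_linear.has_vector_derivative[OF bounded_linear_fst der[OF this]]
        show "((\<lambda>t. fst (\<gamma> t)) has_vector_derivative f t) (at t within {0..1})" by simp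
      qed
      then show ?thesis by (simp add: \<gamma> X_def primitive_def)
    qed
    have "\<gamma> 1 = \<gamma> 0 + integral {0..1} g"
      by (rule absolutely_continuous_on_eq_integral[OF \<gamma>(1) g M]) (use der fst_\<gamma> in \<open>auto simp: g_def\<close>)
    then show "p = primitive g 1" using \<gamma> by (simp add: primitive_def)
  qed
  also have "\<dots> = (X 1, (1/2) *\<^sub>R integral {0..1} (\<lambda>t. \<pi> (wedge (X t) (f t))))"
    using fst_g[of 1] snd_g[of 1] by (simp add: prod_eq_iff)
  finally show ?thesis by (simp add: f_def X_def)
qed

section \<open>Singular controls and their kernels\<close>

text \<open>Along a line the endpoint map is a polynomial of degree two, whose linear coefficient is the
  differential. Integration by parts removes the primitive of \<open>g\<close> from the integral, so that the
  result is linear in the values of \<open>g\<close>.\<close>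

lemma endpoint_map_derivative:
  fixes wedge :: "'v::euclidean_space \<Rightarrow> 'v \<Rightarrow> 'x::euclidean_space" and \<pi> :: "'x \<Rightarrow> 'q::euclidean_space"
  assumes h: "bilinear (\<lambda>a b. \<pi> (wedge a b))" and alt: "\<And>a. wedge a a = 0"
    and D: "(endpoint_map wedge \<pi> has_derivative D) (at u)"
    and g: "g absolutely_integrable_on {0..1}"
  defines "X \<equiv> primitive (rep_control u)"
  shows "D (abs_control g) = (primitive g 1, (1/2) *\<^sub>R \<pi> (wedge (primitive g 1) (X 1))
     + integral {0..1} (\<lambda>t. \<pi> (wedge (X t) (g t))))"
proof -
  define f where "f = rep_control u"
  define Y where "Y = primitive g"
  define h where "h a b = \<pi> (wedge a b)" for a b
  have h_bil: "bilinear h" using h by (simp add: h_def[abs_def])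
  note hs = bilinear_ladd[OF h_bil] bilinear_radd[OF h_bil] bilinear_lmul[OF h_bil] bilinear_rmul[OF h_bil]
  have h_alt: "h a a = 0" for a
    using bilinear_lzero[OF h_bil, of 0] alt[of a] alt[of 0] by (simp add: h_def)
  have h_skew: "h a b = - h b a" for a b
    using h_alt[of "a + b"] h_alt[of a] h_alt[of b] unfolding hs by (simp add: add_eq_0_iff)
  have f: "f absolutely_integrable_on {0..1}" unfolding f_def by (rule rep_control_integrable)
  have X: "X = primitive f" by (simp add: X_def f_def)
  have cX: "continuous_on {0..1} X" and cY: "continuous_on {0..1} Y"
    unfolding X Y_def by (rule primitive_continuous[OF f] primitive_continuous[OF g])+
  note ai = bilinear_absolutely_integrable[OF h_bil]
  have int: "(\<lambda>t. h (X t) (f t)) integrable_on {0..1}" "(\<lambda>t. h (X t) (g t)) integrable_on {0..1}"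
    "(\<lambda>t. h (Y t) (f t)) integrable_on {0..1}" "(\<lambda>t. h (Y t) (g t)) integrable_on {0..1}"
    by (rule set_lebesgue_integral_eq_integral(1)[OF ai[OF cX f]] set_lebesgue_integral_eq_integral(1)[OF ai[OF cX g]]
       set_lebesgue_integral_eq_integral(1)[OF ai[OF cY f]] set_lebesgue_integral_eq_integral(1)[OF ai[OF cY g]])+
  define I where "I p q = integral {0..1} (\<lambda>t. h (p t) (q t))" for p q :: "real \<Rightarrow> 'v"
  have F: "endpoint_map wedge \<pi> (u + s *\<^sub>R abs_control g)
     = (X 1 + s *\<^sub>R Y 1, (1/2) *\<^sub>R (I X f + s *\<^sub>R (I X g + I Y f) + s^2 *\<^sub>R I Y g))" for s
  proof -
    define k where "k t = f t + s *\<^sub>R g t" for t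
    have k: "k absolutely_integrable_on {0..1}" unfolding k_def
      by (rule set_integral_add(1)[OF f absolutely_integrable_scaleR_left[OF g]])
    have "ae_equal (rep_control (u + s *\<^sub>R abs_control g)) k"
      unfolding control_add_scale[OF g] f_def[symmetric] k_def[symmetric] by (rule ae_equal_rep_abs[OF k])
    from ae_equal_negligible[OF this]
    obtain N where N: "negligible N" "\<And>t. t \<in> {0..1} - N \<Longrightarrow> rep_control (u + s *\<^sub>R abs_control g) t = k t"
      by blast
    have P: "primitive (rep_control (u + s *\<^sub>R abs_control g)) t = X t + s *\<^sub>R Y t" if "t \<in> {0..1}" for t
      using primitive_cong[OF N] primitive_add_scale[OF f g that, of s] that by (simp add: k_def[abs_def] X Y_def)
    have "integral {0..1} (\<lambda>t. \<pi> (wedge (primitive (rep_control (u + s *\<^sub>R abs_control g)) t) (rep_control (u + s *\<^sub>R abs_control g) t)))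
       = integral {0..1} (\<lambda>t. h (X t) (f t) + (s *\<^sub>R (h (X t) (g t) + h (Y t) (f t)) + s^2 *\<^sub>R h (Y t) (g t)))"
    proof (rule integral_spike[OF N(1)])
      fix t assume "t \<in> {0..1} - N"
      then show "h (X t) (f t) + (s *\<^sub>R (h (X t) (g t) + h (Y t) (f t)) + s^2 *\<^sub>R h (Y t) (g t))
         = \<pi> (wedge (primitive (rep_control (u + s *\<^sub>R abs_control g)) t) (rep_control (u + s *\<^sub>R abs_control g) t))"
        by (simp add: P N k_def hs flip: h_def) (simp add: algebra_simps power2_eq_square)
    qed
    also have "\<dots> = I X f + s *\<^sub>R (I X g + I Y f) + s^2 *\<^sub>R I Y g"
      using int by (simp add: I_def Henstock_Kurzweil_Integration.integral_add integrable_add integrable_cmul)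
    finally show ?thesis
      using P[of 1] by (simp add: endpoint_map_eq[where wedge = wedge and \<pi> = \<pi>, OF h])
  qed
  have "((\<lambda>s. endpoint_map wedge \<pi> (u + s *\<^sub>R abs_control g)) has_vector_derivative D (abs_control g)) (at 0)"
  proof -
    have 1: "((\<lambda>s::real. u + s *\<^sub>R abs_control g) has_derivative (\<lambda>s. s *\<^sub>R abs_control g)) (at 0)"
      by (auto intro!: derivative_eq_intros)
    have "(endpoint_map wedge \<pi> has_derivative D) (at (u + 0 *\<^sub>R abs_control g))" using D by simp
    from has_derivative_compose[OF 1 this]
    have "((\<lambda>s. endpoint_map wedge \<pi> (u + s *\<^sub>R abs_control g)) has_derivative (\<lambda>s. D (s *\<^sub>R abs_control g))) (at 0)" .
    then show ?thesis
      using has_derivative_linear[OF D] by (simp add: has_vector_derivative_def linear_scale)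
  qed
  moreover have "((\<lambda>s. endpoint_map wedge \<pi> (u + s *\<^sub>R abs_control g)) has_vector_derivative
      (Y 1, (1/2) *\<^sub>R (I X g + I Y f))) (at 0)"
    unfolding F
    apply (rule has_vector_derivative_eq_rhs)
     apply (rule has_vector_derivative_Pair)
    by (auto intro!: derivative_eq_intros)
  ultimately have "D (abs_control g) = (Y 1, (1/2) *\<^sub>R (I X g + I Y f))"
    by (rule vector_derivative_unique_at)
  moreover have "I Y f = h (Y 1) (X 1) + I X g"
  proof -
    have "h (Y 1) (X 1) = integral {0..1} (\<lambda>t. h (g t) (X t)) + I Y f"
      unfolding X Y_def I_def by (rule integral_by_parts_primitive[OF h_bil g f])
    also have "(\<lambda>t. h (g t) (X t)) = (\<lambda>t. - h (X t) (g t))" using h_skew by blast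
    finally show ?thesis by (simp add: I_def)
  qed
  ultimately have "D (abs_control g) = (Y 1, (1/2) *\<^sub>R (h (Y 1) (X 1) + (2::real) *\<^sub>R I X g))"
    by (simp add: scaleR_2 add_ac)
  then show ?thesis by (simp add: h_def I_def Y_def scaleR_add_right)
qed

text \<open>A covector \<open>(l, \<mu>)\<close> orthogonal to the image of the differential acts on \<open>g\<close> as
  the integral of \<open>\<kappa> t \<bullet> g t\<close> with a continuous function \<open>\<kappa>\<close>. Testing it on
  \<open>g = \<kappa>\<close> shows that \<open>\<kappa>\<close> vanishes on the whole interval.\<close>

lemma singular_control_kernel:
  fixes wedge :: "'v::euclidean_space \<Rightarrow> 'v \<Rightarrow> 'x::euclidean_space" and \<pi> :: "'x \<Rightarrow> 'q::euclidean_space"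
  assumes h: "bilinear (\<lambda>a b. \<pi> (wedge a b))" and alt: "\<And>a. wedge a a = 0"
    and sing: "singular_control wedge \<pi> u"
  shows "\<exists>\<mu>. \<mu> \<noteq> 0 \<and> (\<forall>t\<in>{0..1}. \<forall>w. \<mu> \<bullet> \<pi> (wedge (primitive (rep_control u) t) w) = 0)"
proof -
  define X where "X = primitive (rep_control u)"
  have cX: "continuous_on {0..1} X" unfolding X_def by (rule primitive_continuous[OF rep_control_integrable])
  obtain D where D: "(endpoint_map wedge \<pi> has_derivative D) (at u)" "\<not> surj D"
    using sing by (auto simp: singular_control_def)
  have "linear D" using D(1) by (rule has_derivative_linear)
  then have "subspace (range D)" by (rule linear_subspace_image) simp
  then have "span (range D) \<noteq> UNIV" using D(2) by (simp add: span_eq_iff[THEN iffD2])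
  then obtain a where a: "a \<noteq> 0" "\<forall>y\<in>span (range D). a \<bullet> y = 0"
    using span_not_UNIV_orthogonal by blast
  obtain l \<mu> where lm: "a = (l, \<mu>)" by (cases a)
  have orth: "l \<bullet> primitive g 1 + \<mu> \<bullet> ((1/2) *\<^sub>R \<pi> (wedge (primitive g 1) (X 1)) + integral {0..1} (\<lambda>t. \<pi> (wedge (X t) (g t)))) = 0"
    if "g absolutely_integrable_on {0..1}" for g
  proof -
    have "a \<bullet> D (abs_control g) = 0" using a(2) span_base[of "D (abs_control g)" "range D"] by blast
    then show ?thesis
      unfolding endpoint_map_derivative[where wedge = wedge and \<pi> = \<pi>, OF h alt D(1) that] lm X_def by simp
  qed
  define \<kappa> where "\<kappa> t = (\<Sum>b\<in>Basis. (l \<bullet> b + (1/2) * (\<mu> \<bullet> \<pi> (wedge b (X 1))) + \<mu> \<bullet> \<pi> (wedge (X t) b)) *\<^sub>R b)" for t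
  have lin1: "linear (\<lambda>b. l \<bullet> b + (1/2) * (\<mu> \<bullet> \<pi> (wedge b (X 1))) + \<mu> \<bullet> \<pi> (wedge x b))" for x
    by (rule linearI) (simp_all add: bilinear_ladd[OF h] bilinear_radd[OF h] bilinear_lmul[OF h] bilinear_rmul[OF h] inner_add_right algebra_simps)
  have \<kappa>_inner: "\<kappa> t \<bullet> w = l \<bullet> w + (1/2) * (\<mu> \<bullet> \<pi> (wedge w (X 1))) + \<mu> \<bullet> \<pi> (wedge (X t) w)" for t w
  proof -
    have "\<kappa> t \<bullet> w = (\<Sum>b\<in>Basis. (w \<bullet> b) * (l \<bullet> b + (1/2) * (\<mu> \<bullet> \<pi> (wedge b (X 1))) + \<mu> \<bullet> \<pi> (wedge (X t) b)))"
      unfolding \<kappa>_def inner_sum_left inner_scaleR_left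
      by (intro sum.cong refl) (simp add: inner_commute mult.commute)
    also have "\<dots> = l \<bullet> w + (1/2) * (\<mu> \<bullet> \<pi> (wedge w (X 1))) + \<mu> \<bullet> \<pi> (wedge (X t) w)"
      using linear_sum[OF lin1[of "X t"], of "\<lambda>b. (w \<bullet> b) *\<^sub>R b" Basis]
      by (simp only: euclidean_representation linear_scale[OF lin1] real_scaleR_def)
    finally show ?thesis .
  qed
  have wc: "continuous_on {0..1} (\<lambda>t. \<pi> (wedge (X t) b))" for b
    using continuous_on_compose2[OF linear_continuous_on cX, of "\<lambda>x. \<pi> (wedge x b)" UNIV]
      h by (auto simp: bilinear_def linear_conv_bounded_linear)
  have c\<kappa>: "continuous_on {0..1} \<kappa>"
    unfolding \<kappa>_def by (intro continuous_intros wc)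
  have \<kappa>: "\<kappa> absolutely_integrable_on {0..1}"
    using c\<kappa> by (rule absolutely_integrable_continuous_real)
  have ih: "(\<lambda>t. \<pi> (wedge (X t) (\<kappa> t))) integrable_on {0..1}"
    by (rule set_lebesgue_integral_eq_integral(1)[OF bilinear_absolutely_integrable[OF h cX \<kappa>]])
  have i\<kappa>: "\<kappa> integrable_on {0..1}" by (rule set_lebesgue_integral_eq_integral(1)[OF \<kappa>])
  let ?L = "\<lambda>b. l \<bullet> b + (1/2) * (\<mu> \<bullet> \<pi> (wedge b (X 1)))"
  have L: "bounded_linear ?L" using lin1[of 0] bilinear_lzero[OF h] by (simp add: linear_conv_bounded_linear)
  have "integral {0..1} (\<lambda>t. \<kappa> t \<bullet> \<kappa> t) = integral {0..1} (\<lambda>t. ?L (\<kappa> t) + \<mu> \<bullet> \<pi> (wedge (X t) (\<kappa> t)))"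
    by (simp only: \<kappa>_inner)
  also have "\<dots> = integral {0..1} (\<lambda>t. ?L (\<kappa> t)) + integral {0..1} (\<lambda>t. \<mu> \<bullet> \<pi> (wedge (X t) (\<kappa> t)))"
    by (rule Henstock_Kurzweil_Integration.integral_add)
      (use integrable_linear[OF i\<kappa> L] integrable_linear[OF ih bounded_linear_inner_right[of \<mu>]] in \<open>simp_all add: o_def\<close>)
  also have "integral {0..1} (\<lambda>t. ?L (\<kappa> t)) = ?L (primitive \<kappa> 1)"
    using integral_linear[OF i\<kappa> L] by (simp add: o_def primitive_def)
  also have "integral {0..1} (\<lambda>t. \<mu> \<bullet> \<pi> (wedge (X t) (\<kappa> t))) = \<mu> \<bullet> integral {0..1} (\<lambda>t. \<pi> (wedge (X t) (\<kappa> t)))"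
    using integral_linear[OF ih bounded_linear_inner_right[of \<mu>]] by (simp add: o_def)
  also have "?L (primitive \<kappa> 1) + \<mu> \<bullet> integral {0..1} (\<lambda>t. \<pi> (wedge (X t) (\<kappa> t))) = 0"
    using orth[OF \<kappa>] by (simp add: inner_add_right)
  finally have "integral (cbox 0 1) (\<lambda>t. \<kappa> t \<bullet> \<kappa> t) = 0" by simp
  moreover have "continuous_on (cbox 0 1) (\<lambda>t. \<kappa> t \<bullet> \<kappa> t)" using c\<kappa> by (auto intro!: continuous_intros)
  ultimately have z: "\<kappa> t = 0" if "t \<in> {0..1}" for t
    using integral_eq_0_iff[of 0 1 "\<lambda>t. \<kappa> t \<bullet> \<kappa> t"] that by auto
  have X0: "X 0 = 0" by (simp add: X_def)
  have l: "l \<bullet> w + (1/2) * (\<mu> \<bullet> \<pi> (wedge w (X 1))) = 0" for w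
    using \<kappa>_inner[of 0 w] z[of 0] X0 bilinear_lzero[OF h] by simp
  have ker: "\<mu> \<bullet> \<pi> (wedge (X t) w) = 0" if "t \<in> {0..1}" for t w
    using \<kappa>_inner[of t w] z[OF that] l[of w] by simp
  have "\<mu> \<noteq> 0"
  proof
    assume "\<mu> = 0"
    with l[of l] have "l = 0" by simp
    with \<open>\<mu> = 0\<close> a(1) lm show False by (simp add: zero_prod_def)
  qed
  with ker show ?thesis by (auto simp: X_def)
qed

text \<open>The primitive of a singular control stays in the kernel of \<open>\<mu> \<bullet> \<pi> (wedge _ _)\<close>, hence so
  does its derivative almost everywhere. Expanding both factors of the integrand in the vectors
  \<open>P b\<close> expresses the vertical component of the endpoint through brackets of kernel vectors. For
  this \<open>P\<close> has to fix the kernel, as a projection onto it does.\<close>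

lemma abnormal_point_kernel:
  fixes wedge :: "'v::euclidean_space \<Rightarrow> 'v \<Rightarrow> 'x::euclidean_space" and \<pi> :: "'x \<Rightarrow> 'q::euclidean_space"
  assumes h: "bilinear (\<lambda>a b. \<pi> (wedge a b))" and alt: "\<And>a. wedge a a = 0"
    and p: "p \<in> abnormal_set wedge \<pi>"
  shows "\<exists>\<mu>. \<mu> \<noteq> 0 \<and> (\<forall>w. \<mu> \<bullet> \<pi> (wedge (fst p) w) = 0) \<and>
     (\<forall>P. linear P \<longrightarrow> (\<forall>a. (\<forall>w. \<mu> \<bullet> \<pi> (wedge a w) = 0) \<longrightarrow> P a = a) \<longrightarrow>
       (\<exists>\<zeta>. snd p = (\<Sum>b\<in>Basis. \<Sum>c\<in>Basis. \<zeta> b c *\<^sub>R \<pi> (wedge (P b) (P c)))))"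
proof -
  obtain u where u: "p = endpoint_map wedge \<pi> u" "singular_control wedge \<pi> u"
    using p by (auto simp: abnormal_set_def)
  define f where "f = rep_control u"
  define X where "X = primitive f"
  have f: "f absolutely_integrable_on {0..1}" unfolding f_def by (rule rep_control_integrable)
  have cX: "continuous_on {0..1} X" unfolding X_def by (rule primitive_continuous[OF f])
  have p: "p = (X 1, (1/2) *\<^sub>R integral {0..1} (\<lambda>t. \<pi> (wedge (X t) (f t))))"
    unfolding u endpoint_map_eq[where wedge = wedge and \<pi> = \<pi>, OF h] X_def f_def ..
  obtain \<mu> where \<mu>: "\<mu> \<noteq> 0" "\<And>t w. t \<in> {0..1} \<Longrightarrow> \<mu> \<bullet> \<pi> (wedge (X t) w) = 0"
    using singular_control_kernel[where wedge = wedge and \<pi> = \<pi>, OF h alt u(2)] unfolding X_def f_def by blast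
  obtain N where N: "negligible N" "\<And>t. t \<in> {0..1} - N \<Longrightarrow> (X has_vector_derivative f t) (at t within {0..1})"
    using primitive_derivative[OF f] unfolding X_def by blast
  have fk: "\<mu> \<bullet> \<pi> (wedge (f t) w) = 0" if t: "t \<in> {0..1} - N" for t w
  proof -
    have "linear (\<lambda>a. \<mu> \<bullet> \<pi> (wedge a w))"
      by (rule linearI) (simp_all add: bilinear_ladd[OF h] bilinear_lmul[OF h] inner_add_right)
    then have "bounded_linear (\<lambda>a. \<mu> \<bullet> \<pi> (wedge a w))" by (simp add: linear_conv_bounded_linear)
    from bounded_linear.has_vector_derivative[OF this N(2)[OF t]]
    have "((\<lambda>t. \<mu> \<bullet> \<pi> (wedge (X t) w)) has_vector_derivative \<mu> \<bullet> \<pi> (wedge (f t) w)) (at t within {0..1})" .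
    moreover have "((\<lambda>t. \<mu> \<bullet> \<pi> (wedge (X t) w)) has_vector_derivative 0) (at t within {0..1})"
      by (rule has_vector_derivative_transform[OF _ _ has_vector_derivative_const[of 0]]) (use t \<mu> in auto)
    ultimately show ?thesis
      using t by (intro vector_derivative_unique_within_closed_interval[of 0 1 t "\<lambda>t. \<mu> \<bullet> \<pi> (wedge (X t) w)"]) auto
  qed
  show ?thesis
  proof (intro exI[of _ \<mu>] conjI allI impI)
    show "\<mu> \<noteq> 0" by fact
    show "\<mu> \<bullet> \<pi> (wedge (fst p) w) = 0" for w using \<mu>(2)[of 1] by (simp add: p)
    fix P :: "'v \<Rightarrow> 'v" assume P: "linear P" "\<forall>a. (\<forall>w. \<mu> \<bullet> \<pi> (wedge a w) = 0) \<longrightarrow> P a = a"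
    have hi: "(\<lambda>t. ((X t \<bullet> b) * (f t \<bullet> c))) integrable_on {0..1}" for b c :: 'v
    proof -
      have bil: "bilinear (\<lambda>x y::'v. (x \<bullet> b) * (y \<bullet> c))"
        unfolding bilinear_def by (auto intro!: linearI simp: inner_add_left algebra_simps)
      show ?thesis
        by (rule set_lebesgue_integral_eq_integral(1)[OF bilinear_absolutely_integrable[OF bil cX f]])
    qed
    have "integral {0..1} (\<lambda>t. \<pi> (wedge (X t) (f t)))
      = integral {0..1} (\<lambda>t. \<Sum>b\<in>Basis. \<Sum>c\<in>Basis. ((X t \<bullet> b) * (f t \<bullet> c)) *\<^sub>R \<pi> (wedge (P b) (P c)))"
    proof (rule integral_spike[OF N(1)])
      fix t assume t: "t \<in> {0..1} - N"
      have "X t = P (X t)" using P(2) \<mu>(2) t by auto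
      also have "\<dots> = P (\<Sum>b\<in>Basis. (X t \<bullet> b) *\<^sub>R b)" by (simp only: euclidean_representation)
      also have "\<dots> = (\<Sum>b\<in>Basis. (X t \<bullet> b) *\<^sub>R P b)" by (simp add: linear_sum[OF P(1)] linear_scale[OF P(1)])
      finally have 1: "X t = (\<Sum>b\<in>Basis. (X t \<bullet> b) *\<^sub>R P b)" .
      have "f t = P (f t)" using P(2) fk[OF t] by auto
      also have "\<dots> = P (\<Sum>b\<in>Basis. (f t \<bullet> b) *\<^sub>R b)" by (simp only: euclidean_representation)
      also have "\<dots> = (\<Sum>b\<in>Basis. (f t \<bullet> b) *\<^sub>R P b)" by (simp add: linear_sum[OF P(1)] linear_scale[OF P(1)])
      finally have 2: "f t = (\<Sum>b\<in>Basis. (f t \<bullet> b) *\<^sub>R P b)" .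
      have "\<pi> (wedge (X t) (f t)) = \<pi> (wedge (\<Sum>b\<in>Basis. (X t \<bullet> b) *\<^sub>R P b) (\<Sum>c\<in>Basis. (f t \<bullet> c) *\<^sub>R P c))"
        using 1 2 by simp
      also have "\<dots> = (\<Sum>b\<in>Basis. \<Sum>c\<in>Basis. ((X t \<bullet> b) * (f t \<bullet> c)) *\<^sub>R \<pi> (wedge (P b) (P c)))"
        by (simp add: bilinear_sum[OF h] sum.cartesian_product bilinear_lmul[OF h] bilinear_rmul[OF h] mult.commute)
      finally show "(\<Sum>b\<in>Basis. \<Sum>c\<in>Basis. ((X t \<bullet> b) * (f t \<bullet> c)) *\<^sub>R \<pi> (wedge (P b) (P c))) = \<pi> (wedge (X t) (f t))" by simp
    qed
    also have "\<dots> = (\<Sum>b\<in>Basis. \<Sum>c\<in>Basis. integral {0..1} (\<lambda>t. (X t \<bullet> b) * (f t \<bullet> c)) *\<^sub>R \<pi> (wedge (P b) (P c)))"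
    proof -
      have "integral {0..1} (\<lambda>t. ((X t \<bullet> b) * (f t \<bullet> c)) *\<^sub>R \<pi> (wedge (P b) (P c)))
         = integral {0..1} (\<lambda>t. (X t \<bullet> b) * (f t \<bullet> c)) *\<^sub>R \<pi> (wedge (P b) (P c))" for b c
        using integral_linear[OF hi bounded_linear_scaleR_left[of "\<pi> (wedge (P b) (P c))"]] by (simp add: o_def)
      moreover have "(\<lambda>t. ((X t \<bullet> b) * (f t \<bullet> c)) *\<^sub>R \<pi> (wedge (P b) (P c))) integrable_on {0..1}" for b c
        using integrable_linear[OF hi bounded_linear_scaleR_left[of "\<pi> (wedge (P b) (P c))"]] by (simp add: o_def)
      ultimately show ?thesis by (simp add: Henstock_Kurzweil_Integration.integral_sum integrable_sum)
    qed
    finally show "\<exists>\<zeta>. snd p = (\<Sum>b\<in>Basis. \<Sum>c\<in>Basis. \<zeta> b c *\<^sub>R \<pi> (wedge (P b) (P c)))"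
      by (intro exI[of _ "\<lambda>b c. (1/2) * integral {0..1} (\<lambda>t. (X t \<bullet> b) * (f t \<bullet> c))"]) (simp add: p scaleR_sum_right)
  qed
qed

section \<open>Extension of derivations in characteristic zero\<close>

text \<open>The graph of a derivation that is defined on a subring of a field. The closure conditions say
  that it is a subring of the dual numbers $x+x'\varepsilon$; a subring of the dual numbers is a graph if it
  contains no nonzero multiple of $\varepsilon$.\<close>

definition derivation_graph :: "('a::field \<times> 'a) set \<Rightarrow> bool" where
  "derivation_graph R \<longleftrightarrow> (0, 0) \<in> R \<and> (1, 0) \<in> R \<and>
     (\<forall>x x' y y'. (x, x') \<in> R \<longrightarrow> (y, y') \<in> R \<longrightarrow>
        (x + y, x' + y') \<in> R \<and> (x * y, x * y' + x' * y) \<in> R) \<and>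
     (\<forall>x x'. (x, x') \<in> R \<longrightarrow> (- x, - x') \<in> R) \<and>
     (\<forall>y. (0, y) \<in> R \<longrightarrow> y = 0)"

lemma derivation_graphD:
  assumes "derivation_graph R"
  shows "(0, 0) \<in> R" "(1, 0) \<in> R"
    "(x, x') \<in> R \<Longrightarrow> (y, y') \<in> R \<Longrightarrow> (x + y, x' + y') \<in> R"
    "(x, x') \<in> R \<Longrightarrow> (y, y') \<in> R \<Longrightarrow> (x * y, x * y' + x' * y) \<in> R"
    "(x, x') \<in> R \<Longrightarrow> (- x, - x') \<in> R"
    "(0, y) \<in> R \<Longrightarrow> y = 0"
  using assms unfolding derivation_graph_def by blast+

lemma derivation_graph_functional:
  assumes R: "derivation_graph R" and "(x, y) \<in> R" "(x, z) \<in> R"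
  shows "y = z"
proof -
  have "(x + (- x), y + (- z)) \<in> R"
    by (intro derivation_graphD[OF R] assms)
  then have "y - z = 0" using derivation_graphD(6)[OF R, of "y - z"] by simp
  then show ?thesis by simp
qed

lemma derivation_graph_sum:
  assumes R: "derivation_graph R" and "\<And>i. i \<in> I \<Longrightarrow> (f i, g i) \<in> R"
  shows "(sum f I, sum g I) \<in> R"
  using assms(2)
  by (induction I rule: infinite_finite_induct) (auto intro: derivation_graphD[OF R])

text \<open>The graph of coefficientwise differentiation.\<close>

definition coeff_graph :: "('a::field \<times> 'a) set \<Rightarrow> ('a poly \<times> 'a poly) set" where
  "coeff_graph R = {(p, q). \<forall>k. (coeff p k, coeff q k) \<in> R}"

lemma coeff_graph_closed:
  assumes R: "derivation_graph R"
  shows "(0, 0) \<in> coeff_graph R"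
    "(a, b) \<in> R \<Longrightarrow> ([:a:], [:b:]) \<in> coeff_graph R"
    "(a, b) \<in> R \<Longrightarrow> (monom a n, monom b n) \<in> coeff_graph R"
    "(p, q) \<in> coeff_graph R \<Longrightarrow> (p', q') \<in> coeff_graph R \<Longrightarrow> (p + p', q + q') \<in> coeff_graph R"
    "(p, q) \<in> coeff_graph R \<Longrightarrow> (p', q') \<in> coeff_graph R \<Longrightarrow> (p * p', p * q' + q * p') \<in> coeff_graph R"
    "(p, q) \<in> coeff_graph R \<Longrightarrow> (- p, - q) \<in> coeff_graph R"
    "(0, q) \<in> coeff_graph R \<Longrightarrow> q = 0"
proof -
  note RD = derivation_graphD[OF R]
  show "(0, 0) \<in> coeff_graph R" "(p, q) \<in> coeff_graph R \<Longrightarrow> (- p, - q) \<in> coeff_graph R"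
    "(p, q) \<in> coeff_graph R \<Longrightarrow> (p', q') \<in> coeff_graph R \<Longrightarrow> (p + p', q + q') \<in> coeff_graph R"
    "(a, b) \<in> R \<Longrightarrow> (monom a n, monom b n) \<in> coeff_graph R"
    by (auto simp: coeff_graph_def RD)
  show "(a, b) \<in> R \<Longrightarrow> ([:a:], [:b:]) \<in> coeff_graph R"
    by (auto simp: coeff_graph_def coeff_pCons RD split: nat.split)
  show "(0, q) \<in> coeff_graph R \<Longrightarrow> q = 0"
    by (auto simp: coeff_graph_def poly_eq_iff RD(6))
  show "(p, q) \<in> coeff_graph R \<Longrightarrow> (p', q') \<in> coeff_graph R \<Longrightarrow> (p * p', p * q' + q * p') \<in> coeff_graph R"
    unfolding coeff_graph_def
    by (auto simp: coeff_mult simp flip: sum.distrib intro!: derivation_graph_sum[OF R] RD(4))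
qed

text \<open>The derivative of \<open>poly p a\<close> that the chain rule prescribes when \<open>q\<close> is the
  coefficientwise derivative of \<open>p\<close> and the derivative of \<open>a\<close> is \<open>b\<close>.\<close>

definition total_deriv :: "'a::field \<Rightarrow> 'a \<Rightarrow> 'a poly \<Rightarrow> 'a poly \<Rightarrow> 'a" where
  "total_deriv a b p q = poly q a + poly (pderiv p) a * b"

definition adjoin :: "('a::field \<times> 'a) set \<Rightarrow> 'a \<Rightarrow> 'a \<Rightarrow> ('a \<times> 'a) set" where
  "adjoin R a b = {(poly p a, total_deriv a b p q) | p q. (p, q) \<in> coeff_graph R}"

lemma subset_adjoin:
  assumes R: "derivation_graph R"
  shows "R \<subseteq> adjoin R a b" "(a, b) \<in> adjoin R a b"
proof -
  show "R \<subseteq> adjoin R a b"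
  proof (rule subrelI)
    fix x y assume "(x, y) \<in> R"
    then have "([:x:], [:y:]) \<in> coeff_graph R" by (rule coeff_graph_closed[OF R])
    then show "(x, y) \<in> adjoin R a b"
      unfolding adjoin_def by (intro CollectI exI[of _ "[:x:]"] exI[of _ "[:y:]"]) (simp add: total_deriv_def pderiv_pCons)
  qed
  have "(monom 1 1, monom 0 1) \<in> coeff_graph R"
    by (intro coeff_graph_closed[OF R] derivation_graphD[OF R])
  then show "(a, b) \<in> adjoin R a b"
    unfolding adjoin_def by (intro CollectI exI[of _ "monom 1 1"] exI[of _ "0"]) (simp add: total_deriv_def pderiv_monom poly_monom)
qed

lemma derivation_graph_adjoin:
  assumes R: "derivation_graph R"
    and wd: "\<And>p q. (p, q) \<in> coeff_graph R \<Longrightarrow> poly p a = 0 \<Longrightarrow> total_deriv a b p q = 0"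
  shows "derivation_graph (adjoin R a b)"
  unfolding derivation_graph_def
proof (intro conjI allI impI)
  show "(0, 0) \<in> adjoin R a b" "(1, 0) \<in> adjoin R a b"
    using subset_adjoin[OF R] derivation_graphD[OF R] by auto
next
  fix x x' y y' assume "(x, x') \<in> adjoin R a b" "(y, y') \<in> adjoin R a b"
  then obtain p q p' q' where *: "x = poly p a" "x' = total_deriv a b p q" "(p, q) \<in> coeff_graph R"
    "y = poly p' a" "y' = total_deriv a b p' q'" "(p', q') \<in> coeff_graph R"
    unfolding adjoin_def by blast
  show "(x + y, x' + y') \<in> adjoin R a b"
    unfolding adjoin_def using coeff_graph_closed(4)[OF R *(3,6)]
    by (intro CollectI exI conjI) (auto simp: * total_deriv_def pderiv_add algebra_simps)
  show "(x * y, x * y' + x' * y) \<in> adjoin R a b"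
    unfolding adjoin_def using coeff_graph_closed(5)[OF R *(3,6)]
    by (intro CollectI exI conjI) (auto simp: * total_deriv_def pderiv_mult algebra_simps)
next
  fix x x' assume "(x, x') \<in> adjoin R a b"
  then obtain p q where *: "x = poly p a" "x' = total_deriv a b p q" "(p, q) \<in> coeff_graph R"
    unfolding adjoin_def by blast
  show "(- x, - x') \<in> adjoin R a b"
    unfolding adjoin_def using coeff_graph_closed(6)[OF R *(3)]
    by (intro CollectI exI conjI) (auto simp: * total_deriv_def pderiv_minus algebra_simps)
next
  fix y assume "(0, y) \<in> adjoin R a b"
  then obtain p q where "0 = poly p a" "y = total_deriv a b p q" "(p, q) \<in> coeff_graph R"
    unfolding adjoin_def by blast
  with wd[of p q] show "y = 0" by simp
qed

definition transcendental_over :: "'a::field set \<Rightarrow> 'a \<Rightarrow> bool" where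
  "transcendental_over B a \<longleftrightarrow> (\<forall>p. (\<forall>k. coeff p k \<in> B) \<and> poly p a = 0 \<longrightarrow> p = 0)"

text \<open>No polynomial relation of \<open>a\<close> over the domain restricts the choice of the derivative \<open>b\<close>.\<close>

lemma derivation_graph_adjoin_transcendental:
  assumes R: "derivation_graph R" and a: "transcendental_over (Domain R) a"
  shows "derivation_graph (adjoin R a b)"
proof (rule derivation_graph_adjoin[OF R])
  fix p q assume pq: "(p, q) \<in> coeff_graph R" "poly p a = 0"
  then have "\<forall>k. coeff p k \<in> Domain R" by (auto simp: coeff_graph_def)
  with a pq have "p = 0" by (auto simp: transcendental_over_def)
  with pq coeff_graph_closed(7)[OF R, of q] show "total_deriv a b p q = 0"
    by (simp add: total_deriv_def)
qed

text \<open>Let \<open>G\<close> be a relation of \<open>a\<close> of least degree. In characteristic zero \<open>a\<close> is not a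
  root of the derivative of \<open>G\<close>, so \<open>b\<close> can be chosen such that the chain rule holds for
  \<open>G\<close>. Every other relation is reduced to \<open>G\<close> by pseudo-division, which is carried out one
  degree at a time.\<close>

lemma derivation_graph_adjoin_algebraic:
  fixes R :: "('a::field_char_0 \<times> 'a) set"
  assumes R: "derivation_graph R" and a: "\<not> transcendental_over (Domain R) a"
  shows "\<exists>b. derivation_graph (adjoin R a b)"
proof -
  define A where "A p q \<longleftrightarrow> (p, q) \<in> coeff_graph R \<and> poly p a = 0 \<and> p \<noteq> 0" for p q
  obtain p0 where p0: "\<forall>k. coeff p0 k \<in> Domain R" "poly p0 a = 0" "p0 \<noteq> 0"
    using a by (auto simp: transcendental_over_def)
  have "\<exists>q0. \<forall>k. (coeff p0 k, coeff q0 k) \<in> R"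
  proof -
    have "\<forall>k. \<exists>d. (coeff p0 k, d) \<in> R" using p0(1) by blast
    then obtain d where d: "\<And>k. (coeff p0 k, d k) \<in> R" by metis
    have "d k = 0" if "k > degree p0" for k
      using d[of k] coeff_eq_0[OF that] derivation_graphD(6)[OF R] by simp
    then have "coeff (Abs_poly d) k = d k" for k
      by (subst coeff_Abs_poly[of "degree p0"]) auto
    with d show ?thesis by (intro exI[of _ "Abs_poly d"]) simp
  qed
  then have "\<exists>p q. A p q" using p0 by (auto simp: A_def coeff_graph_def)
  then obtain G H where G: "A G H" and least: "\<And>p q. A p q \<Longrightarrow> degree G \<le> degree p"
    using ex_has_least_nat[of "\<lambda>(p,q). A p q" _ "\<lambda>(p,q). degree p"] by fast
  have GH: "(G, H) \<in> coeff_graph R" "poly G a = 0" "G \<noteq> 0" using G by (auto simp: A_def)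
  have deg: "degree G > 0"
  proof (rule ccontr)
    assume "\<not> degree G > 0"
    then obtain c where "G = [:c:]" by (auto elim: degree_eq_zeroE)
    with GH show False by simp
  qed
  have G': "poly (pderiv G) a \<noteq> 0"
  proof
    assume z: "poly (pderiv G) a = 0"
    have nat: "(of_nat n, 0) \<in> R" for n
      by (induction n) (auto intro: derivation_graphD(1)[OF R] dest: derivation_graphD(3)[OF R derivation_graphD(2)[OF R]])
    then have "(of_nat (Suc k) * coeff G (Suc k), of_nat (Suc k) * coeff H (Suc k) + 0 * coeff G (Suc k)) \<in> R" for k
      using GH(1) by (intro derivation_graphD(4)[OF R] nat) (auto simp: coeff_graph_def)
    then have "(pderiv G, pderiv H) \<in> coeff_graph R" by (simp add: coeff_graph_def coeff_pderiv)
    moreover have "pderiv G \<noteq> 0" using deg by (simp add: pderiv_eq_0_iff)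
    ultimately have "A (pderiv G) (pderiv H)" using z by (simp add: A_def)
    from least[OF this] deg show False by (simp add: degree_pderiv)
  qed
  define b where "b = - poly H a / poly (pderiv G) a"
  have tG: "total_deriv a b G H = 0" using G' by (simp add: total_deriv_def b_def)
  have "total_deriv a b p q = 0" if "(p, q) \<in> coeff_graph R" "poly p a = 0" for p q
    using that
  proof (induction "degree p" arbitrary: p q rule: less_induct)
    case less
    show ?case
    proof (cases "p = 0")
      case True
      with less coeff_graph_closed(7)[OF R, of q] show ?thesis by (simp add: total_deriv_def)
    next
      case False
      with less have "A p q" by (simp add: A_def)
      then have le: "degree G \<le> degree p" by (rule least)
      define n where "n = degree p - degree G"
      define s where "s = lead_coeff p"
      define s' where "s' = coeff q (degree p)"
      define g where "g = lead_coeff G"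
      define g' where "g' = coeff H (degree G)"
      have ss: "(s, s') \<in> R" and gg: "(g, g') \<in> R"
        using less(2) GH(1) by (auto simp: s_def s'_def g_def g'_def coeff_graph_def)
      \<comment> \<open>the leading terms cancel in \<open>p1\<close>, and \<open>q1\<close> is its coefficientwise derivative\<close>
      define p1 where "p1 = [:g:] * p + - (monom s n * G)"
      define q1 where "q1 = ([:g:] * q + [:g':] * p) + - (monom s n * H + monom s' n * G)"
      have pq1: "(p1, q1) \<in> coeff_graph R" unfolding p1_def q1_def
        by (intro coeff_graph_closed[OF R] ss gg less(2) GH(1))
      have z1: "poly p1 a = 0" using less(3) GH by (simp add: p1_def)
      have d1: "degree p1 < degree p" if "p1 \<noteq> 0"
      proof -
        have "g \<noteq> 0" "s \<noteq> 0" using False GH by (simp_all add: g_def s_def)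
        have dm: "degree (monom s n * G) = degree p"
          using GH \<open>s \<noteq> 0\<close> le by (simp add: degree_mult_eq degree_monom_eq n_def monom_eq_0_iff)
        have "degree p1 \<le> degree p" unfolding p1_def
          by (intro degree_add_le) (simp_all add: dm degree_smult_le)
        moreover have "coeff p1 (degree p) = 0"
        proof -
          have "coeff (monom s n * G) (degree p) = lead_coeff (monom s n * G)" by (simp only: dm)
          also have "\<dots> = s * g" using \<open>s \<noteq> 0\<close> by (simp add: lead_coeff_mult g_def degree_monom_eq)
          finally show ?thesis by (simp add: p1_def s_def)
        qed
        ultimately show ?thesis
          using that by (metis eq_zero_or_degree_less le_neq_implies_less leading_coeff_0_iff)
      qed
      have "total_deriv a b p1 q1 = 0"
      proof (cases "p1 = 0")
        case True
        with pq1 coeff_graph_closed(7)[OF R, of q1] show ?thesis by (simp add: total_deriv_def)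
      next
        case False
        then show ?thesis using less(1)[OF d1 pq1 z1] by simp
      qed
      moreover have "total_deriv a b p1 q1 = g * total_deriv a b p q"
      proof -
        have "total_deriv a b p1 q1 = g * total_deriv a b p q - poly (monom s n) a * total_deriv a b G H"
          using less(3) GH(2)
          by (simp add: p1_def q1_def total_deriv_def pderiv_add pderiv_minus pderiv_mult pderiv_smult pderiv_diff algebra_simps)
        then show ?thesis by (simp add: tG)
      qed
      moreover have "g \<noteq> 0" using GH by (simp add: g_def)
      ultimately show ?thesis by simp
    qed
  qed
  then show ?thesis using derivation_graph_adjoin[OF R] by blast
qed

definition derivation :: "('a::field \<Rightarrow> 'a) \<Rightarrow> bool" where
  "derivation D \<longleftrightarrow> (\<forall>x y. D (x + y) = D x + D y) \<and> (\<forall>x y. D (x * y) = x * D y + D x * y)"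

text \<open>A maximal derivation graph has every element in its domain, since otherwise that element could
  be adjoined.\<close>

lemma derivation_graph_extend:
  fixes R :: "('a::field_char_0 \<times> 'a) set"
  assumes R: "derivation_graph R"
  shows "\<exists>D. derivation D \<and> (\<forall>(x, y)\<in>R. D x = y)"
proof -
  define \<A> where "\<A> = {S. derivation_graph S \<and> R \<subseteq> S}"
  have "\<exists>M\<in>\<A>. \<forall>X\<in>\<A>. M \<subseteq> X \<longrightarrow> X = M"
  proof (rule subset_Zorn_nonempty)
    show "\<A> \<noteq> {}" using R by (auto simp: \<A>_def)
    fix \<C> assume C: "\<C> \<noteq> {}" "subset.chain \<A> \<C>"
    have dg: "derivation_graph S" "R \<subseteq> S" if "S \<in> \<C>" for S
      using C that by (auto simp: \<A>_def subset.chain_def)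
    have two: "\<exists>S\<in>\<C>. x \<in> S \<and> y \<in> S" if "x \<in> \<Union>\<C>" "y \<in> \<Union>\<C>" for x y
      using that C(2) unfolding subset.chain_def by blast
    have "derivation_graph (\<Union>\<C>)"
      unfolding derivation_graph_def
    proof (intro conjI allI impI)
      show "(0, 0) \<in> \<Union>\<C>" "(1, 0) \<in> \<Union>\<C>" using C(1) dg derivation_graphD by blast+
      fix x x' y y' assume "(x, x') \<in> \<Union>\<C>" "(y, y') \<in> \<Union>\<C>"
      from two[OF this] dg obtain S where S: "S \<in> \<C>" "(x, x') \<in> S" "(y, y') \<in> S" "derivation_graph S" by blast
      then show "(x + y, x' + y') \<in> \<Union>\<C>" "(x * y, x * y' + x' * y) \<in> \<Union>\<C>"
        using derivation_graphD(3,4)[OF S(4) S(2,3)] by blast+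
    next
      fix x x' assume "(x, x') \<in> \<Union>\<C>"
      then show "(- x, - x') \<in> \<Union>\<C>" using dg derivation_graphD(5) by blast
    next
      fix y assume "(0, y) \<in> \<Union>\<C>"
      then show "y = 0" using dg derivation_graphD(6) by blast
    qed
    moreover have "R \<subseteq> \<Union>\<C>" using C(1) dg by blast
    ultimately show "\<Union>\<C> \<in> \<A>" by (simp add: \<A>_def)
  qed
  then obtain M where M: "derivation_graph M" "R \<subseteq> M" and
    max: "\<And>X. derivation_graph X \<Longrightarrow> M \<subseteq> X \<Longrightarrow> X = M"
    unfolding \<A>_def by (metis (mono_tags, lifting) mem_Collect_eq subset_trans)
  have total: "\<exists>b. (a, b) \<in> M" for a
  proof -
    obtain b where "derivation_graph (adjoin M a b)"
      using derivation_graph_adjoin_transcendental[OF M(1)] derivation_graph_adjoin_algebraic[OF M(1)] by blast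
    from max[OF this] subset_adjoin[OF M(1)] show ?thesis by blast
  qed
  then obtain D where D: "\<And>a. (a, D a) \<in> M" by metis
  have "D x = y" if "(x, y) \<in> M" for x y
    by (rule derivation_graph_functional[OF M(1) D that])
  then show ?thesis
    using D derivation_graphD(3,4)[OF M(1)] M(2) unfolding derivation_def by (intro exI[of _ D]) blast
qed

section \<open>An ultrapower of the real numbers\<close>

text \<open>A minimal proper filter below \<open>F\<close>, provided by Zorn's lemma, decides every predicate.\<close>

lemma ultrafilter_exists:
  fixes F :: "'a filter"
  assumes F: "F \<noteq> bot"
  shows "\<exists>U. U \<le> F \<and> U \<noteq> bot \<and> (\<forall>P. eventually P U \<or> eventually (\<lambda>x. \<not> P x) U)"
proof -
  define r where "r = {(G, H). G \<noteq> bot \<and> H \<noteq> bot \<and> G \<le> F \<and> H \<le> F \<and> H \<le> (G :: 'a filter)}"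
  have Field: "Field r = {G. G \<noteq> bot \<and> G \<le> F}" by (auto simp: r_def Field_def)
  have po: "Partial_order r"
    unfolding partial_order_on_def preorder_on_def Field
    by (auto simp: r_def refl_on_def trans_def antisym_def)
  have "\<exists>m\<in>Field r. \<forall>a\<in>Field r. (m, a) \<in> r \<longrightarrow> a = m"
  proof (rule Zorns_po_lemma[OF po])
    fix C assume C: "C \<in> Chains r"
    show "\<exists>u\<in>Field r. \<forall>a\<in>C. (a, u) \<in> r"
    proof (cases "C = {}")
      case True
      with F show ?thesis by (auto simp: Field)
    next
      case False
      have CF: "G \<noteq> bot" "G \<le> F" if "G \<in> C" for G
        using C that unfolding Chains_def r_def by auto
      have "Inf C \<noteq> bot"
      proof
        assume "Inf C = bot"
        then have "eventually (\<lambda>_. False) (Inf C)" by simp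
        moreover have "\<exists>G\<in>C. G \<le> inf A B" if "A \<in> C" "B \<in> C" for A B
          using C that unfolding Chains_def r_def by (auto intro: bexI[of _ A] bexI[of _ B])
        ultimately obtain G where "G \<in> C" "eventually (\<lambda>_. False) G"
          using eventually_Inf_base[OF False] by blast
        with CF(1) show False by (simp add: eventually_False)
      qed
      moreover have "Inf C \<le> F" using False CF(2) by (meson Inf_lower2 ex_in_conv)
      ultimately show ?thesis
        using CF by (intro bexI[of _ "Inf C"]) (simp_all add: Field, simp add: r_def Inf_lower)
    qed
  qed
  then obtain U where U: "U \<noteq> bot" "U \<le> F" and max: "\<And>G. G \<noteq> bot \<Longrightarrow> G \<le> F \<Longrightarrow> G \<le> U \<Longrightarrow> G = U"
    unfolding Field by (auto simp: r_def)
  have "eventually P U \<or> eventually (\<lambda>x. \<not> P x) U" for P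
  proof (cases "inf U (principal {x. P x}) = bot")
    case True
    then show ?thesis unfolding trivial_limit_def eventually_inf_principal by simp
  next
    case False
    have le: "inf U (principal {x. P x}) \<le> U" by simp
    have "inf U (principal {x. P x}) = U" by (rule max[OF False order_trans[OF le U(2)] le])
    moreover have "eventually P (inf U (principal {x. P x}))" by (simp add: eventually_inf_principal)
    ultimately show ?thesis by simp
  qed
  with U show ?thesis by blast
qed

text \<open>The ultrapower is indexed by sets of polynomial functions. Along an ultrafilter that refines the
  filter of finite subsets every given polynomial eventually belongs to the index. A family of points
  that avoids the zeros of all polynomials in its index is therefore a generic point.\<close>

type_synonym poly_set = "((nat \<Rightarrow> real) \<Rightarrow> real) set"

definition poly_ultrafilter :: "poly_set filter" where
  "poly_ultrafilter = (SOME U. U \<le> finite_subsets_at_top UNIV \<and> U \<noteq> bot \<and>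
     (\<forall>P. eventually P U \<or> eventually (\<lambda>x. \<not> P x) U))"

lemma poly_ultrafilter:
  "poly_ultrafilter \<le> finite_subsets_at_top UNIV" "poly_ultrafilter \<noteq> bot"
  "eventually P poly_ultrafilter \<or> eventually (\<lambda>x. \<not> P x) poly_ultrafilter"
proof -
  have "\<exists>U. U \<le> finite_subsets_at_top UNIV \<and> U \<noteq> (bot :: poly_set filter) \<and>
     (\<forall>P. eventually P U \<or> eventually (\<lambda>x. \<not> P x) U)"
    by (rule ultrafilter_exists) simp
  from someI_ex[OF this, folded poly_ultrafilter_def]
  show "poly_ultrafilter \<le> finite_subsets_at_top UNIV" "poly_ultrafilter \<noteq> bot"
    "eventually P poly_ultrafilter \<or> eventually (\<lambda>x. \<not> P x) poly_ultrafilter" by auto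
qed

abbreviation almost_all :: "(poly_set \<Rightarrow> bool) \<Rightarrow> bool" (binder "\<forall>\<^sub>U " 10) where
  "almost_all P \<equiv> eventually P poly_ultrafilter"

lemma eventually_mem_poly_ultrafilter: "\<forall>\<^sub>U i. finite i \<and> Q \<in> i"
proof (rule filter_leD[OF poly_ultrafilter(1)])
  show "\<forall>\<^sub>F i in finite_subsets_at_top UNIV. finite i \<and> Q \<in> i"
    unfolding eventually_finite_subsets_at_top by (intro exI[of _ "{Q}"]) auto
qed

quotient_type hyper = "poly_set \<Rightarrow> real" / "\<lambda>f g. \<forall>\<^sub>U i. f i = g i"
  by (rule equivpI) (auto simp: reflp_def symp_def transp_def elim: eventually_mono eventually_elim2)

instantiation hyper :: field
begin

lift_definition zero_hyper :: hyper is "\<lambda>_. 0" .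
lift_definition one_hyper :: hyper is "\<lambda>_. 1" .
lift_definition plus_hyper :: "hyper \<Rightarrow> hyper \<Rightarrow> hyper" is "\<lambda>f g i. f i + g i"
  by (auto elim: eventually_elim2)
lift_definition minus_hyper :: "hyper \<Rightarrow> hyper \<Rightarrow> hyper" is "\<lambda>f g i. f i - g i"
  by (auto elim: eventually_elim2)
lift_definition uminus_hyper :: "hyper \<Rightarrow> hyper" is "\<lambda>f i. - f i"
  by (auto elim: eventually_mono)
lift_definition times_hyper :: "hyper \<Rightarrow> hyper \<Rightarrow> hyper" is "\<lambda>f g i. f i * g i"
  by (auto elim: eventually_elim2)
lift_definition inverse_hyper :: "hyper \<Rightarrow> hyper" is "\<lambda>f i. inverse (f i)"
  by (auto elim: eventually_mono)
lift_definition divide_hyper :: "hyper \<Rightarrow> hyper \<Rightarrow> hyper" is "\<lambda>f g i. f i / g i"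
  by (auto elim: eventually_elim2)

instance
proof
  fix a b c :: hyper
  show "a + b + c = a + (b + c)" by transfer (simp add: algebra_simps)
  show "a + b = b + a" by transfer (simp add: algebra_simps)
  show "0 + a = a" by transfer simp
  show "- a + a = 0" by transfer simp
  show "a - b = a + - b" by transfer simp
  show "a * b * c = a * (b * c)" by transfer (simp add: algebra_simps)
  show "a * b = b * a" by transfer (simp add: algebra_simps)
  show "1 * a = a" by transfer simp
  show "(a + b) * c = a * c + b * c" by transfer (simp add: algebra_simps)
  show "(0::hyper) \<noteq> 1" by transfer (simp add: poly_ultrafilter(2))
  show "a div b = a * inverse b" by transfer (simp add: divide_inverse)
  show "inverse (0::hyper) = 0" by transfer simp
  show "inverse a * a = 1" if "a \<noteq> 0"
    using that
  proof transfer
    fix f :: "poly_set \<Rightarrow> real" assume "\<not> (\<forall>\<^sub>U i. f i = 0)"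
    then have "\<forall>\<^sub>U i. f i \<noteq> 0" using poly_ultrafilter(3) by blast
    then show "\<forall>\<^sub>U i. inverse (f i) * f i = 1"
      by eventually_elim simp
  qed
qed

end

lemma of_nat_hyper: "of_nat n = abs_hyper (\<lambda>_. real n)"
  by (induction n) (simp_all add: zero_hyper.abs_eq one_hyper.abs_eq plus_hyper.abs_eq zero_hyper_def one_hyper_def)

instance hyper :: field_char_0
proof
  show "inj (of_nat :: nat \<Rightarrow> hyper)"
    by (rule injI) (simp add: of_nat_hyper hyper.abs_eq_iff poly_ultrafilter(2))
qed

lemma abs_hyper_sum: "abs_hyper (\<lambda>i. \<Sum>k\<in>A. f k i) = (\<Sum>k\<in>A. abs_hyper (f k))"
  by (induction A rule: infinite_finite_induct) (simp_all add: zero_hyper_def plus_hyper.abs_eq[symmetric])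

lemma abs_hyper_power: "abs_hyper (\<lambda>i. f i ^ n) = abs_hyper f ^ n"
  by (induction n) (simp_all add: one_hyper_def times_hyper.abs_eq[symmetric])

section \<open>Algebraic independence and generic points\<close>

text \<open>Polynomial functions in the first \<open>m\<close> of countably many variables.\<close>

inductive mpoly_fun :: "nat \<Rightarrow> ((nat \<Rightarrow> real) \<Rightarrow> real) \<Rightarrow> bool" for m where
  const: "mpoly_fun m (\<lambda>_. c)"
| var: "i < m \<Longrightarrow> mpoly_fun m (\<lambda>y. y i)"
| add: "mpoly_fun m P \<Longrightarrow> mpoly_fun m Q \<Longrightarrow> mpoly_fun m (\<lambda>y. P y + Q y)"
| mult: "mpoly_fun m P \<Longrightarrow> mpoly_fun m Q \<Longrightarrow> mpoly_fun m (\<lambda>y. P y * Q y)"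

lemma mpoly_fun_mono: "mpoly_fun m Q \<Longrightarrow> m \<le> n \<Longrightarrow> mpoly_fun n Q"
  by (induction rule: mpoly_fun.induct) (auto intro: mpoly_fun.intros)

lemma mpoly_fun_sum: "(\<And>k. k \<in> A \<Longrightarrow> mpoly_fun m (f k)) \<Longrightarrow> mpoly_fun m (\<lambda>y. \<Sum>k\<in>A. f k y)"
  by (induction A rule: infinite_finite_induct) (auto intro: mpoly_fun.intros)

lemma mpoly_fun_prod: "(\<And>k. k \<in> A \<Longrightarrow> mpoly_fun m (f k)) \<Longrightarrow> mpoly_fun m (\<lambda>y. \<Prod>k\<in>A. f k y)"
  by (induction A rule: infinite_finite_induct) (auto intro: mpoly_fun.intros)

lemma mpoly_fun_power: "mpoly_fun m f \<Longrightarrow> mpoly_fun m (\<lambda>y. f y ^ n)"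
  by (induction n) (auto intro: mpoly_fun.intros)

lemma mpoly_fun_cong: "mpoly_fun m Q \<Longrightarrow> (\<And>i. i < m \<Longrightarrow> y i = z i) \<Longrightarrow> Q y = Q z"
  by (induction rule: mpoly_fun.induct) auto

text \<open>This makes the arguments for univariate polynomials, such as the cancellation of powers of the last
  variable, available for relations in several unknowns.\<close>

lemma mpoly_fun_last_variable:
  assumes "mpoly_fun (Suc m) Q"
  shows "\<exists>A N. (\<forall>k. mpoly_fun m (\<lambda>y. coeff (A y) k)) \<and> (\<forall>y. degree (A y) \<le> N) \<and> Q = (\<lambda>y. poly (A y) (y m))"
  using assms
proof induction
  case (const c)
  have "mpoly_fun m (\<lambda>_. coeff [:c:] k)" for k by (rule mpoly_fun.const)
  then show ?case by (intro exI[of _ "\<lambda>_. [:c:]"] exI[of _ 0]) auto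
next
  case (var i)
  show ?case
  proof (cases "i = m")
    case True
    have "mpoly_fun m (\<lambda>_. coeff (monom 1 1) k)" for k by (rule mpoly_fun.const)
    with True show ?thesis
      by (intro exI[of _ "\<lambda>_. monom 1 1"] exI[of _ 1]) (auto simp: poly_monom degree_monom_eq)
  next
    case False
    have "mpoly_fun m (\<lambda>y. coeff [:y i:] k)" for k
      by (cases k) (use False var in \<open>auto intro: mpoly_fun.intros\<close>)
    then show ?thesis by (intro exI[of _ "\<lambda>y. [:y i:]"] exI[of _ 0]) auto
  qed
next
  case (add P Q)
  from add.IH obtain A N B M where
    A: "\<forall>k. mpoly_fun m (\<lambda>y. coeff (A y) k)" "\<forall>y. degree (A y) \<le> N" "P = (\<lambda>y. poly (A y) (y m))" and
    B: "\<forall>k. mpoly_fun m (\<lambda>y. coeff (B y) k)" "\<forall>y. degree (B y) \<le> M" "Q = (\<lambda>y. poly (B y) (y m))"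
    by blast
  have "degree (A y + B y) \<le> max N M" for y
    by (rule degree_add_le) (use A(2) B(2) in \<open>auto simp: le_max_iff_disj\<close>)
  then show ?case
    by (intro exI[of _ "\<lambda>y. A y + B y"] exI[of _ "max N M"])
      (use A B in \<open>auto intro: mpoly_fun.add\<close>)
next
  case (mult P Q)
  from mult.IH obtain A N B M where
    A: "\<forall>k. mpoly_fun m (\<lambda>y. coeff (A y) k)" "\<forall>y. degree (A y) \<le> N" "P = (\<lambda>y. poly (A y) (y m))" and
    B: "\<forall>k. mpoly_fun m (\<lambda>y. coeff (B y) k)" "\<forall>y. degree (B y) \<le> M" "Q = (\<lambda>y. poly (B y) (y m))"
    by blast
  have "degree (A y * B y) \<le> N + M" for y
    by (rule order_trans[OF degree_mult_le]) (use A(2) B(2) in \<open>auto intro: add_mono\<close>)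
  then show ?case
    by (intro exI[of _ "\<lambda>y. A y * B y"] exI[of _ "N + M"])
      (use A B in \<open>auto simp: coeff_mult intro!: mpoly_fun.mult mpoly_fun_sum\<close>)
qed

lemma mpoly_fun_line:
  "mpoly_fun m Q \<Longrightarrow> \<exists>p. \<forall>t. Q (\<lambda>i. a i + t * (b i - a i)) = poly p t"
proof (induction rule: mpoly_fun.induct)
  case (const c)
  show ?case by (rule exI[of _ "[:c:]"]) simp
next
  case (var i)
  show ?case by (rule exI[of _ "[:a i, b i - a i:]"]) simp
next
  case (add P Q)
  then obtain p q where "\<forall>t. P (\<lambda>i. a i + t * (b i - a i)) = poly p t" "\<forall>t. Q (\<lambda>i. a i + t * (b i - a i)) = poly q t" by blast
  then show ?case by (intro exI[of _ "p + q"]) simp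
next
  case (mult P Q)
  then obtain p q where "\<forall>t. P (\<lambda>i. a i + t * (b i - a i)) = poly p t" "\<forall>t. Q (\<lambda>i. a i + t * (b i - a i)) = poly q t" by blast
  then show ?case by (intro exI[of _ "p * q"]) simp
qed

text \<open>On the line through a nonzero of each factor the product is a product of two nonzero univariate
  polynomials.\<close>

lemma mpoly_fun_mult_nonzero:
  assumes P: "mpoly_fun m P" "P a \<noteq> 0" and Q: "mpoly_fun m Q" "Q b \<noteq> 0"
  shows "\<exists>y. P y * Q y \<noteq> 0"
proof -
  obtain p q where pq: "\<And>t. P (\<lambda>i. a i + t * (b i - a i)) = poly p t" "\<And>t. Q (\<lambda>i. a i + t * (b i - a i)) = poly q t"
    using mpoly_fun_line[OF P(1)] mpoly_fun_line[OF Q(1)] by metis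
  have "p \<noteq> 0" "q \<noteq> 0" using pq(1)[of 0] pq(2)[of 1] P(2) Q(2) by auto
  then obtain t where "poly (p * q) t \<noteq> 0" by (metis mult_eq_0_iff poly_all_0_iff_0)
  with pq show ?thesis by (metis poly_mult)
qed

lemma mpoly_fun_prod_nonzero:
  assumes "finite A" "\<And>Q. Q \<in> A \<Longrightarrow> mpoly_fun m Q \<and> (\<exists>y. Q y \<noteq> 0)"
  shows "\<exists>y. (\<Prod>Q\<in>A. Q y) \<noteq> 0"
  using assms
proof (induction A rule: finite_induct)
  case (insert Q A)
  obtain a where "Q a \<noteq> 0" using insert.prems[of Q] by blast
  moreover obtain b where "(\<Prod>Q\<in>A. Q b) \<noteq> 0" using insert.IH insert.prems by blast
  moreover have "mpoly_fun m Q" "mpoly_fun m (\<lambda>y. \<Prod>Q\<in>A. Q y)"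
    using insert.prems by (auto intro!: mpoly_fun_prod)
  ultimately show ?case
    using mpoly_fun_mult_nonzero[of m Q a "\<lambda>y. \<Prod>Q\<in>A. Q y" b] insert.hyps by simp
qed simp

text \<open>Algebraic dependence over the reals of the restrictions to \<open>S\<close>; since \<open>S\<close> need not be
  irreducible, these live in a ring that may have zero divisors.\<close>

definition alg_dependent :: "nat \<Rightarrow> (nat \<Rightarrow> 's \<Rightarrow> real) \<Rightarrow> 's set \<Rightarrow> bool" where
  "alg_dependent m f S \<longleftrightarrow> (\<exists>Q. mpoly_fun m Q \<and> (\<exists>y. Q y \<noteq> 0) \<and> (\<forall>x\<in>S. Q (\<lambda>j. f j x) = 0))"

lemma alg_dependent_Un:
  assumes "alg_dependent m f S" "alg_dependent m f T"
  shows "alg_dependent m f (S \<union> T)"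
proof -
  obtain P a Q b where PQ: "mpoly_fun m P" "P a \<noteq> 0" "\<forall>x\<in>S. P (\<lambda>j. f j x) = 0"
    "mpoly_fun m Q" "Q b \<noteq> 0" "\<forall>x\<in>T. Q (\<lambda>j. f j x) = 0"
    using assms unfolding alg_dependent_def by blast
  then show ?thesis
    unfolding alg_dependent_def using mpoly_fun_mult_nonzero[OF PQ(1,2,4,5)]
    by (intro exI[of _ "\<lambda>y. P y * Q y"]) (auto intro: mpoly_fun.mult)
qed

definition real_derivation :: "(hyper \<Rightarrow> hyper) \<Rightarrow> bool" where
  "real_derivation D \<longleftrightarrow> derivation D \<and> (\<forall>c. D (abs_hyper (\<lambda>_. c)) = 0)"

text \<open>Choose \<open>e i\<close> in \<open>S\<close> outside the zeros of all nonzero polynomial expressions in the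
  functions that occur in the index \<open>i\<close>; a finite product of such expressions is again one, so this
  is possible. The classes of the functions \<open>f l \<circ> e\<close> then satisfy no polynomial relation over the
  reals. Adjoining them one after the other as transcendental elements prescribes their derivatives at
  will, and the derivation extends to the whole ultrapower.\<close>

lemma alg_independent_derivation:
  fixes f :: "nat \<Rightarrow> 's \<Rightarrow> real"
  assumes indep: "\<not> alg_dependent m f S"
  shows "\<exists>e. (\<forall>i. e i \<in> S) \<and> (\<forall>b :: nat \<Rightarrow> hyper. \<exists>D. real_derivation D \<and>
     (\<forall>l<m. D (abs_hyper (\<lambda>i. f l (e i))) = b l))"
proof -
  have "\<exists>x\<in>S. finite i \<longrightarrow> (\<forall>Q\<in>i. mpoly_fun m Q \<and> (\<exists>y. Q y \<noteq> 0) \<longrightarrow> Q (\<lambda>j. f j x) \<noteq> 0)" for i :: poly_set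
  proof -
    define A where "A = {Q\<in>i. finite i \<and> mpoly_fun m Q \<and> (\<exists>y. Q y \<noteq> 0)}"
    have "finite A" by (cases "finite i") (auto simp: A_def)
    then have "mpoly_fun m (\<lambda>y. \<Prod>Q\<in>A. Q y)" "\<exists>y. (\<Prod>Q\<in>A. Q y) \<noteq> 0"
      by (rule_tac [2] mpoly_fun_prod_nonzero) (auto simp: A_def intro!: mpoly_fun_prod)
    with indep obtain x where "x \<in> S" "(\<Prod>Q\<in>A. Q (\<lambda>j. f j x)) \<noteq> 0"
      unfolding alg_dependent_def by blast
    with \<open>finite A\<close> show ?thesis by (auto simp: A_def)
  qed
  then obtain e where e: "\<And>i. e i \<in> S"
    "\<And>i Q. finite i \<Longrightarrow> Q \<in> i \<Longrightarrow> mpoly_fun m Q \<Longrightarrow> \<exists>y. Q y \<noteq> 0 \<Longrightarrow> Q (\<lambda>j. f j (e i)) \<noteq> 0"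
    by metis
  define \<phi> where "\<phi> Q = abs_hyper (\<lambda>i. Q (\<lambda>j. f j (e i)))" for Q :: "(nat \<Rightarrow> real) \<Rightarrow> real"
  have generic: "Q y = 0" if "mpoly_fun m Q" "\<phi> Q = 0" for Q y
  proof (rule ccontr)
    assume "Q y \<noteq> 0"
    have "\<forall>\<^sub>U i. Q (\<lambda>j. f j (e i)) = 0"
      using that(2) by (simp add: \<phi>_def zero_hyper_def hyper.abs_eq_iff)
    moreover have "\<forall>\<^sub>U i. Q (\<lambda>j. f j (e i)) \<noteq> 0"
      using eventually_mem_poly_ultrafilter[of Q]
      by eventually_elim (use e(2) that \<open>Q y \<noteq> 0\<close> in blast)
    ultimately have "\<forall>\<^sub>U i. False" by eventually_elim simp
    then show False using poly_ultrafilter(2) by (simp add: eventually_False)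
  qed
  define F where "F l = abs_hyper (\<lambda>i. f l (e i))" for l
  have F: "F l = \<phi> (\<lambda>y. y l)" for l by (simp add: F_def \<phi>_def)
  have poly_\<phi>: "poly p (F n) = \<phi> (\<lambda>y. \<Sum>k\<le>degree p. A k y * y n ^ k)"
    if "\<And>k. coeff p k = \<phi> (A k)" for p A n
    by (simp add: poly_altdef that \<phi>_def F_def abs_hyper_sum abs_hyper_power times_hyper.abs_eq[symmetric])
  have graph: "\<exists>R. derivation_graph R \<and> (\<forall>c. (abs_hyper (\<lambda>_. c), 0) \<in> R) \<and> (\<forall>l<n. (F l, b l) \<in> R) \<and>
     Domain R \<subseteq> {\<phi> Q | Q. mpoly_fun n Q}" if "n \<le> m" for b :: "nat \<Rightarrow> hyper" and n
    using that
  proof (induction n)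
    case 0
    define R where "R = {(abs_hyper (\<lambda>_. c), 0 :: hyper) | c. True}"
    have RI: "(abs_hyper (\<lambda>_. c), 0) \<in> R" for c unfolding R_def by blast
    have "derivation_graph R"
      unfolding derivation_graph_def
    proof (intro conjI allI impI)
      show "(0, 0) \<in> R" "(1, 0) \<in> R" using RI[of 0] RI[of 1] by (simp_all add: zero_hyper_def one_hyper_def)
      fix x x' y y' assume "(x, x') \<in> R" "(y, y') \<in> R"
      then obtain c d where "x = abs_hyper (\<lambda>_. c)" "x' = 0" "y = abs_hyper (\<lambda>_. d)" "y' = 0" by (auto simp: R_def)
      then show "(x + y, x' + y') \<in> R" "(x * y, x * y' + x' * y) \<in> R"
        using RI[of "c + d"] RI[of "c * d"] by (simp_all add: plus_hyper.abs_eq times_hyper.abs_eq)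
    next
      fix x x' assume "(x, x') \<in> R"
      then obtain c where "x = abs_hyper (\<lambda>_. c)" "x' = 0" by (auto simp: R_def)
      then show "(- x, - x') \<in> R" using RI[of "- c"] by (simp add: uminus_hyper.abs_eq)
    qed (auto simp: R_def)
    moreover have "Domain R \<subseteq> {\<phi> Q | Q. mpoly_fun 0 Q}"
    proof
      fix x assume "x \<in> Domain R"
      then obtain c where "x = \<phi> (\<lambda>_. c)" by (auto simp: R_def \<phi>_def)
      then show "x \<in> {\<phi> Q | Q. mpoly_fun 0 Q}" using mpoly_fun.const by blast
    qed
    ultimately show ?case using RI by (intro exI[of _ R]) auto
  next
    case (Suc n)
    then obtain R where R: "derivation_graph R" "\<And>c. (abs_hyper (\<lambda>_. c), 0) \<in> R" "\<And>l. l < n \<Longrightarrow> (F l, b l) \<in> R"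
      "Domain R \<subseteq> {\<phi> Q | Q. mpoly_fun n Q}" by auto
    have cf: "\<exists>A. (\<forall>k. coeff p k = \<phi> (A k)) \<and> (\<forall>k. mpoly_fun n (A k))" if "\<forall>k. coeff p k \<in> Domain R" for p
    proof -
      have "\<forall>k. \<exists>Q. coeff p k = \<phi> Q \<and> mpoly_fun n Q" using that R(4) by blast
      then show ?thesis by metis
    qed
    have mp: "mpoly_fun (Suc n) (\<lambda>y. \<Sum>k\<le>N. A k y * y n ^ k)" if "\<forall>k. mpoly_fun n (A k)" for A N
      using that by (intro mpoly_fun_sum mpoly_fun.mult mpoly_fun_power mpoly_fun.var) (auto intro: mpoly_fun_mono)
    have "transcendental_over (Domain R) (F n)"
      unfolding transcendental_over_def
    proof (intro allI impI)
      fix p assume p: "(\<forall>k. coeff p k \<in> Domain R) \<and> poly p (F n) = 0"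
      from cf p obtain A where A: "\<And>k. coeff p k = \<phi> (A k)" "\<And>k. mpoly_fun n (A k)" by blast
      have "mpoly_fun m (\<lambda>y. \<Sum>k\<le>degree p. A k y * y n ^ k)"
        using Suc.prems A(2) by (intro mpoly_fun_mono[OF mp]) auto
      then have z: "(\<Sum>k\<le>degree p. A k y * y n ^ k) = 0" for y
        using p poly_\<phi>[of p A n, OF A(1)] by (intro generic) auto
      have "A k y = 0" if k: "k \<le> degree p" for k y
      proof -
        have "(\<Sum>k\<le>degree p. A k y * t ^ k) = 0" for t
        proof -
          have "A k (y(n := t)) = A k y" for k by (rule mpoly_fun_cong[OF A(2)]) auto
          with z[of "y(n := t)"] show ?thesis by simp
        qed
        with k show ?thesis using polyfun_eq_0[of "\<lambda>k. A k y" "degree p"] by blast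
      qed
      then have "coeff p (degree p) = \<phi> (\<lambda>_. 0)" unfolding A(1) \<phi>_def by simp
      then show "p = 0" by (simp add: \<phi>_def zero_hyper_def[symmetric])
    qed
    from derivation_graph_adjoin_transcendental[OF R(1) this]
    have "derivation_graph (adjoin R (F n) (b n))" .
    moreover have "Domain (adjoin R (F n) (b n)) \<subseteq> {\<phi> Q | Q. mpoly_fun (Suc n) Q}"
    proof
      fix x assume "x \<in> Domain (adjoin R (F n) (b n))"
      then obtain p q where p: "x = poly p (F n)" "(p, q) \<in> coeff_graph R" by (auto simp: adjoin_def)
      then have "\<forall>k. coeff p k \<in> Domain R" by (auto simp: coeff_graph_def)
      from cf[OF this] obtain A where A: "\<And>k. coeff p k = \<phi> (A k)" "\<And>k. mpoly_fun n (A k)" by blast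
      then show "x \<in> {\<phi> Q | Q. mpoly_fun (Suc n) Q}"
        using p(1) poly_\<phi>[of p A n, OF A(1)] mp[of A "degree p"] by auto
    qed
    moreover have "(F l, b l) \<in> adjoin R (F n) (b n)" if "l < Suc n" for l
    proof (cases "l = n")
      case False
      with that have "(F l, b l) \<in> R" by (intro R(3)) simp
      then show ?thesis using subset_adjoin(1)[OF R(1)] by blast
    qed (simp add: subset_adjoin(2)[OF R(1)])
    moreover have "(abs_hyper (\<lambda>_. c), 0) \<in> adjoin R (F n) (b n)" for c
      using R(2) subset_adjoin(1)[OF R(1)] by blast
    ultimately show ?case by (intro exI[of _ "adjoin R (F n) (b n)"]) auto
  qed
  have "\<exists>D. real_derivation D \<and> (\<forall>l<m. D (F l) = b l)" for b :: "nat \<Rightarrow> hyper"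
  proof -
    obtain R where R: "derivation_graph R" "\<And>c. (abs_hyper (\<lambda>_. c), 0) \<in> R" "\<And>l. l < m \<Longrightarrow> (F l, b l) \<in> R"
      using graph[OF order_refl, of b] by blast
    obtain D where "derivation D" "\<forall>(x, y)\<in>R. D x = y"
      using derivation_graph_extend[OF R(1)] by blast
    then have D: "derivation D" "D x = y" if "(x, y) \<in> R" for x y using that by auto
    have "D (abs_hyper (\<lambda>_. c)) = 0" for c by (rule D(2)[OF R(2)])
    moreover have "D (F l) = b l" if "l < m" for l by (rule D(2)[OF R(3)[OF that]])
    ultimately show ?thesis using \<open>derivation D\<close> unfolding real_derivation_def by blast
  qed
  then show ?thesis using e(1) unfolding F_def by blast
qed

text \<open>A derivation of the ultrapower acts on families of reals, and coordinatewise on families of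
  vectors; both actions are meaningful only up to almost equality along the ultrafilter.\<close>

definition sderiv :: "(hyper \<Rightarrow> hyper) \<Rightarrow> (poly_set \<Rightarrow> real) \<Rightarrow> poly_set \<Rightarrow> real" where
  "sderiv D f = rep_hyper (D (abs_hyper f))"

lemma sderiv_eqI:
  assumes "D (abs_hyper f) = abs_hyper g"
  shows "\<forall>\<^sub>U i. sderiv D f i = g i"
proof -
  have "abs_hyper (sderiv D f) = abs_hyper g"
    by (simp add: sderiv_def assms Quotient3_abs_rep[OF Quotient3_hyper])
  then show ?thesis by (simp add: hyper.abs_eq_iff)
qed

lemma abs_hyper_sderiv: "abs_hyper (sderiv D f) = D (abs_hyper f)"
  by (simp add: sderiv_def Quotient3_abs_rep[OF Quotient3_hyper])

lemma real_derivationD: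
  assumes "real_derivation D"
  shows "D (x + y) = D x + D y" "D (x * y) = x * D y + D x * y" "D (abs_hyper (\<lambda>_. c)) = 0" "D 0 = 0"
proof -
  show "D (x + y) = D x + D y" "D (x * y) = x * D y + D x * y" and c: "D (abs_hyper (\<lambda>_. c)) = 0" for c
    using assms by (auto simp: real_derivation_def derivation_def)
  show "D 0 = 0" using c[of 0] by (simp flip: zero_hyper_def)
qed

lemma real_derivation_sum:
  assumes "real_derivation D"
  shows "D (\<Sum>k\<in>A. f k) = (\<Sum>k\<in>A. D (f k))"
  by (induction A rule: infinite_finite_induct) (auto simp: real_derivationD[OF assms])

definition vderiv :: "(hyper \<Rightarrow> hyper) \<Rightarrow> (poly_set \<Rightarrow> 'a::euclidean_space) \<Rightarrow> poly_set \<Rightarrow> 'a" where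
  "vderiv D x i = (\<Sum>b\<in>Basis. sderiv D (\<lambda>i. x i \<bullet> b) i *\<^sub>R b)"

lemma vderiv_inner_Basis: "b \<in> Basis \<Longrightarrow> vderiv D x i \<bullet> b = sderiv D (\<lambda>i. x i \<bullet> b) i"
  by (simp add: vderiv_def)

lemma vderiv_real: "vderiv D x i = sderiv D x i"
  by (simp add: vderiv_def)

lemma vderiv_eqI:
  assumes "\<And>b. b \<in> Basis \<Longrightarrow> D (abs_hyper (\<lambda>i. x i \<bullet> b)) = abs_hyper (\<lambda>i. y i \<bullet> b)"
  shows "\<forall>\<^sub>U i. vderiv D x i = y i"
proof -
  have "\<forall>\<^sub>U i. \<forall>b\<in>Basis. vderiv D x i \<bullet> b = y i \<bullet> b"
    by (rule eventually_ball_finite) (auto simp: vderiv_inner_Basis assms intro!: sderiv_eqI)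
  then show ?thesis by eventually_elim (rule euclidean_eqI, blast)
qed

lemma vderiv_const:
  assumes "real_derivation D"
  shows "\<forall>\<^sub>U i. vderiv D (\<lambda>_. c) i = 0"
  by (rule vderiv_eqI) (simp add: real_derivationD[OF assms] zero_hyper_def)

lemma vderiv_add:
  assumes D: "real_derivation D"
  shows "\<forall>\<^sub>U i. vderiv D (\<lambda>i. x i + y i) i = vderiv D x i + vderiv D y i"
  by (rule vderiv_eqI) (simp add: inner_add_left vderiv_inner_Basis plus_hyper.abs_eq[symmetric] real_derivationD[OF D] abs_hyper_sderiv)

lemma vderiv_sum:
  assumes D: "real_derivation D"
  shows "\<forall>\<^sub>U i. vderiv D (\<lambda>i. \<Sum>k\<in>A. x k i) i = (\<Sum>k\<in>A. vderiv D (x k) i)"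
  by (rule vderiv_eqI) (simp add: inner_sum_left vderiv_inner_Basis abs_hyper_sum real_derivation_sum[OF D] abs_hyper_sderiv)

text \<open>The Leibniz rule, reduced to scalars by expanding both arguments in coordinates.\<close>

lemma vderiv_bilinear:
  fixes h :: "'a::euclidean_space \<Rightarrow> 'b::euclidean_space \<Rightarrow> 'c::euclidean_space"
  assumes D: "real_derivation D" and h: "bilinear h"
  shows "\<forall>\<^sub>U i. vderiv D (\<lambda>i. h (x i) (y i)) i = h (vderiv D x i) (y i) + h (x i) (vderiv D y i)"
proof (rule vderiv_eqI)
  fix c :: 'c assume c: "c \<in> Basis"
  have expand: "h v w \<bullet> c = (\<Sum>a\<in>Basis. \<Sum>b\<in>Basis. (v \<bullet> a) * (w \<bullet> b) * (h a b \<bullet> c))" for v w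
  proof -
    have "h v w = h (\<Sum>a\<in>Basis. (v \<bullet> a) *\<^sub>R a) (\<Sum>b\<in>Basis. (w \<bullet> b) *\<^sub>R b)"
      by (simp only: euclidean_representation)
    also have "\<dots> = (\<Sum>a\<in>Basis. \<Sum>b\<in>Basis. ((v \<bullet> a) * (w \<bullet> b)) *\<^sub>R h a b)"
      by (simp add: bilinear_sum[OF h] sum.cartesian_product bilinear_lmul[OF h] bilinear_rmul[OF h] mult.commute)
    finally show ?thesis by (simp add: inner_sum_left)
  qed
  have e1: "(\<lambda>i. h (x i) (y i) \<bullet> c) = (\<lambda>i. \<Sum>a\<in>Basis. \<Sum>b\<in>Basis. (x i \<bullet> a) * (y i \<bullet> b) * (h a b \<bullet> c))"
    by (rule ext) (rule expand)
  have e2: "(\<lambda>i. (h (vderiv D x i) (y i) + h (x i) (vderiv D y i)) \<bullet> c) = (\<lambda>i.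
      (\<Sum>a\<in>Basis. \<Sum>b\<in>Basis. (vderiv D x i \<bullet> a) * (y i \<bullet> b) * (h a b \<bullet> c))
    + (\<Sum>a\<in>Basis. \<Sum>b\<in>Basis. (x i \<bullet> a) * (vderiv D y i \<bullet> b) * (h a b \<bullet> c)))"
    unfolding inner_add_left by (rule ext) (intro arg_cong2[where f = plus] expand)
  have "D (abs_hyper (\<lambda>i. h (x i) (y i) \<bullet> c))
    = (\<Sum>a\<in>Basis. \<Sum>b\<in>Basis. D (abs_hyper (\<lambda>i. x i \<bullet> a) * abs_hyper (\<lambda>i. y i \<bullet> b) * abs_hyper (\<lambda>_. h a b \<bullet> c)))"
    unfolding e1 by (simp add: abs_hyper_sum real_derivation_sum[OF D] times_hyper.abs_eq[symmetric])
  also have "\<dots> = (\<Sum>a\<in>Basis. \<Sum>b\<in>Basis. abs_hyper (sderiv D (\<lambda>i. x i \<bullet> a)) * abs_hyper (\<lambda>i. y i \<bullet> b) * abs_hyper (\<lambda>_. h a b \<bullet> c))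
     + (\<Sum>a\<in>Basis. \<Sum>b\<in>Basis. abs_hyper (\<lambda>i. x i \<bullet> a) * abs_hyper (sderiv D (\<lambda>i. y i \<bullet> b)) * abs_hyper (\<lambda>_. h a b \<bullet> c))"
    unfolding sum.distrib[symmetric]
    by (intro sum.cong refl) (simp add: real_derivationD[OF D] abs_hyper_sderiv algebra_simps)
  also have "\<dots> = abs_hyper (\<lambda>i. (h (vderiv D x i) (y i) + h (x i) (vderiv D y i)) \<bullet> c)"
    unfolding e2 by (simp add: plus_hyper.abs_eq[symmetric] abs_hyper_sum times_hyper.abs_eq[symmetric] vderiv_inner_Basis)
  finally show "D (abs_hyper (\<lambda>i. h (x i) (y i) \<bullet> c)) = \<dots>" .
qed

lemma vderiv_linear:
  assumes D: "real_derivation D" and T: "linear T"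
  shows "\<forall>\<^sub>U i. vderiv D (\<lambda>i. T (x i)) i = T (vderiv D x i)"
proof -
  have "bilinear (\<lambda>(r::real) x. r *\<^sub>R T x)"
    unfolding bilinear_def using T by (auto intro!: linearI simp: linear_add linear_scale algebra_simps)
  from vderiv_bilinear[OF D this, of "\<lambda>_. 1" x] vderiv_const[OF D, of "1::real"]
  show ?thesis by eventually_elim simp
qed

text \<open>The map \<open>g' x\<close> is the differential of \<open>g\<close> at \<open>x\<close>, known only through the chain
  rule for derivations of the ultrapower.\<close>

definition formal_differential :: "('a::euclidean_space \<Rightarrow> real) \<Rightarrow> ('a \<Rightarrow> 'a \<Rightarrow> real) \<Rightarrow> bool" where
  "formal_differential g g' \<longleftrightarrow> (\<forall>x. linear (g' x)) \<and> (\<forall>D \<xi>. real_derivation D \<longrightarrow>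
     (\<forall>\<^sub>U i. vderiv D (\<lambda>i. g (\<xi> i)) i = g' (\<xi> i) (vderiv D \<xi> i)))"

lemma formal_differentialD:
  assumes "formal_differential g g'"
  shows "linear (g' x)" "real_derivation D \<Longrightarrow> \<forall>\<^sub>U i. vderiv D (\<lambda>i. g (\<xi> i)) i = g' (\<xi> i) (vderiv D \<xi> i)"
  using assms by (auto simp: formal_differential_def)

lemma formal_differential_polynomial:
  fixes g :: "'a::euclidean_space \<Rightarrow> real"
  shows "real_polynomial_function g \<Longrightarrow> \<exists>g'. formal_differential g g'"
proof (induction rule: real_polynomial_function.induct)
  case (linear f)
  then have "linear f" by (simp add: bounded_linear.linear)
  then show ?case
    unfolding formal_differential_def by (intro exI[of _ "\<lambda>_. f"]) (simp add: vderiv_linear)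
next
  case (const c)
  show ?case
    unfolding formal_differential_def by (intro exI[of _ "\<lambda>_ _. 0"]) (simp add: vderiv_const linear_zero)
next
  case (add f g)
  then obtain f' g' where f': "formal_differential f f'" and g': "formal_differential g g'" by blast
  show ?case
    unfolding formal_differential_def
  proof (intro exI[of _ "\<lambda>x v. f' x v + g' x v"] conjI allI impI)
    show "linear (\<lambda>v. f' x v + g' x v)" for x
      using formal_differentialD(1)[OF f'] formal_differentialD(1)[OF g'] by (simp add: linear_compose_add)
    fix D :: "hyper \<Rightarrow> hyper" and \<xi> :: "poly_set \<Rightarrow> 'a" assume D: "real_derivation D"
    from formal_differentialD(2)[OF f' D, of \<xi>] formal_differentialD(2)[OF g' D, of \<xi>]
      vderiv_add[OF D, of "\<lambda>i. f (\<xi> i)" "\<lambda>i. g (\<xi> i)"]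
    show "\<forall>\<^sub>U i. vderiv D (\<lambda>i. f (\<xi> i) + g (\<xi> i)) i = f' (\<xi> i) (vderiv D \<xi> i) + g' (\<xi> i) (vderiv D \<xi> i)"
      by eventually_elim simp
  qed
next
  case (mult f g)
  then obtain f' g' where f': "formal_differential f f'" and g': "formal_differential g g'" by blast
  show ?case
    unfolding formal_differential_def
  proof (intro exI[of _ "\<lambda>x v. f' x v * g x + f x * g' x v"] conjI allI impI)
    show "linear (\<lambda>v. f' x v * g x + f x * g' x v)" for x
      using formal_differentialD(1)[OF f', of x] formal_differentialD(1)[OF g', of x]
      by (auto intro!: linearI simp: linear_add linear_scale algebra_simps)
    fix D :: "hyper \<Rightarrow> hyper" and \<xi> :: "poly_set \<Rightarrow> 'a" assume D: "real_derivation D"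
    from formal_differentialD(2)[OF f' D, of \<xi>] formal_differentialD(2)[OF g' D, of \<xi>]
      vderiv_bilinear[OF D bilinear_times, of "\<lambda>i. f (\<xi> i)" "\<lambda>i. g (\<xi> i)"]
    show "\<forall>\<^sub>U i. vderiv D (\<lambda>i. f (\<xi> i) * g (\<xi> i)) i
        = f' (\<xi> i) (vderiv D \<xi> i) * g (\<xi> i) + f (\<xi> i) * g' (\<xi> i) (vderiv D \<xi> i)"
      by eventually_elim simp
  qed
qed

section \<open>Tangent vectors at generic points\<close>

text \<open>Vectors that have a dual family of linear functionals are linearly independent.\<close>

lemma dual_family_card_le_dim:
  fixes N :: "'a::euclidean_space set"
  assumes \<phi>: "\<And>l. l < n \<Longrightarrow> linear (\<phi> l)" and d: "\<And>l j. l < n \<Longrightarrow> j < n \<Longrightarrow> \<phi> l (v j) = (if l = j then 1 else (0::real))"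
    and N: "\<And>j. j < n \<Longrightarrow> v j \<in> N"
  shows "n \<le> dim N"
proof -
  have inj: "inj_on v {..<n}"
  proof (rule inj_onI)
    fix i j assume ij: "i \<in> {..<n}" "j \<in> {..<n}" "v i = v j"
    then show "i = j" using d[of i i] d[of i j] by (auto split: if_splits)
  qed
  have "independent (v ` {..<n})"
  proof
    assume "dependent (v ` {..<n})"
    then obtain u l where u: "l < n" "u (v l) \<noteq> 0" "(\<Sum>b\<in>v ` {..<n}. u b *\<^sub>R b) = 0"
      using dependent_finite[of "v ` {..<n}"] by auto
    have "0 = \<phi> l (\<Sum>j<n. u (v j) *\<^sub>R v j)"
      using u(3) by (simp add: sum.reindex[OF inj] linear_0[OF \<phi>[OF u(1)]])
    also have "\<dots> = (\<Sum>j<n. u (v j) * \<phi> l (v j))"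
      by (simp add: linear_sum[OF \<phi>[OF u(1)]] linear_scale[OF \<phi>[OF u(1)]])
    also have "\<dots> = (\<Sum>j<n. if l = j then u (v j) else 0)"
      by (intro sum.cong refl) (use u(1) d in auto)
    also have "\<dots> = u (v l)" using u(1) by simp
    finally show False using u(2) by simp
  qed
  moreover have "v ` {..<n} \<subseteq> N" using N by auto
  ultimately have "card (v ` {..<n}) \<le> dim N" by (intro independent_card_le_dim)
  then show ?thesis by (simp add: card_image[OF inj])
qed

lemma dim_le_image_plus_kernel:
  fixes f :: "'a::euclidean_space \<Rightarrow> 'b::euclidean_space"
  assumes f: "linear f" and N: "subspace N"
  shows "dim N \<le> dim (f ` N) + dim {n\<in>N. f n = 0}"
proof -
  define K where "K = {n\<in>N. f n = 0}"
  define C where "C = {y\<in>N. \<forall>x\<in>K. orthogonal x y}"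
  have K: "subspace K" "K \<subseteq> N" using f N
    by (auto simp: K_def subspace_def linear_add linear_scale linear_0)
  have C: "subspace C" using N
    by (auto simp: C_def subspace_def orthogonal_def inner_add_right)
  have "inj_on f C"
  proof (rule inj_onI)
    fix x y assume xy: "x \<in> C" "y \<in> C" "f x = f y"
    then have "x - y \<in> C" using C by (simp add: subspace_diff)
    moreover from this xy have "x - y \<in> K" by (simp add: C_def K_def linear_diff[OF f])
    ultimately have "orthogonal (x - y) (x - y)" by (auto simp: C_def)
    then show "x = y" by (simp add: orthogonal_def)
  qed
  then have "dim (f ` C) = dim C" using C by (intro dim_image_eq[OF f]) (simp add: span_eq_iff[THEN iffD2])
  moreover have "dim C + dim K = dim N"
    unfolding C_def by (rule dim_subspace_orthogonal_to_vectors[OF K(1) N K(2)])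
  moreover have "dim (f ` C) \<le> dim (f ` N)" by (rule dim_subset) (auto simp: C_def)
  ultimately show ?thesis by (simp add: K_def)
qed

lemma subspace_projection_exists:
  fixes U :: "'a::euclidean_space set"
  assumes "subspace U"
  shows "\<exists>P. linear P \<and> (\<forall>a\<in>U. P a = a) \<and> range P = U"
proof -
  obtain B where B: "B \<subseteq> U" "independent B" "U \<subseteq> span B" using basis_exists[of U] by metis
  then have U: "span B = U" using assms by (simp add: span_minimal subset_antisym)
  obtain P where P: "linear P" "\<And>x. x \<in> B \<Longrightarrow> P x = x" "range P = span B"
    using linear_independent_extend_subspace[OF B(2), of "\<lambda>x. x"] by auto
  have "P a = a" if "a \<in> U" for a
    using linear_eq_on_span[OF P(1) linear_id, of B a] P(2) that U by (auto simp: id_def)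
  with P U show ?thesis by blast
qed

definition tangent_frame :: "nat \<Rightarrow> 'a set \<Rightarrow> (poly_set \<Rightarrow> 'a::euclidean_space) \<Rightarrow>
    (nat \<Rightarrow> hyper \<Rightarrow> hyper) \<Rightarrow> (nat \<Rightarrow> 'a \<Rightarrow> 'a \<Rightarrow> real) \<Rightarrow> bool" where
  "tangent_frame m S e D g' \<longleftrightarrow> (\<forall>i. e i \<in> S) \<and> (\<forall>j. real_derivation (D j)) \<and> (\<forall>l<m. \<forall>x. linear (g' l x)) \<and>
     (\<forall>j<m. \<forall>l<m. \<forall>\<^sub>U i. g' l (e i) (vderiv (D j) e i) = (if l = j then 1 else 0))"

lemma tangent_frameD:
  assumes "tangent_frame m S e D g'"
  shows "\<forall>i. e i \<in> S" "\<forall>j. real_derivation (D j)" "\<forall>l<m. \<forall>x. linear (g' l x)"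
    "\<forall>j<m. \<forall>l<m. \<forall>\<^sub>U i. g' l (e i) (vderiv (D j) e i) = (if l = j then 1 else 0)"
  using assms by (simp_all add: tangent_frame_def)

text \<open>Algebraically independent functions have a generic point with tangent vectors dual to their
  differentials: the derivatives \<open>vderiv (D j) e\<close> of the generic point.\<close>

lemma alg_independent_tangent_frame:
  fixes f :: "nat \<Rightarrow> 'a::euclidean_space \<Rightarrow> real"
  assumes indep: "\<not> alg_dependent m f S" and f: "\<forall>j<m. real_polynomial_function (f j)"
  shows "\<exists>e D g'. tangent_frame m S e D g'"
proof -
  obtain e where e: "\<forall>i. e i \<in> S"
    and ex: "\<forall>b :: nat \<Rightarrow> hyper. \<exists>D. real_derivation D \<and> (\<forall>l<m. D (abs_hyper (\<lambda>i. f l (e i))) = b l)"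
    using alg_independent_derivation[OF indep] by (elim exE conjE)
  have "\<exists>D. real_derivation D \<and> (\<forall>l<m. D (abs_hyper (\<lambda>i. f l (e i))) = (if l = j then 1 else 0))" for j
    using ex[rule_format, of "\<lambda>l. if l = j then 1 else 0"] .
  then obtain D where D: "\<forall>j. real_derivation (D j) \<and> (\<forall>l<m. D j (abs_hyper (\<lambda>i. f l (e i))) = (if l = j then 1 else 0))"
    by (elim exE[OF choice[OF allI]])
  have "\<exists>g'. l < m \<longrightarrow> formal_differential (f l) g'" for l
    using formal_differential_polynomial[of "f l"] f by (cases "l < m") auto
  then obtain g' where g': "\<forall>l. l < m \<longrightarrow> formal_differential (f l) (g' l)"
    by (elim exE[OF choice[OF allI]])
  have "\<forall>\<^sub>U i. g' l (e i) (vderiv (D j) e i) = (if l = j then 1 else 0)" if "l < m" for l j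
  proof -
    have "\<forall>\<^sub>U i. sderiv (D j) (\<lambda>i. f l (e i)) i = (if l = j then 1 else 0)"
      by (rule sderiv_eqI) (use that D in \<open>simp add: one_hyper_def zero_hyper_def\<close>)
    moreover have "\<forall>\<^sub>U i. vderiv (D j) (\<lambda>i. f l (e i)) i = g' l (e i) (vderiv (D j) e i)"
      using g' D that by (intro formal_differentialD(2)) simp_all
    ultimately show ?thesis by eventually_elim (simp add: vderiv_real)
  qed
  moreover have "linear (g' l x)" if "l < m" for l x
    by (rule formal_differentialD(1)) (use g' that in blast)
  ultimately show ?thesis
    unfolding tangent_frame_def using e D by (intro exI[of _ e] exI[of _ D] exI[of _ g']) simp
qed

text \<open>The derivatives of a generic point of \<open>L\<close> lie in \<open>L\<close> again.\<close>

lemma alg_dependent_subspace: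
  fixes L :: "'a::euclidean_space set"
  assumes L: "subspace L" and m: "dim L < m" and f: "\<forall>j<m. real_polynomial_function (f j)"
  shows "alg_dependent m f L"
proof (rule ccontr)
  assume "\<not> alg_dependent m f L"
  from alg_independent_tangent_frame[OF this f] obtain e D g' where frame: "tangent_frame m L e D g'"
    by (elim exE)
  note e = tangent_frameD(1)[OF frame] and D = tangent_frameD(2)[OF frame]
    and g' = tangent_frameD(3)[OF frame] and dual = tangent_frameD(4)[OF frame]
  obtain P where P: "linear P" "\<forall>a\<in>L. P a = a" "range P = L"
    using subspace_projection_exists[OF L] by (elim exE conjE)
  have "\<forall>\<^sub>U i. \<forall>j\<in>{..<m}. P (vderiv (D j) e i) = vderiv (D j) e i \<and>
      (\<forall>l\<in>{..<m}. g' l (e i) (vderiv (D j) e i) = (if l = j then 1 else 0))"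
  proof (intro eventually_ball_finite ballI eventually_conj)
    fix j
    have "(\<lambda>i. P (e i)) = e" using P(2) e by auto
    with vderiv_linear[OF D[rule_format] P(1), of j e]
    show "\<forall>\<^sub>U i. P (vderiv (D j) e i) = vderiv (D j) e i" by (simp add: eq_commute)
  qed (use dual in auto)
  from eventually_happens'[OF poly_ultrafilter(2) this]
  obtain i where i: "\<forall>j\<in>{..<m}. P (vderiv (D j) e i) = vderiv (D j) e i \<and>
      (\<forall>l\<in>{..<m}. g' l (e i) (vderiv (D j) e i) = (if l = j then 1 else 0))"
    by (elim exE)
  have "m \<le> dim L"
  proof (rule dual_family_card_le_dim[where \<phi> = "\<lambda>l. g' l (e i)" and v = "\<lambda>j. vderiv (D j) e i"])
    show "vderiv (D j) e i \<in> L" if "j < m" for j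
    proof -
      have "vderiv (D j) e i = P (vderiv (D j) e i)" using i that by simp
      with P(3) show ?thesis by (metis rangeI)
    qed
  qed (use i g' in auto)
  with m show False by simp
qed

definition form_kernel :: "('v::euclidean_space \<Rightarrow> 'v \<Rightarrow> 'q::euclidean_space) \<Rightarrow> 'q \<Rightarrow> 'v set" where
  "form_kernel h \<mu> = {a. \<forall>w. \<mu> \<bullet> h a w = 0}"

text \<open>The union over all \<open>\<mu> \<noteq> 0\<close> of $U_\mu\times\mathrm{span}\,h(U_\mu,U_\mu)$. The projection
  \<open>P\<close> onto the kernel makes a spanning set of the kernel available as a family of vectors
  indexed by the basis of \<open>V\<close>, irrespective of the dimension of the kernel.\<close>

definition kernel_pairs :: "('v::euclidean_space \<Rightarrow> 'v \<Rightarrow> 'q::euclidean_space) \<Rightarrow> ('v \<times> 'q) set" where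
  "kernel_pairs h = {(x, z). \<exists>\<mu> P \<zeta>. \<mu> \<noteq> 0 \<and> x \<in> form_kernel h \<mu> \<and>
     linear P \<and> (\<forall>a\<in>form_kernel h \<mu>. P a = a) \<and> range P = form_kernel h \<mu> \<and>
     z = (\<Sum>b\<in>Basis. \<Sum>c\<in>Basis. \<zeta> b c *\<^sub>R h (P b) (P c))}"

lemma subspace_form_kernel:
  assumes h: "bilinear h"
  shows "subspace (form_kernel h \<mu>)"
  unfolding form_kernel_def subspace_def
  by (auto simp: bilinear_lzero[OF h] bilinear_ladd[OF h] bilinear_lmul[OF h] inner_add_right)

text \<open>The derivative of the sum of all \<open>\<zeta> b c *\<^sub>R h (P b) (P c)\<close>, given the derivatives \<open>Q\<close> of
  \<open>P\<close> and \<open>\<zeta>'\<close> of \<open>\<zeta>\<close>.\<close>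

abbreviation bracket_sum_deriv :: "('v::euclidean_space \<Rightarrow> 'v \<Rightarrow> 'q::euclidean_space) \<Rightarrow>
    ('v \<Rightarrow> 'v) \<Rightarrow> ('v \<Rightarrow> 'v \<Rightarrow> real) \<Rightarrow> ('v \<Rightarrow> 'v) \<Rightarrow> ('v \<Rightarrow> 'v \<Rightarrow> real) \<Rightarrow> 'q" where
  "bracket_sum_deriv h P \<zeta> Q \<zeta>' \<equiv> (\<Sum>b\<in>Basis. \<Sum>c\<in>Basis.
     \<zeta>' b c *\<^sub>R h (P b) (P c) + \<zeta> b c *\<^sub>R (h (Q b) (P c) + h (P b) (Q c)))"

text \<open>The equations defining a point of \<open>kernel_pairs\<close>, differentiated: \<open>\<theta>\<close>, \<open>Q\<close>,
  \<open>\<zeta>'\<close>, \<open>x'\<close> and \<open>z'\<close> are the derivatives of \<open>\<mu>\<close>, \<open>P\<close>, \<open>\<zeta>\<close>, \<open>x\<close> and \<open>z\<close>.\<close>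

definition tangent_triples :: "('v::euclidean_space \<Rightarrow> 'v \<Rightarrow> 'q::euclidean_space) \<Rightarrow> 'q \<Rightarrow> 'v \<Rightarrow>
    ('v \<Rightarrow> 'v) \<Rightarrow> ('v \<Rightarrow> 'v \<Rightarrow> real) \<Rightarrow> ('q \<times> 'v \<times> 'q) set" where
  "tangent_triples h \<mu> x P \<zeta> = {(\<theta>, x', z'). (\<forall>w\<in>Basis. \<theta> \<bullet> h x w + \<mu> \<bullet> h x' w = 0) \<and>
     (\<exists>Q \<zeta>'. (\<forall>b\<in>Basis. \<forall>w\<in>Basis. \<theta> \<bullet> h (P b) w + \<mu> \<bullet> h (Q b) w = 0) \<and>
       z' = bracket_sum_deriv h P \<zeta> Q \<zeta>')}"

lemma subspace_tangent_triples:
  assumes h: "bilinear h"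
  shows "subspace (tangent_triples h \<mu> x P \<zeta>)"
proof -
  note hs = bilinear_ladd[OF h] bilinear_radd[OF h] bilinear_lmul[OF h] bilinear_rmul[OF h] bilinear_lzero[OF h] bilinear_rzero[OF h]
  let ?N = "tangent_triples h \<mu> x P \<zeta>"
  show ?thesis
    unfolding subspace_def
  proof (intro conjI ballI allI)
    show "0 \<in> ?N" unfolding tangent_triples_def zero_prod_def
      by (auto simp: hs intro!: exI[of _ "\<lambda>_. 0"] exI[of _ "\<lambda>_ _. 0"])
  next
    fix p q assume "p \<in> ?N" "q \<in> ?N"
    then obtain \<theta> x' z' Q \<zeta>' \<eta> y' w' R \<xi>' where
      p: "p = (\<theta>, x', z')" "\<And>w. w \<in> Basis \<Longrightarrow> \<theta> \<bullet> h x w + \<mu> \<bullet> h x' w = 0"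
        "\<And>b w. b \<in> Basis \<Longrightarrow> w \<in> Basis \<Longrightarrow> \<theta> \<bullet> h (P b) w + \<mu> \<bullet> h (Q b) w = 0"
        "z' = bracket_sum_deriv h P \<zeta> Q \<zeta>'" and
      q: "q = (\<eta>, y', w')" "\<And>w. w \<in> Basis \<Longrightarrow> \<eta> \<bullet> h x w + \<mu> \<bullet> h y' w = 0"
        "\<And>b w. b \<in> Basis \<Longrightarrow> w \<in> Basis \<Longrightarrow> \<eta> \<bullet> h (P b) w + \<mu> \<bullet> h (R b) w = 0"
        "w' = bracket_sum_deriv h P \<zeta> R \<xi>'"
      unfolding tangent_triples_def by blast
    have "(\<theta> + \<eta>) \<bullet> h x w + \<mu> \<bullet> h (x' + y') w = 0" if "w \<in> Basis" for w
      using p(2)[OF that] q(2)[OF that] by (simp add: hs inner_add_left inner_add_right)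
    moreover have "(\<theta> + \<eta>) \<bullet> h (P b) w + \<mu> \<bullet> h (Q b + R b) w = 0" if "b \<in> Basis" "w \<in> Basis" for b w
      using p(3)[OF that] q(3)[OF that] by (simp add: hs inner_add_left inner_add_right)
    moreover have "z' + w' = (\<Sum>b\<in>Basis. \<Sum>c\<in>Basis. (\<zeta>' b c + \<xi>' b c) *\<^sub>R h (P b) (P c) + \<zeta> b c *\<^sub>R (h (Q b + R b) (P c) + h (P b) (Q c + R c)))"
      unfolding p(4) q(4) sum.distrib[symmetric]
      by (intro sum.cong refl) (simp add: hs algebra_simps)
    ultimately show "p + q \<in> ?N" unfolding tangent_triples_def p(1) q(1)
      by (auto intro!: exI[of _ "\<lambda>b. Q b + R b"] exI[of _ "\<lambda>b c. \<zeta>' b c + \<xi>' b c"])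
  next
    fix r p assume "p \<in> ?N"
    then obtain \<theta> x' z' Q \<zeta>' where
      p: "p = (\<theta>, x', z')" "\<And>w. w \<in> Basis \<Longrightarrow> \<theta> \<bullet> h x w + \<mu> \<bullet> h x' w = 0"
        "\<And>b w. b \<in> Basis \<Longrightarrow> w \<in> Basis \<Longrightarrow> \<theta> \<bullet> h (P b) w + \<mu> \<bullet> h (Q b) w = 0"
        "z' = bracket_sum_deriv h P \<zeta> Q \<zeta>'"
      unfolding tangent_triples_def by blast
    have "(r *\<^sub>R \<theta>) \<bullet> h x w + \<mu> \<bullet> h (r *\<^sub>R x') w = 0" if "w \<in> Basis" for w
      using p(2)[OF that] by (simp add: hs flip: distrib_left)
    moreover have "(r *\<^sub>R \<theta>) \<bullet> h (P b) w + \<mu> \<bullet> h (r *\<^sub>R Q b) w = 0" if "b \<in> Basis" "w \<in> Basis" for b w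
      using p(3)[OF that] by (simp add: hs flip: distrib_left)
    moreover have "r *\<^sub>R z' = (\<Sum>b\<in>Basis. \<Sum>c\<in>Basis. (r * \<zeta>' b c) *\<^sub>R h (P b) (P c) + \<zeta> b c *\<^sub>R (h (r *\<^sub>R Q b) (P c) + h (P b) (r *\<^sub>R Q c)))"
      unfolding p(4) scaleR_sum_right
      by (intro sum.cong refl) (simp add: hs algebra_simps)
    ultimately show "r *\<^sub>R p \<in> ?N" unfolding tangent_triples_def p(1)
      by (auto intro!: exI[of _ "\<lambda>b. r *\<^sub>R Q b"] exI[of _ "\<lambda>b c. r * \<zeta>' b c"])
  qed
qed

text \<open>Membership in the kernel is tested on basis vectors; in this form it is a finite set of
  conditions, as needed for statements that hold eventually along an ultrafilter.\<close>

lemma form_kernel_Basis: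
  assumes h: "bilinear h" and "\<And>w. w \<in> Basis \<Longrightarrow> \<mu> \<bullet> h a w = 0"
  shows "a \<in> form_kernel h \<mu>"
proof -
  have "\<mu> \<bullet> h a w = 0" for w
  proof -
    have lin: "linear (\<lambda>w. \<mu> \<bullet> h a w)"
      by (rule linearI) (simp_all add: bilinear_radd[OF h] bilinear_rmul[OF h] inner_add_right)
    show ?thesis
      using linear_eq_on[OF lin linear_zero, of w Basis] assms(2) by simp
  qed
  then show ?thesis by (simp add: form_kernel_def)
qed

text \<open>Let \<open>M\<close> be the space of all \<open>\<theta>\<close> such that $\theta\cdot h$ vanishes on $U\times U$, where
  \<open>U\<close> is the kernel of \<open>\<mu>\<close>. The first component of a tangent triple lies in \<open>M\<close>: pair the
  differentiated kernel equation with a kernel vector, whereupon the term with \<open>\<mu>\<close> vanishes. If the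
  first component is zero, then \<open>x'\<close> and all \<open>Q b\<close> lie in \<open>U\<close>, and \<open>z'\<close> is orthogonal to
  \<open>M\<close>. The dimensions add up to \<open>DIM('q) + dim U\<close>.\<close>

lemma dim_tangent_triples:
  fixes h :: "'v::euclidean_space \<Rightarrow> 'v \<Rightarrow> 'q::euclidean_space"
  assumes h: "bilinear h" and skew: "\<And>a b. h a b = - h b a"
    and P: "linear P" "range P = form_kernel h \<mu>"
  shows "dim (tangent_triples h \<mu> x P \<zeta>) \<le> DIM('q) + dim (form_kernel h \<mu>)"
proof -
  let ?N = "tangent_triples h \<mu> x P \<zeta>" and ?U = "form_kernel h \<mu>"
  note N = subspace_tangent_triples[OF h, of \<mu> x P \<zeta>]
  define M where "M = {\<theta>. \<forall>a\<in>?U. \<forall>b\<in>?U. \<theta> \<bullet> h a b = 0}"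
  define M' where "M' = {z. \<forall>\<theta>\<in>M. orthogonal \<theta> z}"
  have M: "subspace M" by (auto simp: M_def subspace_def inner_add_left)
  have M': "subspace M'" by (auto simp: M'_def subspace_def orthogonal_def inner_add_right)
  have dM: "dim M' + dim M = DIM('q)"
    using dim_subspace_orthogonal_to_vectors[OF M subspace_UNIV] by (simp add: M'_def)
  have PU: "P b \<in> ?U" for b using P(2) by blast
  have in_M: "\<theta> \<in> M" if "(\<theta>, x', z') \<in> ?N" for \<theta> x' z'
  proof -
    obtain Q where Q: "\<And>b w. b \<in> Basis \<Longrightarrow> w \<in> Basis \<Longrightarrow> \<theta> \<bullet> h (P b) w + \<mu> \<bullet> h (Q b) w = 0"
      using \<open>(\<theta>, x', z') \<in> ?N\<close> unfolding tangent_triples_def by blast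
    have 1: "\<theta> \<bullet> h (P b) w = 0" if b: "b \<in> Basis" and w: "w \<in> ?U" for b w
    proof -
      have lin: "linear (\<lambda>w. \<theta> \<bullet> h (P b) w + \<mu> \<bullet> h (Q b) w)"
        by (rule linearI) (simp_all add: bilinear_radd[OF h] bilinear_rmul[OF h] inner_add_right algebra_simps)
      have "\<theta> \<bullet> h (P b) w + \<mu> \<bullet> h (Q b) w = 0"
        using linear_eq_on[OF lin linear_zero, of w Basis] Q[OF b] by simp
      moreover have "\<mu> \<bullet> h (Q b) w = - (\<mu> \<bullet> h w (Q b))" by (subst skew) simp
      ultimately show ?thesis using w by (simp add: form_kernel_def)
    qed
    have "\<theta> \<bullet> h a w = 0" if a: "a \<in> ?U" and w: "w \<in> ?U" for a w
    proof -
      obtain c where c: "a = P c" using a P(2) by blast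
      have lin: "linear (\<lambda>c. \<theta> \<bullet> h (P c) w)"
        by (rule linearI) (simp_all add: linear_add[OF P(1)] linear_scale[OF P(1)] bilinear_ladd[OF h] bilinear_lmul[OF h] inner_add_right)
      show ?thesis unfolding c using linear_eq_on[OF lin linear_zero, of c Basis] 1 w by simp
    qed
    then show ?thesis by (auto simp: M_def)
  qed
  have "dim (fst ` ?N) \<le> dim M" by (rule dim_subset) (use in_M in force)
  moreover have "dim {n\<in>?N. fst n = 0} \<le> dim ({0::'q} \<times> (?U \<times> M'))"
  proof (rule dim_subset, rule subsetI)
    fix n assume "n \<in> {n\<in>?N. fst n = 0}"
    then obtain \<theta> x' z' where n: "(\<theta>, x', z') \<in> ?N" and \<theta>: "\<theta> = 0" and n_eq: "n = (\<theta>, x', z')"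
      by (cases n) auto
    from n[unfolded \<theta>] obtain Q \<zeta>' where Q: "\<And>w. w \<in> Basis \<Longrightarrow> 0 \<bullet> h x w + \<mu> \<bullet> h x' w = 0"
        "\<And>b w. b \<in> Basis \<Longrightarrow> w \<in> Basis \<Longrightarrow> 0 \<bullet> h (P b) w + \<mu> \<bullet> h (Q b) w = 0"
        "z' = bracket_sum_deriv h P \<zeta> Q \<zeta>'"
      unfolding tangent_triples_def by blast
    note * = Q(1)[simplified] Q(2)[simplified] Q(3)
    have QU: "Q b \<in> ?U" if "b \<in> Basis" for b using that *(2) by (intro form_kernel_Basis[OF h])
    have "orthogonal \<eta> z'" if \<eta>: "\<eta> \<in> M" for \<eta>
    proof -
      have m: "\<eta> \<bullet> h a b = 0" if "a \<in> ?U" "b \<in> ?U" for a b using \<eta> that by (simp add: M_def)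
      show ?thesis unfolding orthogonal_def *(3) inner_sum_right
        by (intro sum.neutral ballI) (simp add: inner_add_right m PU QU)
    qed
    then have "z' \<in> M'" by (simp add: M'_def)
    moreover have "x' \<in> ?U" using *(1) by (rule form_kernel_Basis[OF h])
    ultimately show "n \<in> {0} \<times> (?U \<times> M')" using \<theta> n_eq by simp
  qed
  moreover have "dim ({0::'q} \<times> (?U \<times> M')) = dim ?U + dim M'"
    using M' subspace_form_kernel[OF h, of \<mu>] by (simp add: dim_Times subspace_Times)
  ultimately show ?thesis
    using dim_le_image_plus_kernel[OF linear_fst N] dM by linarith
qed

lemma bilinear_inner: "bilinear ((\<bullet>) :: 'a::euclidean_space \<Rightarrow> 'a \<Rightarrow> real)"
  by (simp add: bilinear_conv_bounded_bilinear bounded_bilinear_inner)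

lemma bilinear_scaleR: "bilinear ((*\<^sub>R) :: real \<Rightarrow> 'a::euclidean_space \<Rightarrow> 'a)"
  by (simp add: bilinear_conv_bounded_bilinear bounded_bilinear_scaleR)

text \<open>If the functions were independent, the derivatives of a generic point, together with those of
  arbitrarily chosen \<open>\<mu>\<close>, \<open>P\<close> and \<open>\<zeta>\<close>, would give \<open>m\<close> tangent triples whose last two
  components are dual to the differentials of the functions. The triple \<open>(\<mu>, 0, 0)\<close> is tangent as
  well, because \<open>x\<close> and all \<open>P b\<close> lie in the kernel of \<open>\<mu>\<close>, and it is independent of the
  others, because its last two components vanish. These are
  \<open>m + 1\<close> independent vectors in a space of dimension at most \<open>m\<close>. It is this extra vector that
  accounts for the summand 1 in the codimension $2k+1$.\<close>

lemma alg_dependent_kernel_pairs: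
  fixes h :: "'v::euclidean_space \<Rightarrow> 'v \<Rightarrow> 'q::euclidean_space"
  assumes h: "bilinear h" and skew: "\<And>a b. h a b = - h b a"
    and d: "\<And>\<mu>. \<mu> \<noteq> 0 \<Longrightarrow> dim (form_kernel h \<mu>) \<le> d"
    and f: "\<forall>j<m. real_polynomial_function (f j)" and m: "DIM('q) + d \<le> m"
  shows "alg_dependent m f (kernel_pairs h)"
proof (rule ccontr)
  assume "\<not> alg_dependent m f (kernel_pairs h)"
  from alg_independent_tangent_frame[OF this f] obtain e D g' where frame: "tangent_frame m (kernel_pairs h) e D g'"
    by (elim exE)
  note e = tangent_frameD(1)[OF frame] and D = tangent_frameD(2)[OF frame]
    and g' = tangent_frameD(3)[OF frame] and dual = tangent_frameD(4)[OF frame]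
  define x z where "x i = fst (e i)" and "z i = snd (e i)" for i
  have "\<forall>i. \<exists>\<mu> P \<zeta>. \<mu> \<noteq> 0 \<and> x i \<in> form_kernel h \<mu> \<and>
     linear P \<and> (\<forall>a\<in>form_kernel h \<mu>. P a = a) \<and> range P = form_kernel h \<mu> \<and>
     z i = (\<Sum>b\<in>Basis. \<Sum>c\<in>Basis. \<zeta> b c *\<^sub>R h (P b) (P c))"
    using e unfolding kernel_pairs_def x_def z_def by (simp add: case_prod_beta)
  then obtain \<mu> P \<zeta> where 0: "\<forall>i. \<mu> i \<noteq> 0 \<and> x i \<in> form_kernel h (\<mu> i) \<and>
     linear (P i) \<and> (\<forall>a\<in>form_kernel h (\<mu> i). P i a = a) \<and> range (P i) = form_kernel h (\<mu> i) \<and>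
     z i = (\<Sum>b\<in>Basis. \<Sum>c\<in>Basis. \<zeta> i b c *\<^sub>R h (P i b) (P i c))"
    unfolding choice_iff by (elim exE)
  define \<theta> where "\<theta> j = vderiv (D j) \<mu>" for j
  define Q where "Q j b = vderiv (D j) (\<lambda>i. P i b)" for j b
  define \<zeta>' where "\<zeta>' j b c = vderiv (D j) (\<lambda>i. \<zeta> i b c)" for j b c
  have kernel_deriv: "\<forall>\<^sub>U i. \<theta> j i \<bullet> h (y i) w + \<mu> i \<bullet> h (vderiv (D j) y i) w = 0"
    if y: "\<forall>i. y i \<in> form_kernel h (\<mu> i)" for y j w
  proof -
    have Dj: "real_derivation (D j)" using D by blast
    have "linear (\<lambda>a. h a w)" using h by (simp add: bilinear_def)
    from vderiv_linear[OF Dj this, of y] vderiv_const[OF Dj, of "0::real"]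
      vderiv_bilinear[OF Dj bilinear_inner, of \<mu> "\<lambda>i. h (y i) w"]
    have "\<forall>\<^sub>U i. vderiv (D j) (\<lambda>i. \<mu> i \<bullet> h (y i) w) i = \<theta> j i \<bullet> h (y i) w + \<mu> i \<bullet> h (vderiv (D j) y i) w"
      unfolding \<theta>_def by eventually_elim simp
    moreover have "(\<lambda>i. \<mu> i \<bullet> h (y i) w) = (\<lambda>_. 0)" using y by (auto simp: form_kernel_def)
    ultimately show ?thesis using vderiv_const[OF Dj, of "0::real"]
      by (auto elim: eventually_elim2)
  qed
  have z_deriv: "\<forall>\<^sub>U i. vderiv (D j) z i = (\<Sum>b\<in>Basis. \<Sum>c\<in>Basis.
     \<zeta>' j b c i *\<^sub>R h (P i b) (P i c) + \<zeta> i b c *\<^sub>R (h (Q j b i) (P i c) + h (P i b) (Q j c i)))" for j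
  proof -
    have Dj: "real_derivation (D j)" using D by blast
    have z: "z = (\<lambda>i. \<Sum>b\<in>Basis. \<Sum>c\<in>Basis. \<zeta> i b c *\<^sub>R h (P i b) (P i c))" using 0 by blast
    have 1: "\<forall>\<^sub>U i. vderiv (D j) (\<lambda>i. \<zeta> i b c *\<^sub>R h (P i b) (P i c)) i
       = \<zeta>' j b c i *\<^sub>R h (P i b) (P i c) + \<zeta> i b c *\<^sub>R (h (Q j b i) (P i c) + h (P i b) (Q j c i))" for b c
      using vderiv_bilinear[OF Dj bilinear_scaleR, of "\<lambda>i. \<zeta> i b c" "\<lambda>i. h (P i b) (P i c)"]
        vderiv_bilinear[OF Dj h, of "\<lambda>i. P i b" "\<lambda>i. P i c"]
      unfolding \<zeta>'_def Q_def by eventually_elim simp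
    have "\<forall>\<^sub>U i. \<forall>b\<in>Basis. \<forall>c\<in>Basis. vderiv (D j) (\<lambda>i. \<zeta> i b c *\<^sub>R h (P i b) (P i c)) i
       = \<zeta>' j b c i *\<^sub>R h (P i b) (P i c) + \<zeta> i b c *\<^sub>R (h (Q j b i) (P i c) + h (P i b) (Q j c i))"
      using 1 by (intro eventually_ball_finite ballI) auto
    moreover have "\<forall>\<^sub>U i. \<forall>b\<in>Basis. vderiv (D j) (\<lambda>i. \<Sum>c\<in>Basis. \<zeta> i b c *\<^sub>R h (P i b) (P i c)) i
       = (\<Sum>c\<in>Basis. vderiv (D j) (\<lambda>i. \<zeta> i b c *\<^sub>R h (P i b) (P i c)) i)"
      by (intro eventually_ball_finite ballI vderiv_sum[OF Dj]) auto
    moreover have "\<forall>\<^sub>U i. vderiv (D j) (\<lambda>i. \<Sum>b\<in>Basis. \<Sum>c\<in>Basis. \<zeta> i b c *\<^sub>R h (P i b) (P i c)) i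
       = (\<Sum>b\<in>Basis. vderiv (D j) (\<lambda>i. \<Sum>c\<in>Basis. \<zeta> i b c *\<^sub>R h (P i b) (P i c)) i)"
      by (rule vderiv_sum[OF Dj])
    ultimately show ?thesis unfolding z[symmetric] by eventually_elim simp
  qed
  have PU: "\<forall>i. P i b \<in> form_kernel h (\<mu> i)" for b using 0 by blast
  have x_deriv: "\<forall>\<^sub>U i. vderiv (D j) e i = (vderiv (D j) x i, vderiv (D j) z i)" for j
  proof -
    have Dj: "real_derivation (D j)" using D by blast
    show ?thesis
      using vderiv_linear[OF Dj linear_fst, of e] vderiv_linear[OF Dj linear_snd, of e]
      unfolding x_def[abs_def] z_def[abs_def] by eventually_elim (simp add: prod_eq_iff)
  qed
  have "\<forall>\<^sub>U i. \<forall>j\<in>{..<m}.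
      (\<forall>w\<in>Basis. \<theta> j i \<bullet> h (x i) w + \<mu> i \<bullet> h (vderiv (D j) x i) w = 0) \<and>
      (\<forall>b\<in>Basis. \<forall>w\<in>Basis. \<theta> j i \<bullet> h (P i b) w + \<mu> i \<bullet> h (Q j b i) w = 0) \<and>
      vderiv (D j) z i = (\<Sum>b\<in>Basis. \<Sum>c\<in>Basis.
        \<zeta>' j b c i *\<^sub>R h (P i b) (P i c) + \<zeta> i b c *\<^sub>R (h (Q j b i) (P i c) + h (P i b) (Q j c i))) \<and>
      vderiv (D j) e i = (vderiv (D j) x i, vderiv (D j) z i) \<and>
      (\<forall>l\<in>{..<m}. g' l (e i) (vderiv (D j) e i) = (if l = j then 1 else 0))"
    unfolding Q_def
    by (intro eventually_ball_finite ballI eventually_conj kernel_deriv z_deriv[unfolded Q_def] x_deriv PU)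
      (use 0 dual in auto)
  from eventually_happens'[OF poly_ultrafilter(2) this] obtain i where
    i: "\<forall>j\<in>{..<m}.
      (\<forall>w\<in>Basis. \<theta> j i \<bullet> h (x i) w + \<mu> i \<bullet> h (vderiv (D j) x i) w = 0) \<and>
      (\<forall>b\<in>Basis. \<forall>w\<in>Basis. \<theta> j i \<bullet> h (P i b) w + \<mu> i \<bullet> h (Q j b i) w = 0) \<and>
      vderiv (D j) z i = (\<Sum>b\<in>Basis. \<Sum>c\<in>Basis.
        \<zeta>' j b c i *\<^sub>R h (P i b) (P i c) + \<zeta> i b c *\<^sub>R (h (Q j b i) (P i c) + h (P i b) (Q j c i))) \<and>
      vderiv (D j) e i = (vderiv (D j) x i, vderiv (D j) z i) \<and>
      (\<forall>l\<in>{..<m}. g' l (e i) (vderiv (D j) e i) = (if l = j then 1 else 0))"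
    by (elim exE)
  let ?N = "tangent_triples h (\<mu> i) (x i) (P i) (\<zeta> i)"
  define v where "v j = (if j < m then (\<theta> j i, vderiv (D j) e i) else (\<mu> i, 0))" for j
  define G where "G l p = g' l (e i) (snd p)" for l and p :: "'q \<times> 'v \<times> 'q"
  \<comment> \<open>the last functional is the component along \<open>\<mu>\<close>, corrected so as to vanish on the other vectors\<close>
  define \<phi> where "\<phi> l p = (if l < m then G l p
      else (\<mu> i \<bullet> fst p - (\<Sum>j<m. (\<mu> i \<bullet> \<theta> j i) * G j p)) / (\<mu> i \<bullet> \<mu> i))" for l p
  have \<mu>0: "\<mu> i \<bullet> \<mu> i \<noteq> 0" using 0 by simp
  have Glin: "linear (G l)" if "l < m" for l
    unfolding G_def using linear_compose[OF linear_snd g'[rule_format, OF that]] by (simp add: o_def)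
  have Gv: "G l (v j) = (if l = j then 1 else 0)" if "l < m" "j < m" for l j
  proof -
    have "j \<in> {..<m}" "l \<in> {..<m}" using that by auto
    with i have "g' l (e i) (vderiv (D j) e i) = (if l = j then 1 else 0)" by blast
    with that show ?thesis by (simp only: G_def v_def snd_conv if_True)
  qed
  have Gm: "G l (v m) = 0" if "l < m" for l
    using linear_0[OF g'[rule_format, OF that]] by (simp add: G_def v_def)
  have "Suc m \<le> dim ?N"
  proof (rule dual_family_card_le_dim)
    fix l assume "l < Suc m"
    have "linear (\<lambda>p. (\<mu> i \<bullet> fst p - (\<Sum>j<m. (\<mu> i \<bullet> \<theta> j i) * G j p)) / (\<mu> i \<bullet> \<mu> i))"
    proof (rule linearI)
      fix p q r
      have "G j (p + q) = G j p + G j q" "G j (r *\<^sub>R p) = r * G j p" if "j \<in> {..<m}" for j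
        using that by (simp_all add: linear_add[OF Glin] linear_scale[OF Glin])
      note G = this
      have s1: "(\<Sum>j<m. (\<mu> i \<bullet> \<theta> j i) * G j (p + q)) = (\<Sum>j<m. (\<mu> i \<bullet> \<theta> j i) * G j p) + (\<Sum>j<m. (\<mu> i \<bullet> \<theta> j i) * G j q)"
        unfolding sum.distrib[symmetric] by (intro sum.cong refl) (simp only: G distrib_left)
      have s2: "(\<Sum>j<m. (\<mu> i \<bullet> \<theta> j i) * G j (r *\<^sub>R p)) = r * (\<Sum>j<m. (\<mu> i \<bullet> \<theta> j i) * G j p)"
        unfolding sum_distrib_left by (intro sum.cong refl) (simp only: G mult.left_commute)
      show "(\<mu> i \<bullet> fst (p + q) - (\<Sum>j<m. (\<mu> i \<bullet> \<theta> j i) * G j (p + q))) / (\<mu> i \<bullet> \<mu> i)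
         = (\<mu> i \<bullet> fst p - (\<Sum>j<m. (\<mu> i \<bullet> \<theta> j i) * G j p)) / (\<mu> i \<bullet> \<mu> i) + (\<mu> i \<bullet> fst q - (\<Sum>j<m. (\<mu> i \<bullet> \<theta> j i) * G j q)) / (\<mu> i \<bullet> \<mu> i)"
        unfolding s1 by (simp add: inner_add_right add_divide_distrib diff_divide_distrib)
      show "(\<mu> i \<bullet> fst (r *\<^sub>R p) - (\<Sum>j<m. (\<mu> i \<bullet> \<theta> j i) * G j (r *\<^sub>R p))) / (\<mu> i \<bullet> \<mu> i)
         = r *\<^sub>R ((\<mu> i \<bullet> fst p - (\<Sum>j<m. (\<mu> i \<bullet> \<theta> j i) * G j p)) / (\<mu> i \<bullet> \<mu> i))"
        unfolding s2 by (simp add: right_diff_distrib)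
    qed
    then show "linear (\<phi> l)" unfolding \<phi>_def using Glin by (cases "l < m") simp_all
  next
    fix l j assume lj: "l < Suc m" "j < Suc m"
    show "\<phi> l (v j) = (if l = j then 1 else 0)"
    proof (cases "l < m")
      case True
      then show ?thesis using Gv[of l j] Gm[of l] lj by (cases "j < m") (auto simp: \<phi>_def less_Suc_eq)
    next
      case False
      with lj have l: "l = m" by simp
      show ?thesis
      proof (cases "j < m")
        case True
        have "(\<Sum>k<m. (\<mu> i \<bullet> \<theta> k i) * G k (v j)) = (\<Sum>k<m. if k = j then \<mu> i \<bullet> \<theta> k i else 0)"
          by (intro sum.cong refl) (use True Gv in auto)
        also have "\<dots> = \<mu> i \<bullet> \<theta> j i" using True by simp
        finally show ?thesis using True l by (simp add: \<phi>_def) (simp add: v_def)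
      next
        case False
        with lj have j: "j = m" by simp
        have "(\<Sum>k<m. (\<mu> i \<bullet> \<theta> k i) * G k (v m)) = 0" by (intro sum.neutral) (simp add: Gm)
        then show ?thesis using l j \<mu>0 by (simp add: \<phi>_def) (simp add: v_def)
      qed
    qed
  next
    fix j assume "j < Suc m"
    show "v j \<in> ?N"
    proof (cases "j < m")
      case True
      with i have "v j = (\<theta> j i, vderiv (D j) x i, vderiv (D j) z i)" by (simp add: v_def)
      moreover have "(\<theta> j i, vderiv (D j) x i, vderiv (D j) z i) \<in> ?N"
        unfolding tangent_triples_def mem_Collect_eq prod.case
        using i True by (intro conjI exI[of _ "\<lambda>b. Q j b i"] exI[of _ "\<lambda>b c. \<zeta>' j b c i"]) simp_all
      ultimately show ?thesis by simp
    next
      case False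
      have "\<mu> i \<bullet> h (P i b) w = 0" "\<mu> i \<bullet> h (x i) w = 0" for b w
        using PU[of b] 0 by (simp_all add: form_kernel_def)
      with False show ?thesis
        by (auto simp: v_def tangent_triples_def zero_prod_def bilinear_lzero[OF h] bilinear_rzero[OF h]
            intro!: exI[of _ "\<lambda>_. 0"] exI[of _ "\<lambda>_ _. 0"])
    qed
  qed
  also have "dim ?N \<le> DIM('q) + dim (form_kernel h (\<mu> i))"
    by (rule dim_tangent_triples[OF h skew]) (use 0 in auto)
  also have "\<dots> \<le> m" using d[of "\<mu> i"] 0 m by simp
  finally show False by simp
qed

section \<open>Krull dimension\<close>

lemma real_polynomial_function_mpoly_fun:
  assumes "mpoly_fun m Q" and f: "\<forall>j<m. real_polynomial_function (f j)"
  shows "real_polynomial_function (\<lambda>x. Q (\<lambda>j. f j x))"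
  using assms(1)
  by (induction rule: mpoly_fun.induct) (use f in \<open>auto intro: real_polynomial_function.intros\<close>)

lemma algebraic_variety_zariski_closure: "algebraic_variety (zariski_closure A)"
proof -
  define P where "P = {p. real_polynomial_function p \<and> (\<forall>x\<in>A. p x = 0)}"
  have "zariski_closure A = {x. \<forall>p\<in>P. p x = 0}"
  proof
    have "algebraic_variety {x. \<forall>p\<in>P. p x = 0}"
      unfolding algebraic_variety_def by (intro exI[of _ P] conjI refl) (simp add: P_def)
    then show "zariski_closure A \<subseteq> {x. \<forall>p\<in>P. p x = 0}"
      unfolding zariski_closure_def by (intro Inter_lower) (auto simp: P_def)
    show "{x. \<forall>p\<in>P. p x = 0} \<subseteq> zariski_closure A"
    proof (clarsimp simp: zariski_closure_def)
      fix x Z assume x: "\<forall>p\<in>P. p x = 0" and Z: "algebraic_variety Z" "A \<subseteq> Z"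
      then obtain R where R: "\<forall>p\<in>R. real_polynomial_function p" "Z = {x. \<forall>p\<in>R. p x = 0}"
        unfolding algebraic_variety_def by blast
      then have "R \<subseteq> P" using Z(2) by (auto simp: P_def)
      with x R(2) show "x \<in> Z" by blast
    qed
  qed
  then show ?thesis unfolding algebraic_variety_def by (intro exI[of _ P] conjI) (simp_all add: P_def)
qed

lemma zariski_closure_subset: "A \<subseteq> zariski_closure A"
  unfolding zariski_closure_def by blast

lemma zariski_closure_minimal: "algebraic_variety Z \<Longrightarrow> A \<subseteq> Z \<Longrightarrow> zariski_closure A \<subseteq> Z"
  unfolding zariski_closure_def by blast

lemma zariski_closure_variety: "algebraic_variety Z \<Longrightarrow> zariski_closure Z = Z"
  by (simp add: subset_antisym zariski_closure_minimal zariski_closure_subset)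

lemma algebraic_variety_separate:
  assumes Z: "algebraic_variety Z" and x: "x \<notin> Z"
  shows "\<exists>p. real_polynomial_function p \<and> p x \<noteq> 0 \<and> (\<forall>y\<in>Z. p y = 0)"
proof -
  obtain R where R: "\<forall>p\<in>R. real_polynomial_function p" "Z = {x. \<forall>p\<in>R. p x = 0}"
    using Z unfolding algebraic_variety_def by (elim exE conjE)
  from x obtain p where "p \<in> R" "p x \<noteq> 0" unfolding R(2) by blast
  with R show ?thesis by blast
qed

lemma algebraic_variety_Int_zeros:
  assumes "algebraic_variety Z" "real_polynomial_function p"
  shows "algebraic_variety {x\<in>Z. p x = 0}"
proof -
  obtain R where R: "\<forall>p\<in>R. real_polynomial_function p" "Z = {x. \<forall>p\<in>R. p x = 0}"
    using assms(1) unfolding algebraic_variety_def by blast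
  with assms(2) show ?thesis unfolding algebraic_variety_def by (intro exI[of _ "insert p R"]) auto
qed

text \<open>A polynomial relation between polynomials is itself a polynomial equation, so it persists on the
  Zariski closure.\<close>

lemma alg_dependent_zariski_closure:
  assumes f: "\<forall>j<m. real_polynomial_function (f j)" and dep: "alg_dependent m f A"
  shows "alg_dependent m f (zariski_closure A)"
proof -
  obtain Q where Q: "mpoly_fun m Q" "\<exists>y. Q y \<noteq> 0" "\<forall>x\<in>A. Q (\<lambda>j. f j x) = 0"
    using dep unfolding alg_dependent_def by blast
  have "algebraic_variety {x. Q (\<lambda>j. f j x) = 0}"
    unfolding algebraic_variety_def using real_polynomial_function_mpoly_fun[OF Q(1) f]
    by (intro exI[of _ "{\<lambda>x. Q (\<lambda>j. f j x)}"]) auto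
  then have "zariski_closure A \<subseteq> {x. Q (\<lambda>j. f j x) = 0}"
    using Q(3) by (intro zariski_closure_minimal) auto
  with Q show ?thesis unfolding alg_dependent_def by (intro exI[of _ Q]) auto
qed

lemma alg_dependent_subset: "alg_dependent m f T \<Longrightarrow> S \<subseteq> T \<Longrightarrow> alg_dependent m f S"
  unfolding alg_dependent_def by blast

text \<open>Passing from \<open>C n\<close> to the larger irreducible variety \<open>C (Suc n)\<close>, add to the polynomials
  found for \<open>C n\<close> a polynomial \<open>g\<close> that vanishes on \<open>C n\<close> but not on \<open>C (Suc n)\<close>. In a
  relation between them on \<open>C (Suc n)\<close> the largest possible power of \<open>g\<close> can be cancelled by
  irreducibility. Restricting what remains to \<open>C n\<close>, where \<open>g\<close> is zero, leaves a nontrivial relation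
  between the old polynomials.\<close>

lemma irreducible_chain_independent:
  fixes C :: "nat \<Rightarrow> 'a::euclidean_space set"
  assumes "\<forall>i\<le>n. irreducible_variety (C i)" "\<forall>i<n. C i \<subset> C (Suc i)"
  shows "\<exists>f. (\<forall>j<n. real_polynomial_function (f j)) \<and> \<not> alg_dependent n f (C n)"
  using assms
proof (induction n)
  case 0
  then obtain x where x: "x \<in> C 0" by (auto simp: irreducible_variety_def)
  have "\<not> alg_dependent 0 f (C 0)" for f :: "nat \<Rightarrow> 'a \<Rightarrow> real"
  proof
    assume "alg_dependent 0 f (C 0)"
    then obtain Q y where Q: "mpoly_fun 0 Q" "Q y \<noteq> 0" "Q (\<lambda>j. f j x) = 0"
      using x unfolding alg_dependent_def by blast
    with mpoly_fun_cong[OF Q(1), of y "\<lambda>j. f j x"] show False by simp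
  qed
  then show ?case by simp
next
  case (Suc n)
  then obtain f where f: "\<forall>j<n. real_polynomial_function (f j)" "\<not> alg_dependent n f (C n)"
    by (auto simp: less_Suc_eq)
  have irr: "irreducible_variety (C n)" "irreducible_variety (C (Suc n))" and sub: "C n \<subset> C (Suc n)"
    using Suc.prems by auto
  obtain x0 where x0: "x0 \<in> C (Suc n)" "x0 \<notin> C n" using sub by blast
  have "algebraic_variety (C n)" using irr(1) by (simp add: irreducible_variety_def)
  from algebraic_variety_separate[OF this x0(2)]
  obtain g where gp: "real_polynomial_function g" and g: "g x0 \<noteq> 0" "\<forall>x\<in>C n. g x = 0"
    by (elim exE conjE)
  define F where "F = f(n := g)"
  have F: "\<forall>j<Suc n. real_polynomial_function (F j)" using f(1) gp by (auto simp: F_def less_Suc_eq)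
  have "\<not> alg_dependent (Suc n) F (C (Suc n))"
  proof
    assume "alg_dependent (Suc n) F (C (Suc n))"
    then obtain Q y0 where Q: "mpoly_fun (Suc n) Q" "Q y0 \<noteq> 0" "\<forall>x\<in>C (Suc n). Q (\<lambda>j. F j x) = 0"
      unfolding alg_dependent_def by (elim exE conjE)
    obtain A N where A': "\<forall>k. mpoly_fun n (\<lambda>y. coeff (A y) k)" "\<forall>y. degree (A y) \<le> N" "Q = (\<lambda>y. poly (A y) (y n))"
      using mpoly_fun_last_variable[OF Q(1)] by (elim exE conjE)
    note A = A'(1,2)[rule_format] A'(3)
    have "A y0 \<noteq> 0" using Q(2) A(3) by auto
    then have ex: "\<exists>k y. coeff (A y) k \<noteq> 0" by (metis leading_coeff_0_iff)
    \<comment> \<open>\<open>d\<close> is the largest power of the last variable that divides \<open>Q\<close>\<close>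
    define d where "d = (LEAST k. \<exists>y. coeff (A y) k \<noteq> 0)"
    obtain y1 where y1: "coeff (A y1) d \<noteq> 0" using LeastI_ex[OF ex] unfolding d_def by blast
    have low: "coeff (A y) k = 0" if "k < d" for k y using not_less_Least[of k "\<lambda>k. \<exists>y. coeff (A y) k \<noteq> 0"] that unfolding d_def by blast
    have dN: "d \<le> N" using y1 A(2)[of y1] le_degree order_trans by blast
    define R where "R y = (\<Sum>k=d..N. coeff (A y) k * y n ^ (k - d))" for y
    have QR: "Q y = y n ^ d * R y" for y
    proof -
      have "Q y = (\<Sum>k\<le>N. coeff (A y) k * y n ^ k)"
        using A(2)[of y] unfolding A(3) poly_altdef
        by (intro sum.mono_neutral_left) (auto simp: coeff_eq_0)
      also have "\<dots> = (\<Sum>k=d..N. coeff (A y) k * y n ^ k)"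
        by (intro sum.mono_neutral_right) (auto simp: low)
      also have "\<dots> = y n ^ d * R y"
        unfolding R_def sum_distrib_left by (intro sum.cong refl) (simp add: mult.left_commute flip: power_add)
      finally show ?thesis .
    qed
    have Rm: "mpoly_fun (Suc n) R" unfolding R_def
      by (intro mpoly_fun_sum mpoly_fun.mult mpoly_fun_power mpoly_fun.var mpoly_fun_mono[OF A(1)]) auto
    define r where "r x = R (\<lambda>j. F j x)" for x
    have rp: "real_polynomial_function r" unfolding r_def by (rule real_polynomial_function_mpoly_fun[OF Rm F])
    have gr: "g x = 0 \<or> r x = 0" if "x \<in> C (Suc n)" for x
      using Q(3) that unfolding QR r_def by (auto simp: F_def)
    have av: "algebraic_variety (C (Suc n))" using irr(2) by (simp add: irreducible_variety_def)
    have "C (Suc n) = {x\<in>C (Suc n). g x = 0} \<union> {x\<in>C (Suc n). r x = 0}" using gr by blast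
    then have "C (Suc n) = {x\<in>C (Suc n). g x = 0} \<or> C (Suc n) = {x\<in>C (Suc n). r x = 0}"
      using irr(2) algebraic_variety_Int_zeros[OF av gp] algebraic_variety_Int_zeros[OF av rp]
      unfolding irreducible_variety_def by blast
    then have r0: "r x = 0" if "x \<in> C (Suc n)" for x using x0(1) g(1) that by blast
    have "coeff (A (\<lambda>j. f j x)) d = 0" if x: "x \<in> C n" for x
    proof -
      have "0 = r x" using r0 sub x by auto
      also have "\<dots> = (\<Sum>k=d..N. coeff (A (\<lambda>j. F j x)) k * 0 ^ (k - d))"
        using g(2) x by (simp add: r_def R_def F_def)
      also have "\<dots> = (\<Sum>k=d..N. if k = d then coeff (A (\<lambda>j. F j x)) k else 0)"
        by (intro sum.cong refl) auto
      also have "\<dots> = coeff (A (\<lambda>j. F j x)) d" using dN by simp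
      also have "\<dots> = coeff (A (\<lambda>j. f j x)) d" by (rule mpoly_fun_cong[OF A(1)]) (simp add: F_def)
      finally show ?thesis by simp
    qed
    then have "alg_dependent n f (C n)"
      unfolding alg_dependent_def using A(1)[of d] y1 by (intro exI[of _ "\<lambda>y. coeff (A y) d"]) auto
    with f(2) show False by simp
  qed
  with F show ?case by blast
qed

lemma variety_dim_le:
  fixes Z :: "'a::euclidean_space set"
  assumes dep: "\<And>f :: nat \<Rightarrow> 'a \<Rightarrow> real. \<forall>j<Suc p. real_polynomial_function (f j) \<Longrightarrow> alg_dependent (Suc p) f Z"
  shows "variety_dim Z \<le> ereal (real p)"
  unfolding variety_dim_def
proof (rule Sup_least, clarify)
  fix n and C :: "nat \<Rightarrow> 'a set"
  assume C: "\<forall>i\<le>n. irreducible_variety (C i) \<and> C i \<subseteq> Z" "\<forall>i<n. C i \<subset> C (Suc i)"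
  have "n \<le> p"
  proof (rule ccontr)
    assume "\<not> n \<le> p"
    then have "Suc p \<le> n" by simp
    then obtain f where f: "\<forall>j<Suc p. real_polynomial_function (f j)" "\<not> alg_dependent (Suc p) f (C (Suc p))"
      using irreducible_chain_independent[of "Suc p" C] C by auto
    moreover have "C (Suc p) \<subseteq> Z" using C(1) \<open>Suc p \<le> n\<close> by simp
    ultimately show False using alg_dependent_subset[OF dep[OF f(1)]] by blast
  qed
  then show "ereal (real n) \<le> ereal (real p)" by simp
qed

lemma real_polynomial_function_line:
  fixes a b :: "'a::euclidean_space"
  shows "real_polynomial_function f \<Longrightarrow> \<exists>p. \<forall>t. f (a + t *\<^sub>R (b - a)) = poly p t"
proof (induction rule: real_polynomial_function.induct)
  case (linear f)
  then have "linear f" by (simp add: bounded_linear.linear)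
  then show ?case
    by (intro exI[of _ "[:f a, f (b - a):]"]) (simp add: linear_add linear_scale)
next
  case (const c)
  show ?case by (rule exI[of _ "[:c:]"]) simp
next
  case (add f g)
  then obtain p q where "\<forall>t. f (a + t *\<^sub>R (b - a)) = poly p t" "\<forall>t. g (a + t *\<^sub>R (b - a)) = poly q t" by blast
  then show ?case by (intro exI[of _ "p + q"]) simp
next
  case (mult f g)
  then obtain p q where "\<forall>t. f (a + t *\<^sub>R (b - a)) = poly p t" "\<forall>t. g (a + t *\<^sub>R (b - a)) = poly q t" by blast
  then show ?case by (intro exI[of _ "p * q"]) simp
qed

text \<open>On the line through a point of \<open>L\<close> outside \<open>A\<close> and one outside \<open>B\<close>, a product of two
  nonzero univariate polynomials would vanish identically.\<close>

lemma irreducible_variety_subspace: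
  fixes L :: "'a::euclidean_space set"
  assumes L: "subspace L"
  shows "irreducible_variety L"
  unfolding irreducible_variety_def
proof (intro conjI allI impI)
  have "L = {x. \<forall>p\<in>(\<lambda>a x. a \<bullet> x) ` (L\<^sup>\<bottom>). p x = 0}"
    using orthogonal_comp_self[OF L] unfolding orthogonal_comp_def orthogonal_def by auto
  moreover have "\<forall>p\<in>(\<lambda>a x. a \<bullet> x) ` (L\<^sup>\<bottom>). real_polynomial_function p"
    by (auto intro!: real_polynomial_function.intros(1) bounded_linear_inner_right)
  ultimately show "algebraic_variety L" unfolding algebraic_variety_def
    by (intro exI[of _ "(\<lambda>a x. a \<bullet> x) ` (L\<^sup>\<bottom>)"] conjI)
  show "L \<noteq> {}" using subspace_0[OF L] by blast
  fix A B assume AB: "algebraic_variety A \<and> algebraic_variety B \<and> L = A \<union> B"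
  show "L = A \<or> L = B"
  proof (rule ccontr)
    assume "\<not> (L = A \<or> L = B)"
    with AB obtain a b where ab: "a \<in> L" "a \<notin> A" "b \<in> L" "b \<notin> B" by blast
    have av: "algebraic_variety A" "algebraic_variety B" using AB by auto
    obtain P where P: "real_polynomial_function P" "P a \<noteq> 0" "\<forall>x\<in>A. P x = 0"
      using algebraic_variety_separate[OF av(1) ab(2)] by (elim exE conjE)
    obtain Q where Q: "real_polynomial_function Q" "Q b \<noteq> 0" "\<forall>x\<in>B. Q x = 0"
      using algebraic_variety_separate[OF av(2) ab(4)] by (elim exE conjE)
    obtain p where p: "\<forall>t. P (a + t *\<^sub>R (b - a)) = poly p t" using real_polynomial_function_line[OF P(1), of a b] by (elim exE)
    obtain q where q: "\<forall>t. Q (a + t *\<^sub>R (b - a)) = poly q t" using real_polynomial_function_line[OF Q(1), of a b] by (elim exE)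
    have "p \<noteq> 0" "q \<noteq> 0" using p[rule_format, of 0] q[rule_format, of 1] P(2) Q(2) by auto
    then obtain t where t: "poly (p * q) t \<noteq> 0" by (metis mult_eq_0_iff poly_all_0_iff_0)
    have "a + t *\<^sub>R (b - a) \<in> L" using ab L by (simp add: subspace_add subspace_diff subspace_scale)
    with AB have "P (a + t *\<^sub>R (b - a)) = 0 \<or> Q (a + t *\<^sub>R (b - a)) = 0" using P(3) Q(3) by blast
    with p q t show False by auto
  qed
qed

text \<open>A flag of subspaces of \<open>L\<close> is a chain of irreducible varieties.\<close>

lemma variety_dim_ge_subspace:
  fixes L :: "'a::euclidean_space set"
  assumes L: "subspace L" "L \<subseteq> Z"
  shows "ereal (real (dim L)) \<le> variety_dim Z"
proof -
  obtain B where B: "B \<subseteq> L" "independent B" "L \<subseteq> span B" "card B = dim L" using basis_exists[of L] by metis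
  obtain b where b: "bij_betw b {..<dim L} B"
    using ex_bij_betw_nat_finite[of B] independent_imp_finite[OF B(2)] B(4) by (auto simp: atLeast0LessThan)
  define C where "C i = span (b ` {..<i})" for i
  have "irreducible_variety (C i)" for i unfolding C_def by (intro irreducible_variety_subspace subspace_span)
  moreover have "C i \<subseteq> Z" if "i \<le> dim L" for i
  proof -
    have "b ` {..<i} \<subseteq> L" using b B(1) that by (auto simp: bij_betw_def)
    then have "C i \<subseteq> L" unfolding C_def using L(1) by (rule span_minimal)
    with L(2) show ?thesis by blast
  qed
  moreover have "C i \<subset> C (Suc i)" if i: "i < dim L" for i
  proof -
    have sub: "C i \<subseteq> C (Suc i)" unfolding C_def by (intro span_mono image_mono) auto
    have "b i \<in> C (Suc i)" unfolding C_def by (intro span_base) auto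
    moreover have "b i \<notin> C i"
    proof
      assume "b i \<in> C i"
      have "b ` {..<i} \<subseteq> B - {b i}" using b i by (auto simp: bij_betw_def inj_on_def)
      with \<open>b i \<in> C i\<close> have "b i \<in> span (B - {b i})" unfolding C_def using span_mono by blast
      moreover have "b i \<in> B" using b i by (auto simp: bij_betw_def)
      ultimately show False using B(2) by (auto simp: dependent_def)
    qed
    ultimately show ?thesis using sub by blast
  qed
  ultimately show ?thesis unfolding variety_dim_def
    by (intro Sup_upper CollectI exI[of _ "dim L"] conjI exI[of _ C]) auto
qed

section \<open>Rank of bivectors\<close>

lemma alternating_skew:
  assumes h: "bilinear h" and alt: "\<And>a. h a a = 0"
  shows "h a b = - h b a"
  using alt[of "a + b"] alt[of a] alt[of b]
  by (simp add: bilinear_ladd[OF h] bilinear_radd[OF h] add_eq_0_iff)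

text \<open>The symplectic normal form. If \<open>\<beta> p q = 1\<close>, subtracting the rank two form built from
  \<open>\<beta> p\<close> and \<open>\<beta> q\<close> leaves an alternating form whose kernel contains the old kernel together with
  \<open>p\<close> and \<open>q\<close>.\<close>

lemma alternating_form_decomposition:
  fixes \<beta> :: "'v::euclidean_space \<Rightarrow> 'v \<Rightarrow> real"
  assumes "bilinear \<beta>" "\<And>v. \<beta> v v = 0"
  shows "\<exists>m a b. (\<forall>v w. \<beta> v w = (\<Sum>i<m. (a i \<bullet> v) * (b i \<bullet> w) - (b i \<bullet> v) * (a i \<bullet> w))) \<and>
     dim {v. \<forall>w. \<beta> v w = 0} + 2 * m \<le> DIM('v)"
  using assms
proof (induction "DIM('v) - dim {v. \<forall>w. \<beta> v w = 0}" arbitrary: \<beta> rule: less_induct)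
  case less
  note \<beta> = less.prems(1) and alt = less.prems(2)
  note bs = bilinear_ladd[OF \<beta>] bilinear_radd[OF \<beta>] bilinear_lmul[OF \<beta>] bilinear_rmul[OF \<beta>]
  have skew: "\<beta> v w = - \<beta> w v" for v w by (rule alternating_skew[OF \<beta> alt])
  define K where "K = {v. \<forall>w. \<beta> v w = 0}"
  show ?case
  proof (cases "\<forall>v w. \<beta> v w = 0")
    case True
    then show ?thesis by (intro exI[of _ 0]) (simp add: dim_UNIV)
  next
    case False
    then obtain p q0 where "\<beta> p q0 \<noteq> 0" by blast
    then obtain q where pq: "\<beta> p q = 1"
      by (intro that[of "(1 / \<beta> p q0) *\<^sub>R q0"]) (simp add: bs)
    have repr: "(\<Sum>b\<in>Basis. \<beta> v b *\<^sub>R b) \<bullet> w = \<beta> v w" for v w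
    proof -
      have lin: "linear (\<beta> v)" using \<beta> by (simp add: bilinear_def)
      have "\<beta> v w = \<beta> v (\<Sum>b\<in>Basis. (w \<bullet> b) *\<^sub>R b)" by (simp only: euclidean_representation)
      also have "\<dots> = (\<Sum>b\<in>Basis. (w \<bullet> b) * \<beta> v b)" by (simp add: linear_sum[OF lin] linear_scale[OF lin])
      finally show ?thesis
        unfolding inner_sum_left inner_scaleR_left by (simp add: inner_commute mult.commute)
    qed
    define a where "a = (\<Sum>b\<in>Basis. \<beta> p b *\<^sub>R b)"
    define c where "c = (\<Sum>b\<in>Basis. \<beta> q b *\<^sub>R b)"
    have a: "a \<bullet> w = \<beta> p w" and c: "c \<bullet> w = \<beta> q w" for w by (simp_all add: a_def c_def repr)
    define \<beta>' where "\<beta>' v w = \<beta> v w - ((a \<bullet> v) * (c \<bullet> w) - (c \<bullet> v) * (a \<bullet> w))" for v w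
    define K' where "K' = {v. \<forall>w. \<beta>' v w = 0}"
    have \<beta>': "bilinear \<beta>'"
      unfolding bilinear_def \<beta>'_def by (auto intro!: linearI simp: bs inner_add_right algebra_simps)
    have alt': "\<beta>' v v = 0" for v by (simp add: \<beta>'_def alt)
    have K: "subspace K" by (auto simp: K_def subspace_def bs bilinear_lzero[OF \<beta>])
    have qp: "\<beta> q p = -1" using skew[of q p] pq by simp
    have "p \<in> K'" "q \<in> K'" by (simp_all add: K'_def \<beta>'_def a c alt pq qp)
    moreover have "K \<subseteq> K'"
    proof
      fix v assume v: "v \<in> K"
      then have "\<beta> p v = 0" "\<beta> q v = 0" using skew[of p v] skew[of q v] by (simp_all add: K_def)
      with v show "v \<in> K'" by (simp add: K'_def \<beta>'_def a c K_def)
    qed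
    ultimately have sub: "insert q (insert p K) \<subseteq> K'" by simp
    have p: "p \<notin> span K"
    proof
      assume "p \<in> span K"
      then have "p \<in> K" using K by (simp add: span_eq_iff[THEN iffD2])
      with pq show False by (simp add: K_def)
    qed
    have q: "q \<notin> span (insert p K)"
    proof
      assume "q \<in> span (insert p K)"
      then obtain s where "q - s *\<^sub>R p \<in> span K" by (auto simp: span_insert)
      then have "q - s *\<^sub>R p \<in> K" using K by (simp add: span_eq_iff[THEN iffD2])
      then have "\<beta> (q - s *\<^sub>R p) p = 0" by (simp add: K_def)
      then show False using qp alt[of p] by (simp add: bilinear_lsub[OF \<beta>] bs)
    qed
    have "dim (insert q (insert p K)) = dim K + 2" using p q by (simp add: dim_insert)
    then have dK: "dim K + 2 \<le> dim K'" using dim_subset[OF sub] by simp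
    have "dim K' \<le> DIM('v)" by (rule dim_subset_UNIV)
    then have "DIM('v) - dim K' < DIM('v) - dim K" using dK by linarith
    from less.hyps[OF this[unfolded K_def K'_def] \<beta>' alt'] obtain m A B where
      m: "\<forall>v w. \<beta>' v w = (\<Sum>i<m. (A i \<bullet> v) * (B i \<bullet> w) - (B i \<bullet> v) * (A i \<bullet> w))" "dim K' + 2 * m \<le> DIM('v)"
      unfolding K'_def by blast
    have "\<beta> v w = (\<Sum>i<Suc m. ((A(m := a)) i \<bullet> v) * ((B(m := c)) i \<bullet> w) - ((B(m := c)) i \<bullet> v) * ((A(m := a)) i \<bullet> w))" for v w
      using m(1)[rule_format, of v w] by (simp add: \<beta>'_def)
    moreover have "dim K + 2 * Suc m \<le> DIM('v)" using m(2) dK by simp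
    ultimately show ?thesis unfolding K_def[symmetric] by blast
  qed
qed

text \<open>The Gram determinant formula for the adequate scalar product. It holds on an orthonormal basis by
  definition when the indices are increasing, in the other cases by antisymmetry, and in general by
  multilinearity. The second part holds because decomposable bivectors span.\<close>

lemma adequate_inner_wedge:
  fixes wedge :: "'v::euclidean_space \<Rightarrow> 'v \<Rightarrow> 'x::euclidean_space"
  assumes w: "bilinear wedge" and alt: "\<And>v. wedge v v = 0" and ad: "adequate wedge"
  shows "wedge a b \<bullet> wedge c d = (a \<bullet> c) * (b \<bullet> d) - (a \<bullet> d) * (b \<bullet> c)"
    and "(\<And>v w. \<omega> \<bullet> wedge v w = 0) \<Longrightarrow> \<omega> = 0"
proof -
  obtain e where e: "bij_betw e {..<DIM('v)} (Basis :: 'v set)"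
    using ex_bij_betw_nat_finite[OF finite_Basis] by (auto simp: atLeast0LessThan)
  have eB: "e i \<in> Basis" if "i < DIM('v)" for i using e that by (auto simp: bij_betw_def)
  have einj: "e i = e j \<longleftrightarrow> i = j" if "i < DIM('v)" "j < DIM('v)" for i j
    using e that by (auto simp: bij_betw_def inj_on_def)
  have ee: "e i \<bullet> e j = (if i = j then 1 else 0)" if "i < DIM('v)" "j < DIM('v)" for i j
    using that by (simp add: inner_Basis eB einj)
  have "e ` {..<DIM('v)} = Basis" using e by (simp add: bij_betw_def)
  then have "orthonormal_basis_on {..<DIM('v)} e"
    unfolding orthonormal_basis_on_def using ee by simp
  with ad have on: "orthonormal_basis_on ({..<DIM('v)} <+> {(i, j). i < j \<and> j < DIM('v)})
          (case_sum (\<lambda>i. (e i, 0 :: 'x)) (\<lambda>(i, j). (0 :: 'v, wedge (e i) (e j))))" (is "orthonormal_basis_on ?I ?f")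
    by (simp add: adequate_def)
  have ww: "wedge (e i) (e j) \<bullet> wedge (e k) (e l) = (if i = k \<and> j = l then 1 else 0)"
    if "i < j" "j < DIM('v)" "k < l" "l < DIM('v)" for i j k l
  proof -
    have "Inr (i, j) \<in> ?I" "Inr (k, l) \<in> ?I" using that by auto
    then have "?f (Inr (i, j)) \<bullet> ?f (Inr (k, l)) = (if (Inr (i, j) :: nat + nat \<times> nat) = Inr (k, l) then 1 else 0)"
      using on unfolding orthonormal_basis_on_def by blast
    then show ?thesis by simp
  qed
  have skew: "wedge v w = - wedge w v" for v w by (rule alternating_skew[OF w alt])
  have basis: "wedge (e i) (e j) \<bullet> wedge (e k) (e l) = (e i \<bullet> e k) * (e j \<bullet> e l) - (e i \<bullet> e l) * (e j \<bullet> e k)"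
    if "i < DIM('v)" "j < DIM('v)" "k < DIM('v)" "l < DIM('v)" for i j k l
  proof -
    have 1: "wedge (e i) (e j) \<bullet> wedge (e k) (e l) = (e i \<bullet> e k) * (e j \<bullet> e l) - (e i \<bullet> e l) * (e j \<bullet> e k)"
      if "i < j" "k < l" "j < DIM('v)" "l < DIM('v)" for i j k l
      using that by (simp add: ww ee)
    have 2: "wedge (e i) (e j) \<bullet> wedge (e k) (e l) = (e i \<bullet> e k) * (e j \<bullet> e l) - (e i \<bullet> e l) * (e j \<bullet> e k)"
      if ij: "i < j" "j < DIM('v)" "k < DIM('v)" "l < DIM('v)" for i j k l
    proof -
      consider "k < l" | "k = l" | "l < k" by linarith
      then show ?thesis
      proof cases
        case 3
        then show ?thesis using 1[OF ij(1) 3 ij(2,3)] skew[of "e k" "e l"] by simp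
      qed (use 1 ij alt in auto)
    qed
    consider "i < j" | "i = j" | "j < i" by linarith
    then show ?thesis
    proof cases
      case 3
      then show ?thesis using 2[OF 3 that(1,3,4)] skew[of "e i" "e j"] by simp
    qed (use 2 that alt in auto)
  qed
  have all: "wedge a b \<bullet> wedge c d = (a \<bullet> c) * (b \<bullet> d) - (a \<bullet> d) * (b \<bullet> c)" for a b c d
  proof -
    have Be: "\<exists>i<DIM('v). v = e i" if "v \<in> Basis" for v
      using e that by (auto simp: bij_betw_def image_iff)
    have step1: "wedge a b \<bullet> wedge c d = (a \<bullet> c) * (b \<bullet> d) - (a \<bullet> d) * (b \<bullet> c)"
      if cd: "c \<in> Basis" "d \<in> Basis" for a b c d
    proof -
      have b1: "bilinear (\<lambda>a b. wedge a b \<bullet> wedge c d)" for c d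
        unfolding bilinear_def by (auto intro!: linearI
          simp: bilinear_ladd[OF w] bilinear_radd[OF w] bilinear_lmul[OF w] bilinear_rmul[OF w] inner_add_left)
      have b2: "bilinear (\<lambda>a b. (a \<bullet> c) * (b \<bullet> d) - (a \<bullet> d) * (b \<bullet> c))" for c d
        unfolding bilinear_def by (auto intro!: linearI simp: inner_add_left algebra_simps)
      have "(\<lambda>a b. wedge a b \<bullet> wedge c d) = (\<lambda>a b. (a \<bullet> c) * (b \<bullet> d) - (a \<bullet> d) * (b \<bullet> c))"
      proof (rule bilinear_eq_stdbasis[OF b1 b2])
        fix i j :: 'v assume "i \<in> Basis" "j \<in> Basis"
        with cd Be obtain i' j' k l where "i' < DIM('v)" "j' < DIM('v)" "k < DIM('v)" "l < DIM('v)"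
          "i = e i'" "j = e j'" "c = e k" "d = e l" by metis
        then show "wedge i j \<bullet> wedge c d = (i \<bullet> c) * (j \<bullet> d) - (i \<bullet> d) * (j \<bullet> c)" using basis by simp
      qed
      then show ?thesis by (rule fun_cong[THEN fun_cong])
    qed
    have b1: "bilinear (\<lambda>c d. wedge a b \<bullet> wedge c d)" for a b
      unfolding bilinear_def by (auto intro!: linearI
        simp: bilinear_ladd[OF w] bilinear_radd[OF w] bilinear_lmul[OF w] bilinear_rmul[OF w] inner_add_right)
    have b2: "bilinear (\<lambda>c d. (a \<bullet> c) * (b \<bullet> d) - (a \<bullet> d) * (b \<bullet> c))" for a b
      unfolding bilinear_def by (auto intro!: linearI simp: inner_add_right algebra_simps)
    have "(\<lambda>c d. wedge a b \<bullet> wedge c d) = (\<lambda>c d. (a \<bullet> c) * (b \<bullet> d) - (a \<bullet> d) * (b \<bullet> c))"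
      by (rule bilinear_eq_stdbasis[OF b1 b2]) (rule step1)
    then show ?thesis by (rule fun_cong[THEN fun_cong])
  qed
  then show "wedge a b \<bullet> wedge c d = (a \<bullet> c) * (b \<bullet> d) - (a \<bullet> d) * (b \<bullet> c)" .
  show "\<omega> = 0" if \<omega>: "\<And>v w. \<omega> \<bullet> wedge v w = 0"
  proof -
    have "orthogonal (0 :: 'v, \<omega>) y" if "y \<in> span (?f ` ?I)" for y
    proof (rule orthogonal_to_span[OF that])
      fix x assume "x \<in> ?f ` ?I"
      then show "orthogonal (0, \<omega>) x" using \<omega> by (auto simp: orthogonal_def)
    qed
    moreover have "span (?f ` ?I) = UNIV" using on by (simp add: orthonormal_basis_on_def)
    ultimately have "orthogonal (0 :: 'v, \<omega>) (0, \<omega>)" by blast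
    then show ?thesis by (simp add: orthogonal_def)
  qed
qed

text \<open>A bivector is determined by the alternating form it defines through the scalar product, so the
  symplectic normal form of that form can be read as a sum of decomposable bivectors.\<close>

lemma bivector_decomposition:
  fixes wedge :: "'v::euclidean_space \<Rightarrow> 'v \<Rightarrow> 'x::euclidean_space"
  assumes w: "bilinear wedge" and alt: "\<And>v. wedge v v = 0" and ad: "adequate wedge"
  shows "\<exists>m a b. \<omega> = (\<Sum>i<m. wedge (a i) (b i)) \<and> dim {v. \<forall>u. \<omega> \<bullet> wedge v u = 0} + 2 * m \<le> DIM('v)"
proof -
  have \<beta>: "bilinear (\<lambda>v u. \<omega> \<bullet> wedge v u)"
    unfolding bilinear_def by (auto intro!: linearI
      simp: bilinear_ladd[OF w] bilinear_radd[OF w] bilinear_lmul[OF w] bilinear_rmul[OF w] inner_add_right)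
  obtain m a b where m: "\<And>v u. \<omega> \<bullet> wedge v u = (\<Sum>i<m. (a i \<bullet> v) * (b i \<bullet> u) - (b i \<bullet> v) * (a i \<bullet> u))"
    "dim {v. \<forall>u. \<omega> \<bullet> wedge v u = 0} + 2 * m \<le> DIM('v)"
    using alternating_form_decomposition[OF \<beta>] alt by auto
  have "(\<omega> - (\<Sum>i<m. wedge (a i) (b i))) \<bullet> wedge v u = 0" for v u
    by (simp add: inner_diff_left inner_sum_left m(1) adequate_inner_wedge(1)[OF w alt ad] mult.commute)
  then have "\<omega> - (\<Sum>i<m. wedge (a i) (b i)) = 0" by (rule adequate_inner_wedge(2)[OF w alt ad])
  then have "\<omega> = (\<Sum>i<m. wedge (a i) (b i))" by simp
  with m(2) show ?thesis by (intro exI conjI)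
qed

lemma dim_kernel_bivector_rank:
  fixes wedge :: "'v::euclidean_space \<Rightarrow> 'v \<Rightarrow> 'x::euclidean_space"
  assumes w: "bilinear wedge" and alt: "\<And>v. wedge v v = 0" and ad: "adequate wedge"
  shows "dim {v. \<forall>u. \<omega> \<bullet> wedge v u = 0} + 2 * bivector_rank wedge \<omega> \<le> DIM('v)"
    and "\<omega> \<noteq> 0 \<Longrightarrow> bivector_rank wedge \<omega> \<noteq> 0"
proof -
  obtain m a b where m: "\<omega> = (\<Sum>i<m. wedge (a i) (b i))" "dim {v. \<forall>u. \<omega> \<bullet> wedge v u = 0} + 2 * m \<le> DIM('v)"
    using bivector_decomposition[where wedge = wedge, OF w alt ad, of \<omega>] by (elim exE conjE)
  then have "bivector_rank wedge \<omega> \<le> m" unfolding bivector_rank_def by (intro Least_le) auto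
  with m(2) show "dim {v. \<forall>u. \<omega> \<bullet> wedge v u = 0} + 2 * bivector_rank wedge \<omega> \<le> DIM('v)" by simp
  have "\<exists>(k::nat) v u. \<omega> = (\<Sum>i<k. wedge (v i) (u i))" by (rule exI[of _ m], rule exI[of _ a], rule exI[of _ b]) (rule m(1))
  then have "\<exists>v u. \<omega> = (\<Sum>i<bivector_rank wedge \<omega>. wedge (v i) (u i))"
    unfolding bivector_rank_def by (rule LeastI_ex)
  then show "bivector_rank wedge \<omega> \<noteq> 0" if "\<omega> \<noteq> 0" using that by (metis lessThan_0 sum.empty)
qed

section \<open>The abnormal set\<close>

text \<open>Only the projection onto the kernel remains to be supplied.\<close>

lemma abnormal_set_subset_kernel_pairs:
  fixes wedge :: "'v::euclidean_space \<Rightarrow> 'v \<Rightarrow> 'x::euclidean_space" and \<pi> :: "'x \<Rightarrow> 'q::euclidean_space"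
  assumes h: "bilinear (\<lambda>a b. \<pi> (wedge a b))" and alt: "\<And>a. wedge a a = 0"
  shows "abnormal_set wedge \<pi> \<subseteq> kernel_pairs (\<lambda>a b. \<pi> (wedge a b))"
proof
  fix p assume "p \<in> abnormal_set wedge \<pi>"
  from abnormal_point_kernel[where wedge = wedge and \<pi> = \<pi>, OF h alt this]
  obtain \<mu> where \<mu>: "\<mu> \<noteq> 0" "\<forall>w. \<mu> \<bullet> \<pi> (wedge (fst p) w) = 0"
    and rep: "\<forall>P. linear P \<longrightarrow> (\<forall>a. (\<forall>w. \<mu> \<bullet> \<pi> (wedge a w) = 0) \<longrightarrow> P a = a) \<longrightarrow>
       (\<exists>\<zeta>. snd p = (\<Sum>b\<in>Basis. \<Sum>c\<in>Basis. \<zeta> b c *\<^sub>R \<pi> (wedge (P b) (P c))))"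
    by (elim exE conjE)
  let ?U = "form_kernel (\<lambda>a b. \<pi> (wedge a b)) \<mu>"
  obtain P where P: "linear P" "\<forall>a\<in>?U. P a = a" "range P = ?U"
    using subspace_projection_exists[OF subspace_form_kernel[OF h, of \<mu>]] by (elim exE conjE)
  from P(2) have PU: "\<forall>a. (\<forall>w. \<mu> \<bullet> \<pi> (wedge a w) = 0) \<longrightarrow> P a = a" by (simp add: form_kernel_def)
  from rep[THEN spec[of _ P], THEN mp, OF P(1), THEN mp, OF PU]
  obtain \<zeta> where "snd p = (\<Sum>b\<in>Basis. \<Sum>c\<in>Basis. \<zeta> b c *\<^sub>R \<pi> (wedge (P b) (P c)))"
    by (elim exE)
  moreover have "fst p \<in> ?U" using \<mu>(2) by (simp add: form_kernel_def)
  ultimately show "p \<in> kernel_pairs (\<lambda>a b. \<pi> (wedge a b))"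
    unfolding kernel_pairs_def case_prod_beta mem_Collect_eq using \<mu>(1) P
    by (intro exI[of _ \<mu>] exI[of _ P] exI[of _ \<zeta>] conjI)
qed

theorem theorem1p1:
  fixes wedge :: "'v::euclidean_space \<Rightarrow> 'v \<Rightarrow> 'x::euclidean_space"
    and \<pi> :: "'x \<Rightarrow> 'q::euclidean_space"
    and W :: "'x set"
    and k :: nat
  assumes "DIM('v) \<ge> 2"
    and "exterior_square wedge"
    and "adequate wedge"
    and "subspace W"
    and "quotient_map_by W \<pi>"
    and "k = Inf (bivector_rank wedge ` (W\<^sup>\<bottom> - {0}))"
  shows "(\<exists>Z. algebraic_variety Z \<and> abnormal_set wedge \<pi> \<subseteq> Z \<and> codim Z = ereal (real (2 * k + 1)))
    \<and> codim (abnormal_set wedge \<pi>) \<ge> 3"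
proof -
  have w: "bilinear wedge" and alt: "\<And>v. wedge v v = 0"
    using assms(2) by (auto simp: exterior_square_def)
  have \<pi>: "linear \<pi>" "surj \<pi>" "{\<omega>. \<pi> \<omega> = 0} = W" using assms(5) by (auto simp: quotient_map_by_def)
  define h where "h = (\<lambda>a b. \<pi> (wedge a b))"
  have h: "bilinear h" unfolding h_def bilinear_def
    by (auto intro!: linearI simp: bilinear_ladd[OF w] bilinear_radd[OF w] bilinear_lmul[OF w] bilinear_rmul[OF w]
        linear_add[OF \<pi>(1)] linear_scale[OF \<pi>(1)])
  have h_skew: "h a b = - h b a" for a b
    by (rule alternating_skew[OF h]) (simp add: h_def alt linear_0[OF \<pi>(1)])
  have adj: "\<mu> \<bullet> h a b = adjoint \<pi> \<mu> \<bullet> wedge a b" for \<mu> a b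
    using adjoint_works[OF \<pi>(1), of "wedge a b" \<mu>] by (simp add: h_def inner_commute)
  have adj_in: "adjoint \<pi> \<mu> \<in> W\<^sup>\<bottom> - {0}" if "\<mu> \<noteq> 0" for \<mu>
  proof
    show "adjoint \<pi> \<mu> \<in> W\<^sup>\<bottom>"
      unfolding orthogonal_comp_def orthogonal_def mem_Collect_eq
    proof
      fix y assume "y \<in> W"
      then have "\<pi> y = 0" using \<pi>(3) by blast
      then show "y \<bullet> adjoint \<pi> \<mu> = 0" by (simp add: adjoint_works[OF \<pi>(1)])
    qed
    obtain y where "\<mu> = \<pi> y" using \<pi>(2) by (metis surjD)
    then have "y \<bullet> adjoint \<pi> \<mu> \<noteq> 0" using that by (simp add: adjoint_works[OF \<pi>(1)])
    then show "adjoint \<pi> \<mu> \<notin> {0}" by auto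
  qed
  have rank_ge: "k \<le> bivector_rank wedge \<omega>" if "\<omega> \<in> W\<^sup>\<bottom> - {0}" for \<omega>
    unfolding assms(6) by (rule cInf_lower) (use that in auto)
  have ker: "dim (form_kernel h \<mu>) + 2 * k \<le> DIM('v)" if "\<mu> \<noteq> 0" for \<mu>
  proof -
    have "form_kernel h \<mu> = {v. \<forall>u. adjoint \<pi> \<mu> \<bullet> wedge v u = 0}" by (simp add: form_kernel_def adj)
    then show ?thesis
      using dim_kernel_bivector_rank(1)[where wedge = wedge, OF w alt assms(3), of "adjoint \<pi> \<mu>"]
        rank_ge[OF adj_in[OF that]] by simp
  qed
  obtain \<mu>0 :: 'q where \<mu>0: "\<mu>0 \<noteq> 0" using nonzero_Basis nonempty_Basis by blast
  have k1: "1 \<le> k"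
  proof -
    have "bivector_rank wedge ` (W\<^sup>\<bottom> - {0}) \<noteq> {}" using adj_in[OF \<mu>0] by blast
    then have "k \<in> bivector_rank wedge ` (W\<^sup>\<bottom> - {0})" unfolding assms(6) by (rule Inf_nat_def1)
    then obtain \<omega> where \<omega>: "\<omega> \<noteq> 0" "k = bivector_rank wedge \<omega>" by blast
    have "k \<noteq> 0"
      using dim_kernel_bivector_rank(2)[where wedge = wedge, OF w alt assms(3) \<omega>(1)] \<omega>(2) by simp
    then show ?thesis by simp
  qed
  \<comment> \<open>the subtraction is exact: the kernel bound gives \<open>2 * k \<le> DIM('v)\<close>, and \<open>DIM('q)\<close> is positive\<close>
  define p where "p = DIM('v \<times> 'q) - (2 * k + 1)"
  have p: "p + (2 * k + 1) = DIM('v \<times> 'q)" "Suc p = DIM('q) + (DIM('v) - 2 * k)"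
    using ker[OF \<mu>0] DIM_positive[where 'a = 'q] DIM_prod[where 'a = 'v and 'b = 'q] unfolding p_def by linarith+
  obtain L :: "('v \<times> 'q) set" where L: "subspace L" "dim L = p"
    using choose_subspace_of_subspace[of p "UNIV :: ('v \<times> 'q) set"] p(1) by (metis dim_UNIV le_add1)
  define Z where "Z = zariski_closure (kernel_pairs h \<union> L)"
  have Z: "algebraic_variety Z" "kernel_pairs h \<subseteq> Z" "L \<subseteq> Z"
    using zariski_closure_subset[of "kernel_pairs h \<union> L"] by (auto simp: Z_def algebraic_variety_zariski_closure)
  have Abn: "abnormal_set wedge \<pi> \<subseteq> Z"
    using abnormal_set_subset_kernel_pairs[where wedge = wedge and \<pi> = \<pi>, OF h[unfolded h_def] alt] Z(2)
    unfolding h_def by blast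
  have "alg_dependent (Suc p) f Z" if f: "\<forall>j<Suc p. real_polynomial_function (f j)" for f :: "nat \<Rightarrow> 'v \<times> 'q \<Rightarrow> real"
    unfolding Z_def
  proof (intro alg_dependent_zariski_closure[OF f] alg_dependent_Un)
    show "alg_dependent (Suc p) f (kernel_pairs h)"
    proof (rule alg_dependent_kernel_pairs[OF h h_skew _ f])
      show "dim (form_kernel h \<mu>) \<le> DIM('v) - 2 * k" if "\<mu> \<noteq> 0" for \<mu> using ker[OF that] by simp
    qed (simp add: p(2))
    show "alg_dependent (Suc p) f L" by (rule alg_dependent_subspace[OF L(1) _ f]) (simp add: L(2))
  qed
  then have "variety_dim Z \<le> ereal (real p)" by (rule variety_dim_le)
  moreover have "ereal (real p) \<le> variety_dim Z" using variety_dim_ge_subspace[OF L(1) Z(3)] L(2) by simp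
  ultimately have dimZ: "variety_dim Z = ereal (real p)" by simp
  have pk: "real DIM('v \<times> 'q) - real p = real (2 * k + 1)" using p(1) by linarith
  have "codim Z = ereal (real (2 * k + 1))"
    unfolding codim_def zariski_closure_variety[OF Z(1)] dimZ ereal_minus pk ..
  moreover have "codim (abnormal_set wedge \<pi>) \<ge> 3"
  proof -
    have "variety_dim (zariski_closure (abnormal_set wedge \<pi>)) \<le> ereal (real p)"
    proof -
      have "variety_dim (zariski_closure (abnormal_set wedge \<pi>)) \<le> variety_dim Z"
        unfolding variety_dim_def using zariski_closure_minimal[OF Z(1) Abn]
        by (intro Sup_subset_mono) blast
      with dimZ show ?thesis by simp
    qed
    then have "ereal (real DIM('v \<times> 'q)) - ereal (real p) \<le> codim (abnormal_set wedge \<pi>)"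
      unfolding codim_def by (intro ereal_minus_mono) auto
    moreover have "(3::ereal) \<le> ereal (real (2 * k + 1))" using k1 by simp
    ultimately show ?thesis unfolding ereal_minus pk by (rule order_trans[rotated])
  qed
  ultimately show ?thesis using Z(1) Abn by blast
qed

end
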